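(* Let $X$ be a compact connected metrizable Abelian group. Then: (i) $\mathfrak{F}_0(X)$ is a monothetic connected Polish non-Schwartz Abelian group. (ii) $\mathfrak{F}_0(X)$ does not have the Schur property, and hence it does not respect compactness. (iii) $c_0(\mathfrak{F}_0(X))$ is $\mathfrak{g}$-closed in $\mathfrak{F}_0(X)^{\mathbb{N}}$ (with the product topology).
   Context: For an Abelian topological group $Y$, $c_0(Y)=\{(y_n)_{n\in\mathbb{N}}\in Y^{\mathbb{N}}:\lim_n y_n=0\}$, and $\mathfrak{F}_0(Y)$ denotes the group $c_0(Y)$ with the uniform topology, i.e. the group topology with base at $0$ given by the sets $V^{\mathbb{N}}\cap c_0(Y)$, $V$ an open neighborhood of $0$ in $Y$. A topological group is monothetic if it has a dense cyclic subgroup, and Polish if it is separable and completely metrizable. $\widehat{G}$ denotes the group of all continuous characters of an Abelian topological group $G$; $G$ is MAP if $\widehat{G}$ separates points. For MAP Abelian $G$, $G^+$ is $G$ with the weakest group topology making all elements of $\widehat{G}$ continuous. $G$ has the Schur property if $G$ and $G^+$ have the same convergent sequences; $G$ respects compactness if $G$ and $G^+$ have the same compact subsets. A Hausdorff Abelian group $G$ is a Schwartz group if for every neighborhood $U$ of $0$ there is a sequence $\{F_n\}_{n\in\mathbb{N}}$ of finite subsets of $G$ such that $\bigcap_{n\in\mathbb{N}}\left((1/n)U+F_n\right)$ is a neighborhood of $0$, where $(1/n)U:=\{x\in G: kx\in U\ \text{for all }1\le k\le n\}$; a non-Schwartz group is one that is not a Schwartz group. For a sequence $\mathbf{u}=\{u_n\}$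 in $\widehat{G}$ put $s_{\mathbf{u}}(G):=\{x\in G: (u_n,x)\to 1\}$, where $(u,x)$ is the value of the character $u$ at $x$. A subgroup $H$ of $G$ is $\mathfrak{g}$-closed in $G$ if $H=\bigcap\{s_{\mathbf{u}}(G): \mathbf{u}\in\widehat{G}^{\mathbb{N}},\ H\le s_{\mathbf{u}}(G)\}$.
   Formalization: The claims that F_0(X) is non-Schwartz, lacks the Schur property and does not respect compactness are stated for nontrivial X only, since for X = {0} the group F_0(X) is trivial and all three fail; the other claims hold for every X. *)

theory Defs
  imports
    "HOL-Analysis.Analysis"
    "HOL-Library.Function_Algebras"
    "HOL-Computational_Algebra.Group_Closure"
begin

section \<open>Powers of topological Abelian groups\<close>

text \<open>
  The type of functions already carries the product topology (\<^theory>\<open>HOL-Analysis.Function_Topology\<close>)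
  and the pointwise group structure (\<^theory>\<open>HOL-Library.Function_Algebras\<close>).
\<close>

lemma nhds_fun_tendsto_iff:
  fixes l :: "'b \<Rightarrow> 'c::topological_space"
  shows "(f \<longlongrightarrow> l) F \<longleftrightarrow> (\<forall>i. ((\<lambda>x. f x i) \<longlongrightarrow> l i) F)"
proof -
  have "(f \<longlongrightarrow> l) F \<longleftrightarrow> limitin (product_topology (\<lambda>i. euclidean) UNIV) f l F"
    by (simp add: euclidean_product_topology)
  also have "\<dots> \<longleftrightarrow> (\<forall>i. ((\<lambda>x. f x i) \<longlongrightarrow> l i) F)"
    by (subst limitin_componentwise) simp
  finally show ?thesis .
qed

instance "fun" :: (type, topological_monoid_add) topological_monoid_add
proof
  fix a b :: "'a \<Rightarrow> 'b"
  have 1: "((\<lambda>x. fst x i) \<longlongrightarrow> a i) (nhds a \<times>\<^sub>F nhds b)" for i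
    using nhds_fun_tendsto_iff[of fst a "nhds a \<times>\<^sub>F nhds b"] filterlim_fst[of "nhds a" "nhds b"]
    by blast
  have 2: "((\<lambda>x. snd x i) \<longlongrightarrow> b i) (nhds a \<times>\<^sub>F nhds b)" for i
    using nhds_fun_tendsto_iff[of snd b "nhds a \<times>\<^sub>F nhds b"] filterlim_snd[of "nhds b" "nhds a"]
    by blast
  show "((\<lambda>x. fst x + snd x) \<longlongrightarrow> a + b) (nhds a \<times>\<^sub>F nhds b)"
    unfolding nhds_fun_tendsto_iff by (auto intro!: tendsto_add 1 2)
qed

instance "fun" :: (type, topological_group_add) topological_group_add
proof
  fix a :: "'a \<Rightarrow> 'b"
  have "((\<lambda>x. x i) \<longlongrightarrow> a i) (nhds a)" for i
    using nhds_fun_tendsto_iff[of "\<lambda>x. x" a "nhds a"] filterlim_ident by blast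
  then show "(uminus \<longlongrightarrow> - a) (nhds a)"
    unfolding nhds_fun_tendsto_iff by (auto intro!: tendsto_minus)
qed

instance "fun" :: (type, topological_ab_group_add) topological_ab_group_add ..


section \<open>Null sequences\<close>

definition null_sequences :: "(nat \<Rightarrow> 'g::topological_ab_group_add) set" where
  "null_sequences = {y. y \<longlonglongrightarrow> 0}"

lemma null_sequences_0: "0 \<in> null_sequences"
  by (simp add: null_sequences_def zero_fun_def)

lemma null_sequences_add: "x \<in> null_sequences \<Longrightarrow> y \<in> null_sequences \<Longrightarrow> x + y \<in> null_sequences"
  using tendsto_add[of x 0 sequentially y 0] by (simp add: null_sequences_def plus_fun_def)

lemma null_sequences_uminus: "x \<in> null_sequences \<Longrightarrow> - x \<in> null_sequences"
  using tendsto_minus[of x 0 sequentially] by (simp add: null_sequences_def fun_Compl_def)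

lemma null_sequences_diff: "x \<in> null_sequences \<Longrightarrow> y \<in> null_sequences \<Longrightarrow> x - y \<in> null_sequences"
  using null_sequences_add[of x "- y"] null_sequences_uminus[of y] by simp

typedef (overloaded) ('g::topological_ab_group_add) F0 = "null_sequences :: (nat \<Rightarrow> 'g) set"
  morphisms seq_of F0_of
  using null_sequences_0 by blast

instantiation F0 :: (topological_ab_group_add) ab_group_add
begin

definition zero_F0 :: "'a F0" where "0 = F0_of 0"
definition plus_F0 :: "'a F0 \<Rightarrow> 'a F0 \<Rightarrow> 'a F0" where "x + y = F0_of (seq_of x + seq_of y)"
definition uminus_F0 :: "'a F0 \<Rightarrow> 'a F0" where "- x = F0_of (- seq_of x)"
definition minus_F0 :: "'a F0 \<Rightarrow> 'a F0 \<Rightarrow> 'a F0" where "x - y = F0_of (seq_of x - seq_of y)"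

lemma seq_of_zero: "seq_of (0 :: 'a F0) = 0"
  by (simp add: zero_F0_def F0_of_inverse null_sequences_0)

lemma seq_of_plus: "seq_of (x + y :: 'a F0) = seq_of x + seq_of y"
  unfolding plus_F0_def using seq_of[of x] seq_of[of y] by (intro F0_of_inverse null_sequences_add)

lemma seq_of_uminus: "seq_of (- x :: 'a F0) = - seq_of x"
  unfolding uminus_F0_def using seq_of[of x] by (intro F0_of_inverse null_sequences_uminus)

lemma seq_of_minus: "seq_of (x - y :: 'a F0) = seq_of x - seq_of y"
  unfolding minus_F0_def using seq_of[of x] seq_of[of y] by (intro F0_of_inverse null_sequences_diff)

instance
proof
  fix a b c :: "'a F0"
  note F0_simps = seq_of_inject[symmetric] seq_of_zero seq_of_plus seq_of_uminus seq_of_minus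
  show "a + b + c = a + (b + c)" by (simp only: F0_simps add.assoc)
  show "a + b = b + a" by (simp only: F0_simps add.commute)
  show "0 + a = a" by (simp only: F0_simps add_0_left)
  show "- a + a = 0" by (simp only: F0_simps left_minus)
  show "a - b = a + - b" by (simp only: F0_simps diff_conv_add_uminus)
qed

end

lemma open_nbhd_zero_inter:
  "\<exists>V. open V \<and> 0 \<in> V \<and> V \<subseteq> V1 \<inter> V2"
  if "open V1" "0 \<in> V1" "open V2" "(0::'a::topological_ab_group_add) \<in> V2"
  using that by (intro exI[of _ "V1 \<inter> V2"]) auto

text \<open>
  The uniform topology: the sets of all elements whose coordinates lie in \<open>V\<close>, for \<open>V\<close> an open
  neighbourhood of \<open>0\<close>, form a base of neighbourhoods of \<open>0\<close>, and their translates one of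
  neighbourhoods elsewhere (see \<open>eventually_nhds_F0\<close> below).
\<close>

instantiation F0 :: (topological_ab_group_add) topological_space
begin

definition open_F0 :: "'a F0 set \<Rightarrow> bool" where
  "open_F0 S \<longleftrightarrow>
    (\<forall>x\<in>S. \<exists>V. open V \<and> 0 \<in> V \<and> {y. \<forall>n. seq_of (y - x) n \<in> V} \<subseteq> S)"

instance
proof
  show "open (UNIV :: 'a F0 set)"
    unfolding open_F0_def by (auto intro: exI[of _ UNIV])
next
  fix S T :: "'a F0 set"
  assume S: "open S" and T: "open T"
  show "open (S \<inter> T)"
    unfolding open_F0_def
  proof
    fix x assume x: "x \<in> S \<inter> T"
    obtain V1 where V1: "open V1" "0 \<in> V1" "{y. \<forall>n. seq_of (y - x) n \<in> V1} \<subseteq> S"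
      using S x unfolding open_F0_def by blast
    obtain V2 where V2: "open V2" "0 \<in> V2" "{y. \<forall>n. seq_of (y - x) n \<in> V2} \<subseteq> T"
      using T x unfolding open_F0_def by blast
    obtain V where "open V" "0 \<in> V" "V \<subseteq> V1 \<inter> V2"
      using open_nbhd_zero_inter[OF V1(1,2) V2(1,2)] by blast
    then show "\<exists>V. open V \<and> 0 \<in> V \<and> {y. \<forall>n. seq_of (y - x) n \<in> V} \<subseteq> S \<inter> T"
      using V1(3) V2(3) by (intro exI[of _ V]) blast
  qed
next
  fix K :: "'a F0 set set"
  assume K: "\<forall>S\<in>K. open S"
  show "open (\<Union>K)"
    unfolding open_F0_def
  proof
    fix x assume "x \<in> \<Union>K"
    then obtain S where S: "S \<in> K" "x \<in> S" by blast
    then obtain V where "open V" "0 \<in> V" "{y. \<forall>n. seq_of (y - x) n \<in> V} \<subseteq> S"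
      using K unfolding open_F0_def by blast
    then show "\<exists>V. open V \<and> 0 \<in> V \<and> {y. \<forall>n. seq_of (y - x) n \<in> V} \<subseteq> \<Union>K"
      using S(1) by blast
  qed
qed

end

lemma zero_add_nbhd:
  fixes V :: "'a::topological_ab_group_add set"
  assumes "open V" "0 \<in> V"
  obtains W where "open W" "0 \<in> W" "\<And>x y. x \<in> W \<Longrightarrow> y \<in> W \<Longrightarrow> x + y \<in> V"
proof -
  have "filterlim (\<lambda>x. fst x + snd x) (nhds (0 + 0)) (nhds (0::'a) \<times>\<^sub>F nhds 0)"
    by (rule tendsto_add_Pair)
  then have "eventually (\<lambda>x. fst x + snd x \<in> V) (nhds (0::'a) \<times>\<^sub>F nhds 0)"
    using assms topological_tendstoD by force
  then obtain P Q where P: "eventually P (nhds (0::'a))" and Q: "eventually Q (nhds (0::'a))"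
    and PQ: "\<And>x y. P x \<Longrightarrow> Q y \<Longrightarrow> x + y \<in> V"
    unfolding eventually_prod_filter by auto
  obtain A where A: "open A" "0 \<in> A" "\<forall>x\<in>A. P x" using P unfolding eventually_nhds by blast
  obtain B where B: "open B" "0 \<in> B" "\<forall>x\<in>B. Q x" using Q unfolding eventually_nhds by blast
  show thesis
    by (rule that[of "A \<inter> B"]) (use A B PQ in auto)
qed

lemma zero_uminus_nbhd:
  fixes V :: "'a::topological_ab_group_add set"
  assumes "open V" "0 \<in> V"
  obtains W where "open W" "0 \<in> W" "\<And>x. x \<in> W \<Longrightarrow> - x \<in> V"
proof -
  have "eventually (\<lambda>x. - x \<in> V) (nhds (0::'a))"
    using topological_tendstoD[OF tendsto_uminus_nhds[of "0::'a"], of V] assms by simp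
  then show thesis
    using that unfolding eventually_nhds by blast
qed

lemma eventually_nhds_F0:
  fixes x :: "'a::topological_ab_group_add F0"
  shows "eventually P (nhds x) \<longleftrightarrow>
    (\<exists>V. open V \<and> 0 \<in> V \<and> (\<forall>y. (\<forall>n. seq_of (y - x) n \<in> V) \<longrightarrow> P y))" (is "?L \<longleftrightarrow> ?R")
proof
  assume ?L
  then obtain S where "open S" "x \<in> S" "\<forall>y\<in>S. P y" unfolding eventually_nhds by blast
  moreover from this obtain V where "open V" "0 \<in> V" "{y. \<forall>n. seq_of (y - x) n \<in> V} \<subseteq> S"
    unfolding open_F0_def by meson
  ultimately show ?R by (intro exI[of _ V]) auto
next
  assume ?R
  define S where
    "S = {z. \<exists>V. open V \<and> 0 \<in> V \<and> (\<forall>y. (\<forall>n. seq_of (y - z) n \<in> V) \<longrightarrow> P y)}"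
  have "x \<in> S" using \<open>?R\<close> by (simp add: S_def)
  moreover have "P z" if "z \<in> S" for z
    using that by (auto simp: S_def seq_of_zero)
  moreover have "open S"
    unfolding open_F0_def
  proof
    fix z assume "z \<in> S"
    then obtain V where V: "open V" "0 \<in> V" "\<And>y. (\<forall>n. seq_of (y - z) n \<in> V) \<Longrightarrow> P y"
      by (auto simp: S_def)
    obtain W where W: "open W" "0 \<in> W" "\<And>x y. x \<in> W \<Longrightarrow> y \<in> W \<Longrightarrow> x + y \<in> V"
      using zero_add_nbhd[OF V(1,2)] by blast
    have "w \<in> S" if w: "\<forall>n. seq_of (w - z) n \<in> W" for w
      unfolding S_def
    proof (intro CollectI exI[of _ W] conjI allI impI W(1,2))
      fix y assume y: "\<forall>n. seq_of (y - w) n \<in> W"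
      have "seq_of (y - z) n = seq_of (y - w) n + seq_of (w - z) n" for n
        by (simp add: seq_of_minus)
      then show "P y" using W(3) y w by (intro V(3)) simp
    qed
    then show "\<exists>V. open V \<and> 0 \<in> V \<and> {y. \<forall>n. seq_of (y - z) n \<in> V} \<subseteq> S"
      using W(1,2) by blast
  qed
  ultimately show ?L unfolding eventually_nhds by blast
qed

instance F0 :: (topological_ab_group_add) topological_ab_group_add
proof
  fix a b :: "'a F0"
  show "((\<lambda>x. fst x + snd x) \<longlongrightarrow> a + b) (nhds a \<times>\<^sub>F nhds b)"
    unfolding filterlim_iff
  proof (intro allI impI)
    fix P assume "eventually P (nhds (a + b))"
    then obtain V where V: "open V" "0 \<in> V" "\<And>y. (\<forall>n. seq_of (y - (a + b)) n \<in> V) \<Longrightarrow> P y"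
      unfolding eventually_nhds_F0 by blast
    obtain W where W: "open W" "0 \<in> W" "\<And>x y. x \<in> W \<Longrightarrow> y \<in> W \<Longrightarrow> x + y \<in> V"
      using zero_add_nbhd[OF V(1,2)] by blast
    define Q where "Q c x \<longleftrightarrow> (\<forall>n. seq_of (x - c) n \<in> W)" for c x :: "'a F0"
    have Q: "eventually (Q c) (nhds c)" for c
      unfolding eventually_nhds_F0 Q_def using W(1,2) by blast
    have "P (x + y)" if "Q a x" "Q b y" for x y
    proof (rule V(3), rule allI)
      fix n
      have "seq_of (x + y - (a + b)) n = seq_of (x - a) n + seq_of (y - b) n"
        by (simp add: seq_of_minus seq_of_plus)
      then show "seq_of (x + y - (a + b)) n \<in> V"
        using that W(3) by (simp add: Q_def)
    qed
    then show "eventually (\<lambda>x. P (fst x + snd x)) (nhds a \<times>\<^sub>F nhds b)"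
      unfolding eventually_prod_filter using Q by fastforce
  qed
next
  fix a :: "'a F0"
  show "(uminus \<longlongrightarrow> - a) (nhds a)"
    unfolding filterlim_iff
  proof (intro allI impI)
    fix P assume "eventually P (nhds (- a))"
    then obtain V where V: "open V" "0 \<in> V" "\<And>y. (\<forall>n. seq_of (y - (- a)) n \<in> V) \<Longrightarrow> P y"
      unfolding eventually_nhds_F0 by blast
    obtain W where W: "open W" "0 \<in> W" "\<And>x. x \<in> W \<Longrightarrow> - x \<in> V"
      using zero_uminus_nbhd[OF V(1,2)] by blast
    have "P (- x)" if "\<forall>n. seq_of (x - a) n \<in> W" for x
    proof (rule V(3), rule allI)
      fix n
      have "seq_of (- x - (- a)) n = - seq_of (x - a) n"
        by (simp add: seq_of_minus seq_of_uminus)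
      then show "seq_of (- x - (- a)) n \<in> V"
        using that W(3) by simp
    qed
    then show "eventually (\<lambda>x. P (- x)) (nhds a)"
      unfolding eventually_nhds_F0 using W(1,2) by blast
  qed
qed


section \<open>Monothetic, Polish and Schwartz groups\<close>

definition monothetic :: "'g::topological_ab_group_add itself \<Rightarrow> bool" where
  "monothetic _ \<longleftrightarrow> (\<exists>x::'g. closure (group_closure {x}) = UNIV)"

definition polish :: "'g::topological_space itself \<Rightarrow> bool" where
  "polish _ \<longleftrightarrow> separable_space (euclidean :: 'g topology) \<and>
     completely_metrizable_space (euclidean :: 'g topology)"

text \<open>The sum \<open>\<Sum>i<k. x\<close> is the multiple \<open>k x\<close>.\<close>

definition nbhd_fraction :: "nat \<Rightarrow> 'g::topological_ab_group_add set \<Rightarrow> 'g set" where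
  "nbhd_fraction n U = {x. \<forall>k\<in>{1..n}. (\<Sum>i<k. x) \<in> U}"

definition schwartz_group :: "'g::topological_ab_group_add itself \<Rightarrow> bool" where
  "schwartz_group _ \<longleftrightarrow>
     Hausdorff_space (euclidean :: 'g topology) \<and>
     (\<forall>U::'g set. 0 \<in> interior U \<longrightarrow>
        (\<exists>F :: nat \<Rightarrow> 'g set. (\<forall>n\<ge>1. finite (F n)) \<and>
           0 \<in> interior (\<Inter>n\<in>{1..}. {x + f | x f. x \<in> nbhd_fraction n U \<and> f \<in> F n})))"


section \<open>Characters and the Bohr modification\<close>

definition character_group :: "('g::topological_ab_group_add \<Rightarrow> complex) set" where
  "character_group = {\<phi>. (\<forall>x. norm (\<phi> x) = 1) \<and> (\<forall>x y. \<phi> (x + y) = \<phi> x * \<phi> y) \<and>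
     continuous_on UNIV \<phi>}"

definition MAP_group :: "'g::topological_ab_group_add itself \<Rightarrow> bool" where
  "MAP_group _ \<longleftrightarrow> (\<forall>x y::'g. x \<noteq> y \<longrightarrow> (\<exists>\<phi>\<in>character_group. \<phi> x \<noteq> \<phi> y))"

definition group_topology :: "'g::ab_group_add topology \<Rightarrow> bool" where
  "group_topology T \<longleftrightarrow> topspace T = UNIV \<and>
     continuous_map (prod_topology T T) T (\<lambda>p. fst p + snd p) \<and> continuous_map T T uminus"

definition characters_continuous :: "'g::topological_ab_group_add topology \<Rightarrow> bool" where
  "characters_continuous T \<longleftrightarrow> (\<forall>\<phi>\<in>character_group. continuous_map T euclidean \<phi>)"

text \<open>
  The topology of \<open>G\<^sup>+\<close>: the weakest group topology making all continuous characters continuous.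
  The lemma \<open>bohr_topology_eq\<close> below shows that it exists.
\<close>

definition bohr_topology :: "'g::topological_ab_group_add topology" where
  "bohr_topology = (THE T. group_topology T \<and> characters_continuous T \<and>
     (\<forall>T'. group_topology T' \<and> characters_continuous T' \<longrightarrow>
        (\<forall>U. openin T U \<longrightarrow> openin T' U)))"

lemma bohr_topology_eq:
  "bohr_topology = topology_generated_by
     {\<phi> -` U | \<phi> U. \<phi> \<in> (character_group :: ('g::topological_ab_group_add \<Rightarrow> complex) set) \<and> open U}"
    (is "_ = ?T0")
  and bohr_topology_group_topology: "group_topology (bohr_topology :: 'g topology)"
  and bohr_topology_characters_continuous: "characters_continuous (bohr_topology :: 'g topology)"
proof -
  let ?S = "{\<phi> -` U | \<phi> U. \<phi> \<in> (character_group :: ('g \<Rightarrow> complex) set) \<and> open U}"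
  have "(\<lambda>_::'g. 1::complex) \<in> character_group" by (simp add: character_group_def)
  then have "(\<lambda>_::'g. 1::complex) -` UNIV \<in> ?S" by blast
  then have US: "\<Union>?S = UNIV" by auto
  then have top: "topspace ?T0 = UNIV" by (simp only: topology_generated_by_topspace)
  have cont: "continuous_map ?T0 euclidean \<phi>" if "\<phi> \<in> character_group" for \<phi> :: "'g \<Rightarrow> complex"
    unfolding continuous_map_alt top
    using that by (auto intro!: topology_generated_by_Basis)
  then have chars: "characters_continuous ?T0"
    by (simp add: characters_continuous_def)
  have gen: "continuous_map Z ?T0 f"
    if "\<And>\<phi>::'g \<Rightarrow> complex. \<phi> \<in> character_group \<Longrightarrow> continuous_map Z euclidean (\<lambda>z. \<phi> (f z))"
    for Z :: "'z topology" and f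
    unfolding continuous_on_generated_topo_iff
  proof (intro conjI allI impI)
    fix A assume "A \<in> ?S"
    then obtain \<phi> U where A: "A = \<phi> -` U" and \<phi>: "\<phi> \<in> character_group" and "open U" by blast
    have "openin Z ((\<lambda>z. \<phi> (f z)) -` U \<inter> topspace Z)"
      using that[OF \<phi>] \<open>open U\<close> unfolding continuous_map_alt by simp
    then show "openin Z (f -` A \<inter> topspace Z)"
      by (simp add: A vimage_def)
  qed (simp only: US subset_UNIV)
  have mult: "continuous_map (prod_topology ?T0 ?T0) ?T0 (\<lambda>p. fst p + snd p)"
  proof (rule gen)
    fix \<phi> :: "'g \<Rightarrow> complex" assume \<phi>: "\<phi> \<in> character_group"
    have 1: "continuous_map (prod_topology ?T0 ?T0) euclidean (\<lambda>p. \<phi> (fst p))"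
      using continuous_map_compose[OF continuous_map_fst cont[OF \<phi>], of ?T0] by (simp add: o_def)
    have 2: "continuous_map (prod_topology ?T0 ?T0) euclidean (\<lambda>p. \<phi> (snd p))"
      using continuous_map_compose[OF continuous_map_snd cont[OF \<phi>], of ?T0] by (simp add: o_def)
    have 3: "continuous_map euclidean euclidean (\<lambda>q::complex\<times>complex. fst q * snd q)"
      by (simp add: continuous_on_fst continuous_on_mult continuous_on_snd)
    have 4: "continuous_map (prod_topology ?T0 ?T0) euclidean (\<lambda>p. (\<phi> (fst p), \<phi> (snd p)))"
      using continuous_map_pairedI[OF 1 2] by simp
    have "continuous_map (prod_topology ?T0 ?T0) euclidean (\<lambda>p. \<phi> (fst p) * \<phi> (snd p))"
      using continuous_map_compose[OF 4 3] by (simp add: o_def)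
    then show "continuous_map (prod_topology ?T0 ?T0) euclidean (\<lambda>p. \<phi> (fst p + snd p))"
      using \<phi> by (simp add: character_group_def)
  qed
  have minus: "continuous_map ?T0 ?T0 uminus"
  proof (rule gen)
    fix \<phi> :: "'g \<Rightarrow> complex" assume \<phi>: "\<phi> \<in> character_group"
    have n: "norm (\<phi> x) = 1" and a: "\<phi> (x + y) = \<phi> x * \<phi> y" for x y
      using \<phi> by (auto simp: character_group_def)
    have nz: "\<phi> x \<noteq> 0" for x using n[of x] by auto
    have "\<phi> 0 = 1" using a[of 0 0] nz[of 0] by simp
    then have "\<phi> (- x) * \<phi> x = 1" for x using a[of "- x" x] by simp
    moreover have "cnj (\<phi> x) * \<phi> x = 1" for x
      using n[of x] complex_norm_square[of "\<phi> x"] by (simp add: mult.commute)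
    ultimately have eq: "\<phi> (- x) = cnj (\<phi> x)" for x
      using nz[of x] by (metis mult_cancel_right)
    have "continuous_map euclidean euclidean cnj"
      by (simp add: continuous_on_cnj)
    then show "continuous_map ?T0 euclidean (\<lambda>z. \<phi> (- z))"
      unfolding eq using continuous_map_compose[OF cont[OF \<phi>], of euclidean cnj] by (simp add: o_def)
  qed
  have grp: "group_topology ?T0"
    unfolding group_topology_def using top mult minus by blast
  have least: "openin T' U"
    if "characters_continuous T'" "group_topology T'" "openin ?T0 U" for T' :: "'g topology" and U
  proof -
    have "continuous_map T' ?T0 (\<lambda>x. x)"
      by (rule gen) (use that(1) in \<open>simp add: characters_continuous_def\<close>)
    then show ?thesis
      using that(2,3) unfolding continuous_map_alt group_topology_def by fastforce
  qed
  show eq: "bohr_topology = ?T0"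
    unfolding bohr_topology_def
  proof (rule the_equality)
    show "group_topology ?T0 \<and> characters_continuous ?T0 \<and>
      (\<forall>T'. group_topology T' \<and> characters_continuous T' \<longrightarrow> (\<forall>U. openin ?T0 U \<longrightarrow> openin T' U))"
      using grp chars least by blast
  next
    fix T :: "'g topology"
    assume T: "group_topology T \<and> characters_continuous T \<and>
      (\<forall>T'. group_topology T' \<and> characters_continuous T' \<longrightarrow> (\<forall>U. openin T U \<longrightarrow> openin T' U))"
    then have "openin T U \<Longrightarrow> openin ?T0 U" for U using grp chars by blast
    moreover have "openin ?T0 U \<Longrightarrow> openin T U" for U using T least by blast
    ultimately show "T = ?T0" unfolding topology_eq by blast
  qed
  show "group_topology (bohr_topology :: 'g topology)"
    "characters_continuous (bohr_topology :: 'g topology)"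
    unfolding eq by (rule grp chars)+
qed

text \<open>The next two notions are meant for MAP groups only.\<close>

definition schur_property :: "'g::topological_ab_group_add itself \<Rightarrow> bool" where
  "schur_property _ \<longleftrightarrow>
     (\<forall>x :: nat \<Rightarrow> 'g. convergent x \<longleftrightarrow> (\<exists>l. limitin bohr_topology x l sequentially))"

definition respects_compactness :: "'g::topological_ab_group_add itself \<Rightarrow> bool" where
  "respects_compactness _ \<longleftrightarrow> (\<forall>K :: 'g set. compact K \<longleftrightarrow> compactin bohr_topology K)"


section \<open>\<open>\<gg>\<close>-closed subgroups\<close>

definition s_subgroup :: "(nat \<Rightarrow> 'g::topological_ab_group_add \<Rightarrow> complex) \<Rightarrow> 'g set" where
  "s_subgroup u = {x. (\<lambda>n. u n x) \<longlonglongrightarrow> 1}"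

text \<open>An intersection of sets \<open>s_subgroup u\<close> is automatically a subgroup.\<close>

definition g_closed :: "'g::topological_ab_group_add set \<Rightarrow> bool" where
  "g_closed H \<longleftrightarrow>
     H = \<Inter>{s_subgroup u | u. range u \<subseteq> character_group \<and> H \<subseteq> s_subgroup u}"

end

theory Submission
  imports Defs
begin

text \<open>
  Everything rests on the Peter--Weyl theorem for \<open>X\<close>: continuous characters separate points.
  Haar measure is replaced by the invariant mean of a continuous function, the unique constant that
  is uniformly approximated by averages of finitely many translates. Write \<open>q \<lless> k\<close> if \<open>k - q\<close> is
  positive definite. The positive definite \<open>q \<lless> k\<close> are uniformly equicontinuous, so that they form
  a compact convex set for pointwise convergence on which the mean of \<open>\<bar>q\<bar>\<^sup>2\<close> is continuous. Maximising
  this mean minus \<open>c (q 0)\<^sup>2\<close> cuts off the small Fourier coefficients of \<open>k\<close>; after that, the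
  normalised positive definite functions lying below some multiple of \<open>q\<close> lie below one fixed
  multiple, and a maximiser of the mean of \<open>\<bar>r\<bar>\<^sup>2\<close> among them is an extreme point, hence a
  character. Applied to the autocorrelation of \<open>f - f (\<cdot> + a)\<close> this gives a character with
  value \<open>\<noteq> 1\<close> at \<open>a\<close>.

  If \<open>X\<close> is connected, then \<open>\<chi>\<^sup>k = 1\<close> for some \<open>k > 0\<close> only if \<open>\<chi> = 1\<close>. Hence the map \<open>x \<mapsto> k x\<close>
  decorrelates trigonometric polynomials for large \<open>k\<close>, and for every neighbourhood \<open>W\<close> of \<open>0\<close> and
  all large \<open>k\<close> one has \<open>k W - W = X\<close>. By Baire's theorem in the Polish group \<open>F0\<close> some element has
  dense multiples.

  If \<open>x \<noteq> 0\<close>, the elements with the single nonzero coordinate \<open>x\<close> at place \<open>n\<close> form a null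
  sequence in the Bohr topology which does not converge in \<open>F0\<close>. The Schwartz condition would force
  a nontrivial character of \<open>X\<close> to be trivial on a neighbourhood of \<open>0\<close>, although this
  neighbourhood generates \<open>X\<close>. Finally, if \<open>y\<close> is not a null sequence in \<open>F0\<close>, some coordinates of
  its terms cluster at a point \<open>l \<noteq> 0\<close> of \<open>X\<close>, and a character of \<open>X\<close> that is not \<open>1\<close> at \<open>l\<close>,
  applied to these coordinates, excludes \<open>y\<close>.
\<close>

section \<open>The invariant mean of a compact Abelian group\<close>

text \<open>The codomain is any real normed field, so that real functions, where order arguments are
  available, and complex ones share the theory. For \<open>n = 0\<close> the value is
  \<open>0\<close>, hence the condition \<open>n > 0\<close> in \<open>has_mean\<close>.\<close>

definition translate_avg :: "nat \<Rightarrow> (nat \<Rightarrow> 'g::ab_group_add) \<Rightarrow> ('g \<Rightarrow> 'a::real_normed_field) \<Rightarrow> 'g \<Rightarrow> 'a" where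
  "translate_avg n t f x = (\<Sum>i<n. f (x + t i)) / of_nat n"

definition has_mean :: "('g::ab_group_add \<Rightarrow> 'a::real_normed_field) \<Rightarrow> 'a \<Rightarrow> bool" where
  "has_mean f c \<longleftrightarrow> (\<forall>e>0. \<exists>n>0. \<exists>t. \<forall>x. norm (translate_avg n t f x - c) \<le> e)"

lemma has_meanD:
  assumes "has_mean f c" "e > 0"
  obtains n t where "n > 0" "\<And>x. norm (translate_avg n t f x - c) \<le> e"
  using assms unfolding has_mean_def by blast

text \<open>The pair \<open>(i, j)\<close> with \<open>i < n\<close> and \<open>j < m\<close> is
  coded as \<open>i * m + j\<close>, so that an average of averages is again one average over an
  initial segment of the naturals.\<close>

lemma translate_avg_translate_avg:
  "translate_avg n s (translate_avg m t f) x =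
     translate_avg (n * m) (\<lambda>k. s (k div m) + t (k mod m)) f x"
proof (cases "m = 0")
  case False
  have "(\<Sum>k<n*m. f (x + (s (k div m) + t (k mod m)))) =
      (\<Sum>i<n. sum (\<lambda>k. f (x + (s (k div m) + t (k mod m)))) {i*m..<i*m+m})"
    by (simp add: sum.nat_group)
  also have "\<dots> = (\<Sum>i<n. \<Sum>j<m. f (x + (s i + t j)))"
  proof (rule sum.cong[OF refl])
    fix i
    show "sum (\<lambda>k. f (x + (s (k div m) + t (k mod m)))) {i*m..<i*m+m} = (\<Sum>j<m. f (x + (s i + t j)))"
      by (rule sum.reindex_bij_witness[of _ "\<lambda>j. i*m+j" "\<lambda>k. k - i*m"])
        (use False in \<open>auto simp: le_iff_add\<close>)
  qed
  finally show ?thesis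
    by (simp add: translate_avg_def sum_divide_distrib add.assoc mult.commute)
qed (simp add: translate_avg_def)

lemma translate_avg_commute:
  "translate_avg n s (translate_avg m t f) x = translate_avg m t (translate_avg n s f) x"
proof -
  have "(\<Sum>i<n. \<Sum>j<m. f (x + s i + t j)) = (\<Sum>j<m. \<Sum>i<n. f (x + t j + s i))"
    by (subst sum.swap) (simp add: add_ac)
  then show ?thesis
    by (simp add: translate_avg_def mult.commute flip: sum_divide_distrib)
qed

lemma translate_avg_near:
  assumes "\<And>x. norm (f x - c) \<le> e" "n > 0"
  shows "norm (translate_avg n t f x - c) \<le> e"
proof -
  have "translate_avg n t f x - c = (\<Sum>i<n. f (x + t i) - c) / of_nat n"
    using assms(2) by (simp add: translate_avg_def sum_subtractf diff_divide_distrib)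
  also have "norm \<dots> \<le> (\<Sum>i<n. e) / of_nat n"
    unfolding norm_divide norm_of_nat
    by (intro divide_right_mono sum_norm_le) (use assms in auto)
  also have "\<dots> = e" using assms(2) by simp
  finally show ?thesis .
qed

text \<open>Averaging with one family after the other keeps both estimates: averages commute, and
  averaging a function uniformly close to a constant keeps it as close.\<close>

lemma has_mean_common:
  assumes "has_mean f c" "has_mean g d" "e > 0"
  obtains n t where "n > 0" "\<And>x. norm (translate_avg n t f x - c) \<le> e"
    "\<And>x. norm (translate_avg n t g x - d) \<le> e"
proof -
  obtain n s where n: "n > 0" "\<And>x. norm (translate_avg n s f x - c) \<le> e"
    using has_meanD[OF assms(1,3)] by blast
  obtain m t where m: "m > 0" "\<And>x. norm (translate_avg m t g x - d) \<le> e"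
    using has_meanD[OF assms(2,3)] by blast
  show ?thesis
  proof (rule that[of "n*m" "\<lambda>k. s (k div m) + t (k mod m)"])
    show "n * m > 0" using n m by simp
    show "norm (translate_avg (n*m) (\<lambda>k. s (k div m) + t (k mod m)) f x - c) \<le> e" for x
      unfolding translate_avg_translate_avg[symmetric] translate_avg_commute[of n s]
      by (intro translate_avg_near n m)
    show "norm (translate_avg (n*m) (\<lambda>k. s (k div m) + t (k mod m)) g x - d) \<le> e" for x
      unfolding translate_avg_translate_avg[symmetric] 
      by (intro translate_avg_near n m)
  qed
qed

text \<open>A common family of translates compares both means through the averages at
  \<open>0\<close>. The case \<open>B = 0\<close> gives uniqueness.\<close>

lemma has_mean_norm_diff_le:
  assumes "has_mean f c" "has_mean g d" "\<And>x. norm (f x - g x) \<le> B"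
  shows "norm (c - d) \<le> B"
proof (rule field_le_epsilon)
  fix e :: real assume "e > 0"
  obtain n t where n: "n > 0" "\<And>x. norm (translate_avg n t f x - c) \<le> e/2"
    "\<And>x. norm (translate_avg n t g x - d) \<le> e/2"
    using has_mean_common[OF assms(1,2), of "e/2"] \<open>e > 0\<close> by auto
  have "translate_avg n t f 0 - translate_avg n t g 0 = translate_avg n t (\<lambda>x. f x - g x) 0"
    by (simp add: translate_avg_def sum_subtractf diff_divide_distrib)
  then have "norm (translate_avg n t f 0 - translate_avg n t g 0) \<le> B"
    using translate_avg_near[of "\<lambda>x. f x - g x" 0 B n t 0] assms(3) n(1) by simp
  moreover have *: "c - d = - (translate_avg n t f 0 - c) + (translate_avg n t f 0 - translate_avg n t g 0)
      + (translate_avg n t g 0 - d)" by simp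
  moreover have "norm (- (translate_avg n t f 0 - c) + (translate_avg n t f 0 - translate_avg n t g 0)
      + (translate_avg n t g 0 - d)) \<le> norm (translate_avg n t f 0 - c)
      + norm (translate_avg n t f 0 - translate_avg n t g 0) + norm (translate_avg n t g 0 - d)"
    by (metis norm_triangle_mono norm_minus_cancel norm_triangle_ineq order_refl)
  ultimately show "norm (c - d) \<le> B + e"
    using n(2)[of 0] n(3)[of 0] unfolding * by linarith
qed

lemma has_mean_unique: "has_mean f c \<Longrightarrow> has_mean f d \<Longrightarrow> c = d"
  using has_mean_norm_diff_le[of f c f d 0] by simp

lemma has_mean_add:
  assumes "has_mean f c" "has_mean g d"
  shows "has_mean (\<lambda>x. f x + g x) (c + d)"
  unfolding has_mean_def
proof (intro allI impI)
  fix e :: real assume "e > 0"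
  obtain n t where n: "n > 0" "\<And>x. norm (translate_avg n t f x - c) \<le> e/2"
    "\<And>x. norm (translate_avg n t g x - d) \<le> e/2"
    using has_mean_common[OF assms(1,2), of "e/2"] \<open>e > 0\<close> by auto
  have "norm (translate_avg n t (\<lambda>x. f x + g x) x - (c + d)) \<le> e" for x
  proof -
    have "translate_avg n t (\<lambda>x. f x + g x) x - (c + d) =
        (translate_avg n t f x - c) + (translate_avg n t g x - d)"
      by (simp add: translate_avg_def sum.distrib add_divide_distrib)
    then show ?thesis
      using norm_triangle_mono[OF n(2,3)] by (metis field_sum_of_halves)
  qed
  then show "\<exists>n>0. \<exists>t. \<forall>x. norm (translate_avg n t (\<lambda>x. f x + g x) x - (c + d)) \<le> e"
    using n(1) by blast
qed

text \<open>Averages commute with real linear maps. This serves for real and imaginary parts,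
  conjugation and complex multiples at once.\<close>

lemma has_mean_linear:
  assumes "has_mean f c" and h: "bounded_linear h"
  shows "has_mean (\<lambda>x. h (f x)) (h c)"
  unfolding has_mean_def
proof (intro allI impI)
  fix e :: real assume "e > 0"
  interpret bounded_linear h by (rule h)
  obtain K where K: "K > 0" "\<And>x. norm (h x) \<le> norm x * K" using pos_bounded by blast
  obtain n t where n: "n > 0" "\<And>x. norm (translate_avg n t f x - c) \<le> e / K"
    using has_meanD[OF assms(1), of "e / K"] \<open>e > 0\<close> K by auto
  have "norm (translate_avg n t (\<lambda>x. h (f x)) x - h c) \<le> e" for x
  proof -
    have "translate_avg n t (\<lambda>x. h (f x)) x = scaleR (1 / real n) (h (\<Sum>i<n. f (x + t i)))"
      by (simp add: translate_avg_def sum scaleR_conv_of_real)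
    also have "\<dots> = h (translate_avg n t f x)"
      by (simp add: translate_avg_def flip: scaleR) (simp add: scaleR_conv_of_real)
    finally have "norm (translate_avg n t (\<lambda>x. h (f x)) x - h c) = norm (h (translate_avg n t f x - c))"
      by (simp add: diff)
    also have "\<dots> \<le> norm (translate_avg n t f x - c) * K" by (rule K)
    also have "\<dots> \<le> e / K * K" using n(2)[of x] K(1) by (intro mult_right_mono) auto
    finally show ?thesis using K(1) by simp
  qed
  then show "\<exists>n>0. \<exists>t. \<forall>x. norm (translate_avg n t (\<lambda>x. h (f x)) x - h c) \<le> e"
    using n(1) by blast
qed

lemma has_mean_const: "has_mean (\<lambda>x. c) c"
  unfolding has_mean_def by (intro allI impI exI[of _ "1::nat"]) (simp add: translate_avg_def)

lemma has_mean_translate: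
  assumes "has_mean f c"
  shows "has_mean (\<lambda>x. f (x + a)) c"
  unfolding has_mean_def
proof (intro allI impI)
  fix e :: real assume "e > 0"
  then obtain n t where n: "n > 0" "\<And>x. norm (translate_avg n t f x - c) \<le> e"
    using has_meanD[OF assms(1)] by blast
  have "translate_avg n t (\<lambda>x. f (x + a)) x = translate_avg n t f (x + a)" for x
    by (simp add: translate_avg_def add_ac)
  then show "\<exists>n>0. \<exists>t. \<forall>x. norm (translate_avg n t (\<lambda>x. f (x + a)) x - c) \<le> e"
    using n by (intro exI[of _ n] conjI exI[of _ t] allI) simp_all
qed

lemma has_mean_reflect:
  assumes "has_mean f c"
  shows "has_mean (\<lambda>x. f (- x)) c"
  unfolding has_mean_def
proof (intro allI impI)
  fix e :: real assume "e > 0"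
  then obtain n t where n: "n > 0" "\<And>x. norm (translate_avg n t f x - c) \<le> e"
    using has_meanD[OF assms(1)] by blast
  have "translate_avg n (\<lambda>i. - t i) (\<lambda>x. f (- x)) x = translate_avg n t f (- x)" for x
    by (simp add: translate_avg_def add_ac)
  then show "\<exists>n>0. \<exists>t. \<forall>x. norm (translate_avg n t (\<lambda>x. f (- x)) x - c) \<le> e"
    using n by metis
qed

lemma translate_avg_ge:
  fixes f :: "'g::ab_group_add \<Rightarrow> real"
  assumes "\<And>x. a \<le> f x" "n > 0"
  shows "a \<le> translate_avg n t f x"
proof -
  have "(\<Sum>i<n. a) / real n \<le> translate_avg n t f x"
    unfolding translate_avg_def by (intro divide_right_mono sum_mono assms) auto
  then show ?thesis using assms(2) by simp
qed

lemma translate_avg_ge_single: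
  fixes f :: "'g::ab_group_add \<Rightarrow> real"
  assumes "\<And>x. a \<le> f x" "j < n" "b \<le> f (x + t j)"
  shows "a + (b - a) / n \<le> translate_avg n t f x"
proof -
  have "(b - a) = (\<Sum>i<n. if i = j then b - a else 0)"
    using assms(2) by simp
  also have "\<dots> \<le> (\<Sum>i<n. f (x + t i) - a)"
    by (intro sum_mono) (use assms in \<open>auto simp: algebra_simps\<close>)
  finally have "(b - a) / n \<le> (\<Sum>i<n. f (x + t i) - a) / n"
    by (intro divide_right_mono) auto
  also have "\<dots> = translate_avg n t f x - a"
    using assms(2) by (simp add: translate_avg_def sum_subtractf diff_divide_distrib)
  finally show ?thesis by simp
qed

lemma has_mean_ge:
  fixes f :: "'g::ab_group_add \<Rightarrow> real"
  assumes "has_mean f c" "\<And>x. a \<le> f x"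
  shows "a \<le> c"
proof (rule field_le_epsilon)
  fix e :: real assume "e > 0"
  then obtain n t where n: "n > 0" "\<And>x. norm (translate_avg n t f x - c) \<le> e"
    using has_meanD[OF assms(1)] by blast
  have "a \<le> translate_avg n t f 0" by (rule translate_avg_ge) (use assms n in auto)
  with n(2)[of 0] show "a \<le> c + e" by (simp add: abs_le_iff)
qed

lemma has_mean_avg:
  assumes "has_mean f c" "m > 0"
  shows "has_mean (translate_avg m t f) c"
  unfolding has_mean_def
proof (intro allI impI)
  fix e :: real assume "e > 0"
  then obtain n s where n: "n > 0" "\<And>x. norm (translate_avg n s f x - c) \<le> e"
    using has_meanD[OF assms(1)] by blast
  have "norm (translate_avg n s (translate_avg m t f) x - c) \<le> e" for x
    unfolding translate_avg_commute[of n s] by (intro translate_avg_near n assms)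
  then show "\<exists>n>0. \<exists>s. \<forall>x. norm (translate_avg n s (translate_avg m t f) x - c) \<le> e"
    using n(1) by blast
qed

section \<open>Existence of the mean of a continuous function\<close>

locale compact_ab_group =
  fixes G :: "'g::topological_ab_group_add itself"
  assumes compact_UNIV: "compact (UNIV :: 'g set)"
begin

text \<open>The tube lemma along \<open>{0} \<times> UNIV\<close>. It turns continuity into
  uniformity without a metric on the group.\<close>

lemma nbhd_zero_uniform:
  fixes W :: "('g \<times> 'g) set"
  assumes "open W" "\<And>t. (0, t) \<in> W"
  shows "\<exists>U. open U \<and> 0 \<in> U \<and> (\<forall>s\<in>U. \<forall>t. (s, t) \<in> W)"
proof -
  have "{0} \<times> UNIV \<subseteq> W" using assms by auto
  from Elementary_Topology.tube_lemma[OF compact_UNIV assms(1) this]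
  obtain U where U: "0 \<in> U" "open U" "U \<times> UNIV \<subseteq> W" by blast
  then show ?thesis by (intro exI[of _ U]) auto
qed

lemma uniform_continuity:
  fixes f :: "'g \<Rightarrow> 'b::metric_space"
  assumes "continuous_on UNIV f" "e > 0"
  shows "\<exists>U. open U \<and> 0 \<in> U \<and> (\<forall>x y. x - y \<in> U \<longrightarrow> dist (f x) (f y) < e)"
proof -
  \<comment> \<open>Pairs \<open>(s, t)\<close> such that shifting \<open>t\<close> by
    \<open>s\<close> changes \<open>f\<close> by less than \<open>e\<close>; this open set contains
    \<open>(0, t)\<close> for every \<open>t\<close>.\<close>
  let ?W = "{q. dist (f (fst q + snd q)) (f (snd q)) < e} :: ('g \<times> 'g) set"
  have c: "continuous_on UNIV (\<lambda>q::'g\<times>'g. f (h q))" if "continuous_on UNIV h" for h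
    by (rule continuous_on_compose2[OF assms(1) that]) auto
  have "open ?W"
    by (intro open_Collect_less continuous_on_dist continuous_on_const c continuous_intros)
  moreover have "(0, t) \<in> ?W" for t using assms by simp
  ultimately obtain U where U: "open U" "0 \<in> U" "\<And>s t. s \<in> U \<Longrightarrow> (s, t) \<in> ?W"
    using nbhd_zero_uniform[of ?W] by blast
  have "dist (f x) (f y) < e" if "x - y \<in> U" for x y
    using U(3)[OF that, of y] by simp
  with U(1,2) show ?thesis by blast
qed

lemma finite_translates_cover:
  assumes "open U" "(0::'g) \<in> U"
  shows "\<exists>n>0::nat. \<exists>a. \<forall>x. \<exists>i<n. x + a i \<in> U"
proof -
  have "open ((\<lambda>x. x + b) -` U)" for b
    by (intro open_vimage assms continuous_intros)
  moreover have "UNIV \<subseteq> (\<Union>b\<in>UNIV. (\<lambda>x. x + b) -` U)"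
  proof
    fix x :: 'g
    have "x + (- x) \<in> U" using assms by simp
    then show "x \<in> (\<Union>b\<in>UNIV. (\<lambda>x. x + b) -` U)" by blast
  qed
  ultimately obtain B where B: "finite B" "UNIV \<subseteq> (\<Union>b\<in>B. (\<lambda>x. x + b) -` U)"
    using compactE_image[OF compact_UNIV, of UNIV "\<lambda>b. (\<lambda>x. x + b) -` U"] by metis
  obtain a where a: "bij_betw a {..<card B} B"
    using ex_bij_betw_nat_finite[OF B(1)] by (auto simp: atLeast0LessThan)
  have *: "\<exists>i<card B. x + a i \<in> U" for x
  proof -
    obtain b where "b \<in> B" "x + b \<in> U" using B(2) by blast
    then show ?thesis using a unfolding bij_betw_def by (metis imageE lessThan_iff)
  qed
  moreover have "card B > 0" using *[of 0] by auto
  ultimately show ?thesis by blast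
qed

text \<open>The mean is the supremum \<open>S\<close> of the lower bounds that averages of
  translates attain. An average with lower bound close to \<open>S\<close> cannot exceed
  \<open>S\<close> by much anywhere, since spreading the bump over a finite cover would raise the
  lower bound above \<open>S\<close>.\<close>

lemma has_mean_exists_real:
  fixes f :: "'g \<Rightarrow> real"
  assumes "continuous_on UNIV f"
  shows "\<exists>c. has_mean f c"
proof -
  obtain b where b: "\<And>x. b \<le> f x"
    using continuous_attains_inf[OF compact_UNIV _ assms] by auto
  obtain b' where b': "\<And>x. f x \<le> b'"
    using continuous_attains_sup[OF compact_UNIV _ assms] by auto
  define A where "A = {a. \<exists>n>0. \<exists>t. \<forall>x. a \<le> translate_avg n t f x}"
  have "translate_avg n t f x \<le> b'" if "n > 0" for n t x
  proof -
    have "translate_avg n t f x \<le> (\<Sum>i<n. b') / n"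
      unfolding translate_avg_def by (intro divide_right_mono sum_mono b') auto
    then show ?thesis using that by simp
  qed
  then have "a \<le> b'" if "a \<in> A" for a
    using that unfolding A_def by (auto intro: order_trans)
  then have bdd: "bdd_above A" by (rule bdd_aboveI)
  have "b \<in> A" unfolding A_def using b by (auto intro!: exI[of _ "1::nat"] simp: translate_avg_def)
  define S where "S = Sup A"
  have "has_mean f S"
    unfolding has_mean_def
  proof (intro allI impI)
    fix e :: real assume "e > 0"
    obtain U where U: "open U" "0 \<in> U" "\<And>x y. x - y \<in> U \<Longrightarrow> dist (f x) (f y) < e / 2"
      using uniform_continuity[OF assms, of "e/2"] \<open>e > 0\<close> by (meson half_gt_zero)
    obtain N a where N: "(N::nat) > 0" "\<And>x. \<exists>i<N. x + a i \<in> U"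
      using finite_translates_cover[OF U(1,2)] by metis
    \<comment> \<open>The factor \<open>4 * N\<close> makes the gain
      \<open>(e/2 + d) / N = 2 * d + d / N\<close> found below larger than the deficit
      \<open>d\<close>.\<close>
    define d where "d = e / (4 * N)"
    have "d > 0" using \<open>e > 0\<close> N by (simp add: d_def)
    then obtain s where "s \<in> A" "S - d < s"
      using less_cSupD[of A "S - d"] \<open>b \<in> A\<close> by (auto simp: S_def)
    then obtain n t where n: "n > 0" "\<And>x. s \<le> translate_avg n t f x"
      unfolding A_def by blast
    with \<open>S - d < s\<close> have n: "n > 0" "\<And>x. S - d \<le> translate_avg n t f x"
      by (auto intro: order_trans[OF less_imp_le])
    have "translate_avg n t f y \<le> S + e" for y
    proof (rule ccontr)
      assume y: "\<not> translate_avg n t f y \<le> S + e"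
      \<comment> \<open>A large value at \<open>y\<close> persists on \<open>y + U\<close>, because
        \<open>U\<close> works for all translates of \<open>f\<close> at once.\<close>
      have near: "S + e / 2 \<le> translate_avg n t f x" if "x - y \<in> U" for x
      proof -
        have "\<bar>translate_avg n t f x - translate_avg n t f y\<bar> \<le> e / 2"
        proof -
          have "translate_avg n t f x - translate_avg n t f y =
              translate_avg n t (\<lambda>z. f (z + x) - f (z + y)) 0"
            by (simp add: translate_avg_def sum_subtractf diff_divide_distrib add_ac)
          moreover have "norm (f (z + x) - f (z + y) - 0) \<le> e / 2" for z
            using U(3)[of "z + x" "z + y"] that by (simp add: dist_real_def)
          ultimately show ?thesis
            using translate_avg_near[of "\<lambda>z. f (z + x) - f (z + y)" 0 "e/2" n t 0] n(1) by simp
        qed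
        then show ?thesis using y by linarith
      qed
      \<comment> \<open>The translates by \<open>a i\<close> bring every point into
        \<open>y + U\<close> for some \<open>i < N\<close>, so this second average improves the
        lower bound everywhere.\<close>
      have "S - d + ((S + e/2) - (S - d)) / N \<le> translate_avg N (\<lambda>i. a i) (translate_avg n t f) x" for x
      proof -
        obtain i where i: "i < N" "x - y + a i \<in> U" using N(2)[of "x - y"] by blast
        show ?thesis
          by (rule translate_avg_ge_single[OF n(2) i(1)]) (use near[of "x + a i"] i(2) in \<open>simp add: algebra_simps\<close>)
      qed
      then have "S - d + ((S + e/2) - (S - d)) / N \<in> A"
        unfolding A_def translate_avg_translate_avg using N(1) n(1)
        by (intro CollectI exI[of _ "N * n"] exI[of _ "\<lambda>k. a (k div n) + t (k mod n)"]) auto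
      then have "S - d + ((S + e/2) - (S - d)) / N \<le> S"
        unfolding S_def using bdd by (rule cSup_upper)
      then have "(e/2 + d) / N \<le> d" by simp
      moreover have "(e/2 + d) / N = 2 * d + d / N" using N by (simp add: d_def field_simps)
      moreover have "d / N > 0" using N \<open>d > 0\<close> by simp
      ultimately show False using \<open>d > 0\<close> by linarith
    qed
    moreover have "d \<le> e" using \<open>e > 0\<close> N by (simp add: d_def field_simps)
    ultimately have "norm (translate_avg n t f x - S) \<le> e" for x
      using n(2)[of x] by (simp add: abs_le_iff algebra_simps)
    then show "\<exists>n>0. \<exists>t. \<forall>x. norm (translate_avg n t f x - S) \<le> e"
      using n(1) by blast
  qed
  then show ?thesis by blast
qed

lemma has_mean_exists:
  fixes f :: "'g \<Rightarrow> complex"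
  assumes "continuous_on UNIV f"
  shows "\<exists>c. has_mean f c"
proof -
  obtain a b where ab: "has_mean (\<lambda>x. Re (f x)) a" "has_mean (\<lambda>x. Im (f x)) b"
    using has_mean_exists_real[OF continuous_on_Re[OF assms]]
      has_mean_exists_real[OF continuous_on_Im[OF assms]] by blast
  have "bounded_linear (\<lambda>r. \<i> * complex_of_real r)"
    by (rule bounded_linear_compose[OF bounded_linear_mult_right bounded_linear_of_real])
  from has_mean_add[OF has_mean_linear[OF ab(1) bounded_linear_of_real] has_mean_linear[OF ab(2) this]]
  have "has_mean (\<lambda>x. complex_of_real (Re (f x)) + \<i> * complex_of_real (Im (f x))) (a + \<i> * b)" .
  then show ?thesis by (auto simp flip: complex_eq)
qed

end

section \<open>The mean as a positive invariant functional\<close>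

definition mean :: "('g::ab_group_add \<Rightarrow> complex) \<Rightarrow> complex" where
  "mean f = (THE c. has_mean f c)"

lemma mean_eqI: "has_mean f c \<Longrightarrow> mean f = c"
  unfolding mean_def using has_mean_unique by blast

lemma mean_const [simp]: "mean (\<lambda>x. c) = c"
  by (rule mean_eqI has_mean_const)+

text \<open>Continuity is not involved: a function and its translate have the same means, so the two
  \<open>THE\<close> terms coincide.\<close>

lemma mean_translate: "mean (\<lambda>x. f (x + a)) = mean f"
proof -
  have "has_mean (\<lambda>x. f (x + a)) c \<longleftrightarrow> has_mean f c" for c
    using has_mean_translate[of f c a] has_mean_translate[of "\<lambda>x. f (x + a)" c "- a"] by auto
  then show ?thesis by (simp add: mean_def)
qed

lemma mean_reflect: "mean (\<lambda>x. f (- x)) = mean f"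
proof -
  have "has_mean (\<lambda>x. f (- x)) c \<longleftrightarrow> has_mean f c" for c
    using has_mean_reflect[of f c] has_mean_reflect[of "\<lambda>x. f (- x)" c] by auto
  then show ?thesis by (simp add: mean_def)
qed

context compact_ab_group
begin

lemma has_mean_mean: "continuous_on UNIV f \<Longrightarrow> has_mean f (mean f)" for f :: "'g \<Rightarrow> complex"
  using has_mean_exists[of f] mean_eqI[of f] by auto

lemma mean_add:
  fixes f g :: "'g \<Rightarrow> complex"
  assumes "continuous_on UNIV f" "continuous_on UNIV g"
  shows "mean (\<lambda>x. f x + g x) = mean f + mean g"
  by (intro mean_eqI has_mean_add has_mean_mean assms)

lemma mean_linear:
  fixes f :: "'g \<Rightarrow> complex"
  assumes "continuous_on UNIV f" "bounded_linear h"
  shows "mean (\<lambda>x. h (f x)) = h (mean f)"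
  by (rule mean_eqI[OF has_mean_linear[OF has_mean_mean[OF assms(1)] assms(2)]])

lemma mean_cmult:
  fixes f :: "'g \<Rightarrow> complex"
  assumes "continuous_on UNIV f"
  shows "mean (\<lambda>x. c * f x) = c * mean f"
  by (rule mean_linear[OF assms bounded_linear_mult_right])

lemma mean_cnj:
  fixes f :: "'g \<Rightarrow> complex"
  assumes "continuous_on UNIV f"
  shows "mean (\<lambda>x. cnj (f x)) = cnj (mean f)"
  by (rule mean_linear[OF assms bounded_linear_cnj])

lemma mean_diff:
  fixes f g :: "'g \<Rightarrow> complex"
  assumes "continuous_on UNIV f" "continuous_on UNIV g"
  shows "mean (\<lambda>x. f x - g x) = mean f - mean g"
  using mean_add[OF assms(1), of "\<lambda>x. (-1) * g x"] mean_cmult[OF assms(2), of "-1"] assms(2)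
  by (simp add: continuous_on_minus)

lemma mean_sum:
  fixes f :: "'i \<Rightarrow> 'g \<Rightarrow> complex"
  assumes "\<And>i. i \<in> I \<Longrightarrow> continuous_on UNIV (f i)"
  shows "mean (\<lambda>x. \<Sum>i\<in>I. f i x) = (\<Sum>i\<in>I. mean (f i))"
  using assms
proof (induction I rule: infinite_finite_induct)
  case (insert i I)
  then show ?case by (simp add: mean_add continuous_on_sum)
qed auto

lemma mean_norm_diff_le:
  fixes f g :: "'g \<Rightarrow> complex"
  assumes "continuous_on UNIV f" "continuous_on UNIV g" "\<And>x. norm (f x - g x) \<le> B"
  shows "norm (mean f - mean g) \<le> B"
  by (rule has_mean_norm_diff_le[OF has_mean_mean has_mean_mean]) (use assms in auto)

lemma mean_norm_le:
  fixes f :: "'g \<Rightarrow> complex"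
  assumes "continuous_on UNIV f" "\<And>x. norm (f x) \<le> B"
  shows "norm (mean f) \<le> B"
  using mean_norm_diff_le[OF assms(1), of "\<lambda>x. 0" B] assms(2) by simp

lemma mean_mono:
  fixes f g :: "'g \<Rightarrow> complex"
  assumes "continuous_on UNIV f" "continuous_on UNIV g" "\<And>x. Re (f x) \<le> Re (g x)"
  shows "Re (mean f) \<le> Re (mean g)"
proof -
  have "has_mean (\<lambda>x. Re (g x - f x)) (Re (mean (\<lambda>x. g x - f x)))"
    by (rule has_mean_linear[OF has_mean_mean bounded_linear_Re]) (intro continuous_intros assms)
  from has_mean_ge[OF this, of 0] show ?thesis using assms by (simp add: mean_diff)
qed

text \<open>\<open>Re f\<close> exceeds \<open>Re (f a) / 2\<close> on a neighbourhood of
  \<open>a\<close>. Finitely many translates of it cover the group, so an average of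
  \<open>n\<close> translates is at least \<open>Re (f a) / (2 n)\<close> everywhere.\<close>

lemma mean_pos:
  fixes f :: "'g \<Rightarrow> complex"
  assumes "continuous_on UNIV f" "\<And>x. 0 \<le> Re (f x)" "0 < Re (f a)"
  shows "0 < Re (mean f)"
proof -
  let ?U = "{x. Re (f a) / 2 < Re (f (x + a))}"
  have "open ?U"
    by (intro open_Collect_less continuous_on_const continuous_on_Re
        continuous_on_compose2[OF assms(1)] continuous_intros) auto
  moreover have "0 \<in> ?U" using assms(3) by simp
  ultimately obtain n b where n: "(n::nat) > 0" "\<And>x. \<exists>i<n. x + b i \<in> ?U"
    using finite_translates_cover[of ?U] by metis
  have "has_mean (\<lambda>x. Re (f x)) (Re (mean f))"
    by (rule has_mean_linear[OF has_mean_mean[OF assms(1)] bounded_linear_Re])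
  then have "has_mean (translate_avg n (\<lambda>i. b i + a) (\<lambda>x. Re (f x))) (Re (mean f))"
    using n(1) by (rule has_mean_avg)
  moreover have "Re (f a) / 2 / n \<le> translate_avg n (\<lambda>i. b i + a) (\<lambda>x. Re (f x)) x" for x
  proof -
    obtain i where "i < n" "x + b i \<in> ?U" using n(2) by blast
    then show ?thesis
      using translate_avg_ge_single[of 0 "\<lambda>x. Re (f x)" i n "Re (f a) / 2" x "\<lambda>i. b i + a"] assms(2)
      by (simp add: add_ac)
  qed
  ultimately have "Re (f a) / 2 / n \<le> Re (mean f)" by (rule has_mean_ge)
  moreover have "Re (f a) / 2 / n > 0" using n(1) assms(3) by simp
  ultimately show ?thesis by linarith
qed

end

section \<open>Positive definite functions\<close>

text \<open>Hermitian symmetry is a separate clause and makes the quadratic form real, so only the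
  sign of its real part is prescribed. Continuity is not included.\<close>

definition pos_def :: "('g::ab_group_add \<Rightarrow> complex) \<Rightarrow> bool" where
  "pos_def w \<longleftrightarrow> (\<forall>x. w (- x) = cnj (w x)) \<and>
     (\<forall>n (c::nat \<Rightarrow> complex) t. 0 \<le> Re (\<Sum>i<n. \<Sum>j<n. c i * cnj (c j) * w (t i - t j)))"

lemma pos_def_minus: "pos_def w \<Longrightarrow> w (- x) = cnj (w x)"
  by (simp add: pos_def_def)

lemma pos_def_sum_nonneg:
  fixes c :: "'i \<Rightarrow> complex"
  assumes "pos_def w" "finite I"
  shows "0 \<le> Re (\<Sum>i\<in>I. \<Sum>j\<in>I. c i * cnj (c j) * w (t i - t j))"
proof -
  obtain h where h: "bij_betw h {..<card I} I"
    using ex_bij_betw_nat_finite[OF assms(2)] by (auto simp: atLeast0LessThan)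
  have "(\<Sum>i\<in>I. \<Sum>j\<in>I. c i * cnj (c j) * w (t i - t j)) =
      (\<Sum>i<card I. \<Sum>j<card I. c (h i) * cnj (c (h j)) * w (t (h i) - t (h j)))"
    by (simp flip: sum.reindex_bij_betw[OF h])
  also have "0 \<le> Re \<dots>" 
    by (rule assms(1)[unfolded pos_def_def, THEN conjunct2, rule_format])
  finally show ?thesis .
qed

lemma pdI:
  assumes "\<And>x. w (- x) = cnj (w x)"
    "\<And>n (c::nat \<Rightarrow> complex) t. 0 \<le> Re (\<Sum>i<n. \<Sum>j<n. c i * cnj (c j) * w (t i - t j))"
  shows "pos_def w"
  using assms unfolding pos_def_def by blast

lemma pos_def_0: "pos_def (\<lambda>x. 0)"
  by (rule pdI) auto

lemma pos_def_add: "pos_def v \<Longrightarrow> pos_def w \<Longrightarrow> pos_def (\<lambda>x. v x + w x)"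
  by (rule pdI) (auto simp: pos_def_def distrib_left sum.distrib simp del: Re_sum)

lemma pos_def_scale:
  assumes "pos_def w" "0 \<le> r"
  shows "pos_def (\<lambda>x. of_real r * w x)"
proof (rule pdI)
  show "of_real r * w (- x) = cnj (of_real r * w x)" for x using assms by (simp add: pos_def_def)
  fix n and c :: "nat \<Rightarrow> complex" and t
  have "(\<Sum>i<n. \<Sum>j<n. c i * cnj (c j) * (of_real r * w (t i - t j))) =
      of_real r * (\<Sum>i<n. \<Sum>j<n. c i * cnj (c j) * w (t i - t j))"
    by (simp add: sum_distrib_left mult_ac)
  then show "0 \<le> Re (\<Sum>i<n. \<Sum>j<n. c i * cnj (c j) * (of_real r * w (t i - t j)))"
    using assms unfolding pos_def_def by (simp only: Re_complex_of_real times_complex.sel Im_complex_of_real) simp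
qed

lemma pos_def_sum: "(\<And>i. i \<in> I \<Longrightarrow> pos_def (w i)) \<Longrightarrow> pos_def (\<lambda>x. \<Sum>i\<in>I. w i x)"
  by (induction I rule: infinite_finite_induct) (auto intro: pos_def_0 pos_def_add)

text \<open>The values \<open>\<phi> (t i)\<close> are absorbed into the coefficients.\<close>

lemma pos_def_mult_hom:
  assumes "pos_def w" "\<And>x y. \<phi> (x + y) = \<phi> x * \<phi> y" "\<And>x. \<phi> (- x) = cnj (\<phi> x)"
  shows "pos_def (\<lambda>x. w x * \<phi> x)"
proof (rule pdI)
  show "w (- x) * \<phi> (- x) = cnj (w x * \<phi> x)" for x using assms by (simp add: pos_def_def)
  fix n and c :: "nat \<Rightarrow> complex" and t
  have "\<phi> (x - y) = \<phi> x * cnj (\<phi> y)" for x y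
    using assms(2)[of x "- y"] assms(3) by simp
  then have "(\<Sum>i<n. \<Sum>j<n. c i * cnj (c j) * (w (t i - t j) * \<phi> (t i - t j))) =
      (\<Sum>i<n. \<Sum>j<n. (c i * \<phi> (t i)) * cnj (c j * \<phi> (t j)) * w (t i - t j))"
    by (simp add: mult_ac)
  then show "0 \<le> Re (\<Sum>i<n. \<Sum>j<n. c i * cnj (c j) * (w (t i - t j) * \<phi> (t i - t j)))"
    using pos_def_sum_nonneg[OF assms(1), of "{..<n}" "\<lambda>i. c i * \<phi> (t i)" t] by (simp only: finite_lessThan)
qed

text \<open>The convolution of \<open>w\<close> with the measure \<open>\<mu> * \<mu>\<^sup>*\<close> for \<open>\<mu> = \<Sum>i<n. c i \<delta>\<^bsub>- t i\<^esub>\<close>.\<close>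

definition twist :: "nat \<Rightarrow> (nat \<Rightarrow> complex) \<Rightarrow> (nat \<Rightarrow> 'g::ab_group_add) \<Rightarrow> ('g \<Rightarrow> complex) \<Rightarrow> 'g \<Rightarrow> complex" where
  "twist n c t w x = (\<Sum>i<n. \<Sum>j<n. c i * cnj (c j) * w (x + t i - t j))"

text \<open>The form of the twist at \<open>d\<close>, \<open>s\<close> is the form of
  \<open>w\<close> over pairs, with coefficients \<open>d a * c i\<close> at the points
  \<open>s a + t i\<close>.\<close>

lemma pos_def_twist:
  assumes "pos_def w"
  shows "pos_def (twist n c t w)"
proof (rule pdI)
  fix x
  have "twist n c t w (- x) = (\<Sum>i<n. \<Sum>j<n. c i * cnj (c j) * w (- (x + t j - t i)))"
    by (simp add: twist_def algebra_simps)
  also have "\<dots> = (\<Sum>i<n. \<Sum>j<n. c i * cnj (c j) * cnj (w (x + t j - t i)))"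
    by (simp only: pos_def_minus[OF assms])
  also have "\<dots> = cnj (twist n c t w x)"
    unfolding twist_def by (subst sum.swap) (simp add: mult_ac)
  finally show "twist n c t w (- x) = cnj (twist n c t w x)" .
next
  fix m :: nat and d :: "nat \<Rightarrow> complex" and s :: "nat \<Rightarrow> 'a"
  let ?I = "{..<m} \<times> {..<n}"
  have "0 \<le> Re (\<Sum>p\<in>?I. \<Sum>q\<in>?I. (d (fst p) * c (snd p)) * cnj (d (fst q) * c (snd q)) *
      w ((s (fst p) + t (snd p)) - (s (fst q) + t (snd q))))"
    by (rule pos_def_sum_nonneg[OF assms]) auto
  also have "(\<Sum>p\<in>?I. \<Sum>q\<in>?I. (d (fst p) * c (snd p)) * cnj (d (fst q) * c (snd q)) *
      w ((s (fst p) + t (snd p)) - (s (fst q) + t (snd q)))) =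
      (\<Sum>a<m. \<Sum>i<n. \<Sum>b<m. \<Sum>j<n. (d a * c i) * cnj (d b * c j) * w ((s a + t i) - (s b + t j)))"
    by (simp add: sum.cartesian_product' del: Re_sum)
  also have "\<dots> = (\<Sum>a<m. \<Sum>b<m. \<Sum>i<n. \<Sum>j<n. (d a * c i) * cnj (d b * c j) * w ((s a + t i) - (s b + t j)))"
    by (intro sum.cong refl sum.swap)
  also have "\<dots> = (\<Sum>a<m. \<Sum>b<m. d a * cnj (d b) * twist n c t w (s a - s b))"
    by (simp add: twist_def sum_distrib_left algebra_simps)
  finally show "0 \<le> Re (\<Sum>a<m. \<Sum>b<m. d a * cnj (d b) * twist n c t w (s a - s b))" .
qed

text \<open>The twist with points \<open>t\<close>, \<open>0\<close> and coefficients
  \<open>a\<close>, \<open>b\<close>. It multiplies the Fourier coefficient at \<open>\<chi>\<close>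
  by \<open>|a \<chi>(t) + b|^2\<close>.\<close>

lemma pos_def_two_point:
  assumes "pos_def w"
  shows "pos_def (\<lambda>x. (a * cnj a + b * cnj b) * w x + a * cnj b * w (x + t) + b * cnj a * w (x - t))"
proof -
  have "twist 2 (\<lambda>i. if i = 0 then a else b) (\<lambda>i. if i = 0 then t else 0) w =
      (\<lambda>x. (a * cnj a + b * cnj b) * w x + a * cnj b * w (x + t) + b * cnj a * w (x - t))"
    by (rule ext) (simp add: twist_def numeral_2_eq_2 algebra_simps)
  then show ?thesis using pos_def_twist[OF assms] by metis
qed

lemma pos_def_zero:
  assumes "pos_def w"
  shows "0 \<le> Re (w 0)" "Im (w 0) = 0" "w 0 = of_real (Re (w 0))"
proof -
  show "0 \<le> Re (w 0)"
    using pos_def_sum_nonneg[OF assms, of "{0::nat}" "\<lambda>_. 1" "\<lambda>_. 0"] by simp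
  have "w 0 = cnj (w 0)" using pos_def_minus[OF assms, of 0] by simp
  then show "Im (w 0) = 0" by (simp add: complex_eq_iff)
  then show "w 0 = of_real (Re (w 0))" by (simp add: complex_eq_iff)
qed

lemma pos_def_norm_le:
  assumes "pos_def w"
  shows "norm (w x) \<le> Re (w 0)"
proof (cases "w x = 0")
  case False
  \<comment> \<open>The unimodular \<open>z\<close> with \<open>z * w x = - norm (w x)\<close> makes
    the two-point function at \<open>0\<close> equal to
    \<open>2 * (w 0 - norm (w x))\<close>.\<close>
  define z where "z = - cnj (w x) / norm (w x)"
  have z: "z * cnj z = 1" "z * w x = - norm (w x)"
    using False by (simp_all add: z_def complex_norm_square[symmetric] power2_eq_square field_simps
        flip: of_real_mult)
  have "0 \<le> Re ((\<lambda>y. (z * cnj z + 1 * cnj 1) * w y + z * cnj 1 * w (y + x) + 1 * cnj z * w (y - x)) 0)"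
    by (rule pos_def_zero(1)[OF pos_def_two_point[OF assms]])
  also have "\<dots> = 2 * Re (w 0) + Re (z * w x) + Re (cnj (z * w x))"
    using z(1) pos_def_minus[OF assms, of x] by simp
  finally show ?thesis unfolding z(2) by simp
qed (use pos_def_zero[OF assms] in simp)

text \<open>Krein's inequality: positivity of the form at the three points \<open>x\<close>,
  \<open>y\<close>, \<open>0\<close>. It converts continuity at \<open>0\<close> into uniform
  continuity.\<close>

lemma pos_def_norm_diff_le:
  assumes "pos_def w"
  shows "(norm (w x - w y))\<^sup>2 \<le> 2 * Re (w 0) * (Re (w 0) - Re (w (x - y)))"
proof (cases "Re (w 0) = 0")
  case True
  then have "w z = 0" for z using pos_def_norm_le[OF assms, of z] by simp
  then show ?thesis by simp
next
  case False
  then have w0: "Re (w 0) > 0" using pos_def_zero(1)[OF assms] by simp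
  define r where "r = Re (w 0)"
  have r: "w 0 = of_real r" "r > 0" using pos_def_zero[OF assms] w0 by (auto simp: r_def)
  define u where "u = w x - w y"
  \<comment> \<open>The value that minimises the form with coefficients \<open>1\<close>,
    \<open>-1\<close>, \<open>l\<close> at \<open>x\<close>, \<open>y\<close>,
    \<open>0\<close>.\<close>
  define l where "l = - u / r"
  define c :: "nat \<Rightarrow> complex" where "c i = (if i = 0 then 1 else if i = 1 then -1 else l)" for i
  define t where "t i = (if i = 0 then x else if i = 1 then y else 0)" for i :: nat
  have "0 \<le> Re (\<Sum>i<3. \<Sum>j<3. c i * cnj (c j) * w (t i - t j))"
    by (rule pos_def_sum_nonneg[OF assms]) auto
  also have "(\<Sum>i<3. \<Sum>j<3. c i * cnj (c j) * w (t i - t j)) =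
     2 * w 0 - w (x - y) - w (- (x - y)) + l * cnj l * w 0 + cnj l * u + l * (w (- x) - w (- y))"
    by (simp add: numeral_3_eq_3 c_def t_def u_def algebra_simps)
  also have "\<dots> = 2 * r - w (x - y) - cnj (w (x - y)) + l * cnj l * r + cnj l * u + cnj (cnj l * u)"
    by (simp only: pos_def_minus[OF assms] r) (simp add: u_def)
  also have "Re \<dots> = 2 * r - 2 * Re (w (x - y)) + (norm l)\<^sup>2 * r + 2 * Re (cnj l * u)"
    unfolding complex_norm_square[symmetric] by (simp del: of_real_power)
  finally have *: "0 \<le> 2 * r - 2 * Re (w (x - y)) + (norm l)\<^sup>2 * r + 2 * Re (cnj l * u)" .
  have "(norm l)\<^sup>2 * r = (norm u)\<^sup>2 / r"
    using r by (simp add: l_def norm_divide power_divide power2_eq_square)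
  moreover have "cnj l * u = - of_real ((norm u)\<^sup>2 / r)"
    using complex_norm_square[of u] by (simp add: l_def mult.commute)
  then have "Re (cnj l * u) = - ((norm u)\<^sup>2 / r)" by (simp only: uminus_complex.sel Re_complex_of_real)
  ultimately have "(norm u)\<^sup>2 / r \<le> 2 * r - 2 * Re (w (x - y))" using * by linarith
  then show ?thesis using r(2) by (simp add: u_def r_def[symmetric] field_simps power2_eq_square)
qed

lemma pos_def_real_diff_mono:
  assumes "pos_def q" "pos_def (\<lambda>x. k x - q x)"
  shows "Re (q 0) - Re (q x) \<le> Re (k 0) - Re (k x)" "Re (q 0) \<le> Re (k 0)"
  using pos_def_norm_le[OF assms(2), of x] complex_Re_le_cmod[of "k x - q x"] pos_def_zero(1)[OF assms(2)] by auto

text \<open>In Fourier terms the Cauchy--Schwarz inequality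
  \<open>|\<Sum> c_i \<chi>(t_i)|^2 \<le> n \<Sum> |c_i|^2\<close>. The difference of the two sides
  is half the sum over all \<open>i\<close>, \<open>j\<close> of the two-point functions with
  coefficients \<open>c i\<close> and \<open>- c j\<close>.\<close>

lemma pos_def_twist_le:
  assumes "pos_def w"
  shows "pos_def (\<lambda>x. of_real (of_nat n * (\<Sum>i<n. (norm (c i))\<^sup>2)) * w x - twist n c t w x)"
proof -
  have *: "2 * (of_nat n * (\<Sum>i<n. c i * cnj (c i)) * w x - twist n c t w x) =
    (\<Sum>i<n. \<Sum>j<n. (c i * cnj (c i) + (- c j) * cnj (- c j)) * w x + c i * cnj (- c j) * w (x + (t i - t j))
      + (- c j) * cnj (c i) * w (x - (t i - t j)))" (is "_ = ?r x") for x
  proof -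
    have 1: "(\<Sum>i<n. \<Sum>j<n. c i * cnj (c i) * w x) = of_nat n * (\<Sum>i<n. c i * cnj (c i)) * w x"
      by (simp add: sum_distrib_left sum_distrib_right mult_ac)
    have 2: "(\<Sum>i<n. \<Sum>j<n. c j * cnj (c j) * w x) = of_nat n * (\<Sum>i<n. c i * cnj (c i)) * w x"
      by (simp add: sum_distrib_left sum_distrib_right mult_ac)
    have 3: "(\<Sum>i<n. \<Sum>j<n. c j * cnj (c i) * w (x + t j - t i)) = twist n c t w x"
      unfolding twist_def by (rule sum.swap)
    have "?r x = (\<Sum>i<n. \<Sum>j<n. c i * cnj (c i) * w x) + (\<Sum>i<n. \<Sum>j<n. c j * cnj (c j) * w x)
      - twist n c t w x - (\<Sum>i<n. \<Sum>j<n. c j * cnj (c i) * w (x + t j - t i))"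
      unfolding twist_def sum.distrib[symmetric] sum_subtractf[symmetric]
      by (intro sum.cong refl) (simp add: algebra_simps)
    then show ?thesis unfolding 1 2 3 by simp
  qed
  have "pos_def (\<lambda>x. of_real (1/2) * ?r x)"
    by (intro pos_def_scale pos_def_sum pos_def_two_point assms) simp
  also have "(\<lambda>x. of_real (1/2) * ?r x) = (\<lambda>x. of_real (of_nat n * (\<Sum>i<n. (norm (c i))\<^sup>2)) * w x - twist n c t w x)"
  proof
    fix x
    have "of_real (\<Sum>i<n. (norm (c i))\<^sup>2) = (\<Sum>i<n. c i * cnj (c i))"
      by (simp only: of_real_sum complex_norm_square)
    then show "of_real (1/2) * ?r x = of_real (of_nat n * (\<Sum>i<n. (norm (c i))\<^sup>2)) * w x - twist n c t w x"
      unfolding *[symmetric] of_real_mult by simp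
  qed
  finally show ?thesis .
qed

text \<open>Averaging over the translates by \<open>t i\<close> and then by \<open>- t j\<close>
  produces at \<open>0\<close> the quadratic form with all coefficients \<open>1\<close>, divided by
  \<open>n^2\<close>, and still approximates the mean.\<close>

lemma pos_def_mean_nonneg:
  assumes "pos_def w" "has_mean w c"
  shows "0 \<le> Re c"
proof (rule field_le_epsilon)
  fix e :: real assume "e > 0"
  then obtain n t where n: "n > 0" "\<And>x. norm (translate_avg n t w x - c) \<le> e"
    using has_meanD[OF assms(2)] by blast
  have "translate_avg n (\<lambda>j. - t j) (translate_avg n t w) 0 =
      of_real (1 / (real n)\<^sup>2) * (\<Sum>j<n. \<Sum>i<n. w (t i - t j))"
    by (simp add: translate_avg_def power2_eq_square flip: sum_divide_distrib)
  also have "(\<Sum>j<n. \<Sum>i<n. w (t i - t j)) = (\<Sum>i<n. \<Sum>j<n. 1 * cnj 1 * w (t i - t j))"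
    by (subst sum.swap) simp
  finally have "Re (translate_avg n (\<lambda>j. - t j) (translate_avg n t w) 0) =
     1 / (real n)\<^sup>2 * Re (\<Sum>i<n. \<Sum>j<n. 1 * cnj 1 * w (t i - t j))" by simp
  then have "0 \<le> Re (translate_avg n (\<lambda>j. - t j) (translate_avg n t w) 0)"
    using pos_def_sum_nonneg[OF assms(1), of "{..<n}" "\<lambda>_. 1" t] by (simp del: Re_sum)
  moreover have "norm (translate_avg n (\<lambda>j. - t j) (translate_avg n t w) 0 - c) \<le> e"
    by (rule translate_avg_near) (use n in auto)
  ultimately show "0 \<le> Re c + e"
    using abs_Re_le_cmod[of "translate_avg n (\<lambda>j. - t j) (translate_avg n t w) 0 - c"] by simp
qed

section \<open>Characters of compact Abelian groups\<close>

lemma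
  assumes "\<phi> \<in> character_group"
  shows character_norm: "norm (\<phi> x) = 1"
    and character_add: "\<phi> (x + y) = \<phi> x * \<phi> y"
    and character_continuous: "continuous_on UNIV \<phi>"
    and character_nonzero: "\<phi> x \<noteq> 0"
    and character_zero: "\<phi> 0 = 1"
    and character_minus: "\<phi> (- x) = cnj (\<phi> x)"
    and character_mult_cnj: "\<phi> x * cnj (\<phi> x) = 1"
proof -
  show n: "norm (\<phi> x) = 1" for x using assms by (simp add: character_group_def)
  show a: "\<phi> (x + y) = \<phi> x * \<phi> y" for x y using assms by (simp add: character_group_def)
  show "continuous_on UNIV \<phi>" using assms by (simp add: character_group_def)
  show nz: "\<phi> x \<noteq> 0" for x using n[of x] by auto
  show z: "\<phi> 0 = 1" using a[of 0 0] nz[of 0] by simp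
  show c: "\<phi> x * cnj (\<phi> x) = 1" for x
    using complex_norm_square[of "\<phi> x"] n[of x] by simp
  have "\<phi> x * \<phi> (- x) = 1" using a[of x "- x"] z by simp
  then show "\<phi> (- x) = cnj (\<phi> x)" using c[of x] nz[of x] by (metis mult_left_cancel)
qed

lemma norm_eq_1_if_mult_cnj:
  assumes "z * cnj z = 1"
  shows "norm z = 1"
proof -
  have "(norm z)\<^sup>2 = 1" using assms complex_norm_square[of z] by (metis of_real_eq_1_iff)
  then show ?thesis using norm_ge_zero[of z] unfolding power2_eq_1_iff by linarith
qed

lemma character_diff: "\<phi> \<in> character_group \<Longrightarrow> \<phi> (x - y) = \<phi> x * cnj (\<phi> y)"
  using character_add[of \<phi> x "- y"] character_minus[of \<phi> y] by simp

section \<open>Order intervals of positive definite functions\<close>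

definition dominated :: "('g::ab_group_add \<Rightarrow> complex) \<Rightarrow> ('g \<Rightarrow> complex) set" where
  "dominated k = {q. pos_def q \<and> pos_def (\<lambda>x. k x - q x)}"

lemma dominatedI: "pos_def q \<Longrightarrow> pos_def (\<lambda>x. k x - q x) \<Longrightarrow> q \<in> dominated k"
  by (simp add: dominated_def)

lemma dominated_norm_le:
  assumes "q \<in> dominated k"
  shows "norm (q x) \<le> Re (k 0)"
proof -
  have q: "pos_def q" "pos_def (\<lambda>x. k x - q x)" using assms by (auto simp: dominated_def)
  show ?thesis using pos_def_norm_le[OF q(1), of x] pos_def_real_diff_mono(2)[OF q] by simp
qed

text \<open>Krein's inequality for \<open>q\<close>, whose right-hand side can only grow when
  \<open>q\<close> is replaced by \<open>k\<close>. The resulting bound is the same for the whole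
  interval, whence its equicontinuity.\<close>

lemma dominated_norm_diff_le:
  assumes "q \<in> dominated k"
  shows "(norm (q x - q y))\<^sup>2 \<le> 2 * Re (k 0) * (Re (k 0) - Re (k (x - y)))"
proof -
  have q: "pos_def q" "pos_def (\<lambda>x. k x - q x)" using assms by (auto simp: dominated_def)
  have "(norm (q x - q y))\<^sup>2 \<le> 2 * Re (q 0) * (Re (q 0) - Re (q (x - y)))"
    by (rule pos_def_norm_diff_le[OF q(1)])
  also have "\<dots> \<le> 2 * Re (k 0) * (Re (k 0) - Re (k (x - y)))"
    using pos_def_real_diff_mono(1)[OF q, of "x - y"] pos_def_real_diff_mono(2)[OF q] pos_def_zero(1)[OF q(1)]
      complex_Re_le_cmod[of "q (x - y)"] pos_def_norm_le[OF q(1), of "x - y"]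
    by (intro mult_mono) auto
  finally show ?thesis .
qed

lemma continuous_on_shift:
  fixes w :: "'g::topological_monoid_add \<Rightarrow> 'b::topological_space"
  assumes "continuous_on UNIV w"
  shows "continuous_on UNIV (\<lambda>x. w (x + a))"
  by (rule continuous_on_compose2[OF assms]) (auto intro!: continuous_intros)

lemma continuous_on_twist:
  fixes w :: "'g::topological_ab_group_add \<Rightarrow> complex"
  assumes "continuous_on UNIV w"
  shows "continuous_on UNIV (twist n c t w)"
proof -
  have "twist n c t w = (\<lambda>x. \<Sum>i<n. \<Sum>j<n. c i * cnj (c j) * w (x + (t i - t j)))"
    by (auto simp: twist_def add_diff_eq)
  then show ?thesis by (simp add: continuous_intros continuous_on_shift[OF assms])
qed

lemma dominated_uniformly_equicontinuous:
  fixes k :: "'g::topological_ab_group_add \<Rightarrow> complex"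
  assumes "continuous_on UNIV k" "e > 0"
  shows "\<exists>U. open U \<and> 0 \<in> U \<and> (\<forall>q\<in>dominated k. \<forall>x y. x - y \<in> U \<longrightarrow> norm (q x - q y) < e)"
proof -
  let ?U = "{s. 2 * Re (k 0) * (Re (k 0) - Re (k s)) < e\<^sup>2}"
  have "open ?U"
    by (intro open_Collect_less continuous_intros assms)
  moreover have "0 \<in> ?U" using assms by simp
  moreover have "norm (q x - q y) < e" if "q \<in> dominated k" "x - y \<in> ?U" for q x y
  proof -
    have "(norm (q x - q y))\<^sup>2 < e\<^sup>2"
      using dominated_norm_diff_le[OF that(1), of x y] that(2) by simp
    then show ?thesis using assms(2) by (simp add: power2_less_imp_less)
  qed
  ultimately show ?thesis by (intro exI[of _ ?U]) blast
qed

lemma continuous_on_uniformI: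
  fixes f :: "'g::topological_ab_group_add \<Rightarrow> 'b::metric_space"
  assumes "\<And>e. e > 0 \<Longrightarrow> \<exists>U. open U \<and> 0 \<in> U \<and> (\<forall>x y. x - y \<in> U \<longrightarrow> dist (f x) (f y) < e)"
  shows "continuous_on UNIV f"
  unfolding continuous_on_def
proof (intro ballI tendstoI)
  fix a :: 'g and e :: real assume "e > 0"
  then obtain U where U: "open U" "0 \<in> U" "\<And>x y. x - y \<in> U \<Longrightarrow> dist (f x) (f y) < e"
    using assms by blast
  have "open ((\<lambda>x. x - a) -` U)"
    by (intro open_vimage U continuous_intros)
  moreover have "a \<in> (\<lambda>x. x - a) -` U" using U by simp
  ultimately show "\<forall>\<^sub>F x in at a. dist (f x) (f a) < e"
    unfolding eventually_at_topological using U(3) by (intro exI[of _ "(\<lambda>x. x - a) -` U"]) auto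
qed

lemma continuous_on_dominated:
  fixes k :: "'g::topological_ab_group_add \<Rightarrow> complex"
  assumes "continuous_on UNIV k" "q \<in> dominated k"
  shows "continuous_on UNIV q"
  using dominated_uniformly_equicontinuous[OF assms(1)] assms(2)
  by (intro continuous_on_uniformI) (metis dist_norm)

lemma closed_pos_def:
  fixes F :: "'z::topological_space \<Rightarrow> 'g::ab_group_add \<Rightarrow> complex"
  assumes "\<And>x. continuous_on UNIV (\<lambda>q. F q x)"
  shows "closed {q. pos_def (F q)}"
  unfolding pos_def_def
  by (intro closed_Collect_conj closed_Collect_all closed_Collect_eq closed_Collect_le
      continuous_on_cnj continuous_on_Re continuous_on_sum continuous_on_mult continuous_on_const assms)

text \<open>The functions are bounded by \<open>Re (k 0)\<close>, so they lie in a product of discs,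
  compact by Tychonoff, and positive definiteness is closed under pointwise convergence.\<close>

lemma compact_dominated:
  fixes k :: "'g::topological_ab_group_add \<Rightarrow> complex"
  shows "compact (dominated k)"
proof -
  have "compactin (product_topology (\<lambda>x::'g. euclidean) UNIV) (PiE UNIV (\<lambda>x. cball (0::complex) (Re (k 0))))"
    unfolding compactin_PiE by simp
  then have *: "compact (PiE UNIV (\<lambda>x::'g. cball (0::complex) (Re (k 0))))"
    by (simp add: euclidean_product_topology)
  have "closed {q. pos_def (\<lambda>x. q x)}" "closed {q. pos_def (\<lambda>x. k x - q x)}"
    by (intro closed_pos_def continuous_on_diff continuous_on_const continuous_on_product_coordinates)+
  then have "closed (dominated k)"
    unfolding dominated_def by (rule closed_Collect_conj)
  moreover have "dominated k \<subseteq> PiE UNIV (\<lambda>x. cball 0 (Re (k 0)))"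
    using dominated_norm_le[of _ k] by auto
  ultimately show ?thesis using compact_Int_closed[OF *] by (metis inf.absorb2)
qed

section \<open>The inner product of L^2 and the existence of characters\<close>

definition ip :: "('g::ab_group_add \<Rightarrow> complex) \<Rightarrow> ('g \<Rightarrow> complex) \<Rightarrow> complex" where
  "ip f g = mean (\<lambda>x. f x * cnj (g x))"

context compact_ab_group
begin

lemma ip_cnj:
  fixes f g :: "'g \<Rightarrow> complex"
  assumes "continuous_on UNIV f" "continuous_on UNIV g"
  shows "ip g f = cnj (ip f g)"
  using mean_cnj[of "\<lambda>x. f x * cnj (g x)"] assms
  by (simp add: ip_def continuous_intros mult.commute)

text \<open>The expansion along a line, for comparing a maximiser with its perturbations.\<close>

lemma Re_ip_add_scaled:
  fixes f g :: "'g \<Rightarrow> complex"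
  assumes "continuous_on UNIV f" "continuous_on UNIV g"
  shows "Re (ip (\<lambda>x. f x + of_real r * g x) (\<lambda>x. f x + of_real r * g x)) =
    Re (ip f f) + 2 * r * Re (ip f g) + r\<^sup>2 * Re (ip g g)"
proof -
  note c = assms continuous_on_cnj continuous_on_mult continuous_on_add continuous_on_const
  have "ip (\<lambda>x. f x + of_real r * g x) (\<lambda>x. f x + of_real r * g x) =
      mean (\<lambda>x. (f x * cnj (f x) + of_real r * (f x * cnj (g x))) +
        (of_real r * (g x * cnj (f x)) + of_real (r\<^sup>2) * (g x * cnj (g x))))"
    unfolding ip_def by (rule arg_cong[of _ _ mean]) (simp add: fun_eq_iff algebra_simps power2_eq_square)
  also have "\<dots> = (ip f f + of_real r * ip f g) + (of_real r * ip g f + of_real (r\<^sup>2) * ip g g)"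
    unfolding ip_def by (simp only: mean_add mean_cmult c)
  finally show ?thesis unfolding ip_cnj[OF assms] by (simp del: of_real_power)
qed

lemma ip_self_nonneg:
  fixes f :: "'g \<Rightarrow> complex"
  assumes "continuous_on UNIV f"
  shows "0 \<le> Re (ip f f)"
  using mean_mono[of "\<lambda>x. 0" "\<lambda>x. f x * cnj (f x)"] assms
  by (simp add: ip_def continuous_intros)

lemma ip_self_pos:
  fixes f :: "'g \<Rightarrow> complex"
  assumes "continuous_on UNIV f" "f a \<noteq> 0"
  shows "0 < Re (ip f f)"
  unfolding ip_def
proof (rule mean_pos[of _ a])
  show "0 < Re (f a * cnj (f a))"
    using assms(2) by (simp only: complex_norm_square[symmetric] Re_complex_of_real) simp
qed (auto intro!: continuous_intros assms)

lemma Re_ip_le: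
  fixes f g :: "'g \<Rightarrow> complex"
  assumes "continuous_on UNIV f" "continuous_on UNIV g" "\<And>x. norm (f x) \<le> A" "\<And>x. norm (g x) \<le> B"
  shows "Re (ip f g) \<le> A * B"
proof -
  have "norm (ip f g) \<le> A * B"
    unfolding ip_def using assms(3) order_trans[OF norm_ge_zero assms(3)]
    by (intro mean_norm_le continuous_intros assms) (auto simp: norm_mult intro!: mult_mono assms)
  then show ?thesis using complex_Re_le_cmod[of "ip f g"] by simp
qed

text \<open>By equicontinuity, closeness at finitely many points already gives uniform closeness on
  the whole group, so pointwise convergence in the interval is uniform.\<close>

lemma continuous_on_ip_self:
  fixes k :: "'g \<Rightarrow> complex"
  assumes "continuous_on UNIV k"
  shows "continuous_on (dominated k) (\<lambda>q. Re (ip q q))"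
  unfolding continuous_on_def
proof (intro ballI tendstoI)
  fix p :: "'g \<Rightarrow> complex" and e :: real
  assume p: "p \<in> dominated k" and "e > 0"
  define B where "B = Re (k 0)"
  have B: "norm (q x) \<le> B" if "q \<in> dominated k" for q x
    using dominated_norm_le[OF that] by (simp add: B_def)
  have "B \<ge> 0" using B[OF p] norm_ge_zero order_trans by blast
  \<comment> \<open>Uniform distance \<open>3 * d\<close> changes the squared modulus by at most
    \<open>6 * B * d\<close>; the summand \<open>1\<close> covers \<open>B = 0\<close>.\<close>
  define d where "d = e / (6 * B + 1)"
  have "d > 0" using \<open>e > 0\<close> \<open>B \<ge> 0\<close> by (simp add: d_def)
  obtain U where U: "open U" "0 \<in> U"
    "\<And>q x y. q \<in> dominated k \<Longrightarrow> x - y \<in> U \<Longrightarrow> norm (q x - q y) < d"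
    using dominated_uniformly_equicontinuous[OF assms \<open>d > 0\<close>] by blast
  obtain n a where n: "(n::nat) > 0" "\<And>x. \<exists>i<n. x + a i \<in> U"
    using finite_translates_cover[OF U(1,2)] by metis
  have "continuous_on UNIV (\<lambda>q::'g \<Rightarrow> complex. q x)" for x
    by (rule continuous_on_product_coordinates)
  then have "(\<lambda>q. q x) \<midarrow>p\<rightarrow> p x" for x :: 'g
    unfolding continuous_on_def by simp
  then have "\<forall>\<^sub>F q in at p. dist (q x) (p x) < d" for x
    using \<open>d > 0\<close> by (rule tendstoD)
  then have "\<forall>\<^sub>F q in at p. \<forall>i\<in>{..<n}. dist (q (- a i)) (p (- a i)) < d"
    by (intro eventually_ball_finite) auto
  then have "\<forall>\<^sub>F q in at p within dominated k. \<forall>i\<in>{..<n}. dist (q (- a i)) (p (- a i)) < d"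
    by (rule filter_leD[OF at_le[OF subset_UNIV]])
  moreover have "\<forall>\<^sub>F q in at p within dominated k. q \<in> dominated k"
    by (simp add: eventually_at_topological) auto
  ultimately show "\<forall>\<^sub>F q in at p within dominated k. dist (Re (ip q q)) (Re (ip p p)) < e"
  proof eventually_elim
    case (elim q)
    \<comment> \<open>Comparison at the point \<open>- a i\<close>, which differs from
      \<open>x\<close> by an element of \<open>U\<close>.\<close>
    have qp: "norm (q x - p x) \<le> 3 * d" for x
    proof -
      obtain i where i: "i < n" "x + a i \<in> U" using n(2) by blast
      have "norm (q x - q (- a i)) < d" "norm (p x - p (- a i)) < d"
        using U(3)[of _ x "- a i"] i(2) elim p by auto
      moreover have "norm (q (- a i) - p (- a i)) < d" using elim i by (simp add: dist_norm)
      moreover have "q x - p x = (q x - q (- a i)) + (q (- a i) - p (- a i)) - (p x - p (- a i))" by simp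
      ultimately show ?thesis
        using norm_triangle_ineq4[of "(q x - q (- a i)) + (q (- a i) - p (- a i))" "p x - p (- a i)"]
          norm_triangle_ineq[of "q x - q (- a i)" "q (- a i) - p (- a i)"] by simp
    qed
    have "norm (q x * cnj (q x) - p x * cnj (p x)) \<le> 6 * B * d" for x
    proof -
      have "q x * cnj (q x) - p x * cnj (p x) = (q x - p x) * cnj (q x) + p x * cnj (q x - p x)"
        by (simp add: algebra_simps)
      also have "norm \<dots> \<le> norm (q x - p x) * norm (q x) + norm (p x) * norm (q x - p x)"
        by (rule order_trans[OF norm_triangle_ineq]) (simp add: norm_mult del: complex_cnj_diff)
      also have "\<dots> \<le> (3 * d) * B + B * (3 * d)"
        using qp B p elim \<open>d > 0\<close> \<open>B \<ge> 0\<close> by (intro add_mono mult_mono) auto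
      finally show ?thesis by simp
    qed
    then have "norm (ip q q - ip p p) \<le> 6 * B * d"
      unfolding ip_def using continuous_on_dominated[OF assms] p elim
      by (intro mean_norm_diff_le continuous_intros) auto
    also have "\<dots> < e" using \<open>e > 0\<close> \<open>B \<ge> 0\<close> by (simp add: d_def field_simps)
    finally show ?case
      using abs_Re_le_cmod[of "ip q q - ip p p"] by (simp add: dist_real_def)
  qed
qed

text \<open>
  In terms of Fourier coefficients the conclusion says that those of \<open>q\<close> are either \<open>0\<close> or at
  least \<open>c (q 0)\<close>. It is the first-order condition for a maximiser \<open>q\<close>, perturbed to \<open>q - \<epsilon> s\<close>.
\<close>

lemma spectral_truncation:
  fixes k :: "'g \<Rightarrow> complex"
  assumes k: "continuous_on UNIV k" "pos_def k" and k0: "0 < Re (k 0)"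
  shows "\<exists>q\<in>dominated k. \<exists>c>0. 0 < Re (q 0) \<and>
    (\<forall>s\<in>dominated q. c * Re (q 0) * Re (s 0) \<le> Re (ip q s))"
proof -
  \<comment> \<open>This \<open>c\<close> gives \<open>\<Phi> k = Re (ip k k) / 2 > 0\<close>, so
    that the maximiser is not the zero function.\<close>
  define c where "c = Re (ip k k) / (2 * (Re (k 0))\<^sup>2)"
  have kk: "0 < Re (ip k k)" using k0 by (intro ip_self_pos[of k 0] k) auto
  then have c: "c > 0" using k0 by (simp add: c_def)
  define \<Phi> where "\<Phi> q = Re (ip q q) - c * (Re (q 0))\<^sup>2" for q :: "'g \<Rightarrow> complex"
  have kD: "k \<in> dominated k" using k pos_def_0 by (intro dominatedI) auto
  have "continuous_on (dominated k) \<Phi>"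
    unfolding \<Phi>_def by (intro continuous_intros continuous_on_ip_self k)
      (auto intro: continuous_on_subset[OF continuous_on_product_coordinates])
  then obtain q where q: "q \<in> dominated k" "\<And>p. p \<in> dominated k \<Longrightarrow> \<Phi> p \<le> \<Phi> q"
    using continuous_attains_sup[OF compact_dominated] kD by blast
  have pq: "pos_def q" "pos_def (\<lambda>x. k x - q x)" using q(1) by (auto simp: dominated_def)
  have cq: "continuous_on UNIV q" by (rule continuous_on_dominated[OF k(1) q(1)])
  have "\<Phi> k = Re (ip k k) / 2" using k0 by (simp add: \<Phi>_def c_def)
  then have "\<Phi> q > 0" using q(2)[OF kD] kk by simp
  have q0: "Re (q 0) > 0"
  proof (rule ccontr)
    assume "\<not> Re (q 0) > 0"
    then have "Re (q 0) = 0" using pos_def_zero[OF pq(1)] by simp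
    then have "q = (\<lambda>x. 0)" using pos_def_norm_le[OF pq(1)] by auto
    then show False using \<open>\<Phi> q > 0\<close> by (simp add: \<Phi>_def ip_def)
  qed
  have "c * Re (q 0) * Re (s 0) \<le> Re (ip q s)" if s: "s \<in> dominated q" for s
  proof (rule field_le_epsilon)
    fix \<delta> :: real assume "\<delta> > 0"
    have ps: "pos_def s" "pos_def (\<lambda>x. q x - s x)" using s by (auto simp: dominated_def)
    have cs: "continuous_on UNIV s" by (rule continuous_on_dominated[OF cq s])
    define M where "M = c * (Re (s 0))\<^sup>2"
    have "M \<ge> 0" using c by (simp add: M_def)
    \<comment> \<open>\<open>\<epsilon> \<le> 1\<close> keeps \<open>q - \<epsilon> s\<close>
      positive definite; the other bound makes the quadratic term small against
      \<open>\<delta>\<close>.\<close>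
    define \<epsilon> where "\<epsilon> = min 1 (2 * \<delta> / (M + 1))"
    have \<epsilon>: "0 < \<epsilon>" "\<epsilon> \<le> 1" "\<epsilon> * M \<le> 2 * \<delta>"
    proof -
      show "0 < \<epsilon>" "\<epsilon> \<le> 1" using \<open>\<delta> > 0\<close> \<open>M \<ge> 0\<close> by (auto simp: \<epsilon>_def)
      have "\<epsilon> * M \<le> 2 * \<delta> / (M + 1) * M" using \<open>M \<ge> 0\<close> by (intro mult_right_mono) (auto simp: \<epsilon>_def)
      also have "\<dots> \<le> 2 * \<delta>" using \<open>M \<ge> 0\<close> \<open>\<delta> > 0\<close> by (simp add: field_simps)
      finally show "\<epsilon> * M \<le> 2 * \<delta>" .
    qed
    let ?r = "\<lambda>x. q x + of_real (- \<epsilon>) * s x"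
    have "?r \<in> dominated k"
    proof (rule dominatedI)
      have "pos_def (\<lambda>x. of_real (1 - \<epsilon>) * q x + of_real \<epsilon> * (q x - s x))"
        using \<epsilon> by (intro pos_def_add pos_def_scale pq ps) auto
      then show "pos_def ?r" by (simp add: algebra_simps)
      have "pos_def (\<lambda>x. (k x - q x) + of_real \<epsilon> * s x)"
        using \<epsilon> by (intro pos_def_add pos_def_scale pq ps) auto
      then show "pos_def (\<lambda>x. k x - ?r x)" by (simp add: algebra_simps)
    qed
    then have "\<Phi> ?r \<le> \<Phi> q" by (rule q(2))
    then have "Re (ip q q) - 2 * \<epsilon> * Re (ip q s) + \<epsilon>\<^sup>2 * Re (ip s s) - c * (Re (q 0) - \<epsilon> * Re (s 0))\<^sup>2
        \<le> Re (ip q q) - c * (Re (q 0))\<^sup>2"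
      unfolding \<Phi>_def Re_ip_add_scaled[OF cq cs] by simp
    moreover have "0 \<le> \<epsilon>\<^sup>2 * Re (ip s s)" using ip_self_nonneg[OF cs] by simp
    \<comment> \<open>Maximality of \<open>q\<close>, with the nonnegative term in
      \<open>ip s s\<close> dropped.\<close>
    ultimately have "\<epsilon> * (2 * (c * Re (q 0) * Re (s 0))) \<le> \<epsilon> * (2 * Re (ip q s) + \<epsilon> * M)"
      by (simp add: M_def power2_eq_square algebra_simps)
    then have "2 * (c * Re (q 0) * Re (s 0)) \<le> 2 * Re (ip q s) + \<epsilon> * M"
      using \<epsilon>(1) by (simp only: mult_le_cancel_left_pos)
    then show "c * Re (q 0) * Re (s 0) \<le> Re (ip q s) + \<delta>" using \<epsilon>(3) by linarith
  qed
  then show ?thesis using q(1) q0 c by blast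
qed

text \<open>
  With the convolution \<open>v\<close> of \<open>r\<close> and \<open>q\<close>, both \<open>v - a r\<close> and \<open>q - v\<close> are positive definite: the
  coefficients of \<open>q\<close> are at least \<open>a\<close> wherever \<open>r\<close> has any, and those of \<open>r\<close> are at most \<open>r 0 = 1\<close>.
\<close>

lemma truncation_dominates:
  fixes q r :: "'g \<Rightarrow> complex"
  assumes q: "continuous_on UNIV q" "pos_def q"
    and lower: "\<And>s. s \<in> dominated q \<Longrightarrow> a * Re (s 0) \<le> Re (ip q s)"
    and r: "pos_def r" "pos_def (\<lambda>x. of_real D * q x - r x)" "D \<ge> 0" "Re (r 0) = 1"
  shows "pos_def (\<lambda>x. q x - of_real a * r x)"
proof -
  have cDq: "continuous_on UNIV (\<lambda>x. of_real D * q x)" by (intro continuous_intros q)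
  have cr: "continuous_on UNIV r"
    by (rule continuous_on_dominated[OF cDq]) (intro dominatedI r)
  note cont = continuous_on_mult continuous_on_cnj continuous_on_const q(1) cr
    continuous_on_shift[OF cr] continuous_on_shift[OF q(1)] continuous_on_twist
  \<comment> \<open>The convolution of \<open>r\<close> and \<open>q\<close>, because
    \<open>q\<close> is hermitian.\<close>
  define v where "v t = mean (\<lambda>x. r (x + t) * cnj (q x))" for t
  have v_minus: "v (- t) = cnj (v t)" for t
  proof -
    have "cnj (v t) = mean (\<lambda>x. cnj (r (x + t) * cnj (q x)))"
      unfolding v_def by (rule mean_cnj[symmetric]) (intro cont)
    also have "\<dots> = mean (\<lambda>x. cnj (r (- x + t) * cnj (q (- x))))"
      by (rule mean_reflect[symmetric])
    also have "\<dots> = v (- t)"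
      unfolding v_def using pos_def_minus[OF r(1)] pos_def_minus[OF q(2)]
      by (intro arg_cong[of _ _ mean] ext) (metis complex_cnj_cnj complex_cnj_mult add_uminus_conv_diff minus_diff_eq uminus_add_conv_diff)
    finally show ?thesis ..
  qed
  have v_sum: "(\<Sum>i<n. \<Sum>j<n. c i * cnj (c j) * v (t i - t j)) = ip (twist n c t r) q" for n c t
  proof -
    have "ip (twist n c t r) q = mean (\<lambda>x. \<Sum>i<n. \<Sum>j<n. c i * cnj (c j) * (r (x + (t i - t j)) * cnj (q x)))"
      unfolding ip_def twist_def
      by (rule arg_cong[of _ _ mean]) (simp add: fun_eq_iff sum_distrib_right mult.assoc add_diff_eq)
    also have "\<dots> = (\<Sum>i<n. \<Sum>j<n. c i * cnj (c j) * mean (\<lambda>x. r (x + (t i - t j)) * cnj (q x)))"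
      by (simp only: mean_sum mean_cmult continuous_on_sum cont)
    finally show ?thesis by (simp add: v_def)
  qed
  have "pos_def (\<lambda>x. v x - of_real a * r x)"
  proof (rule pdI)
    show "v (- x) - of_real a * r (- x) = cnj (v x - of_real a * r x)" for x
      by (simp add: v_minus pos_def_minus[OF r(1)])
    fix n c and t :: "nat \<Rightarrow> 'g"
    define s where "s = twist n c t r"
    \<comment> \<open>\<open>s\<close> lies below \<open>K q\<close>: \<open>r\<close> lies below
      \<open>D q\<close>, and twisting multiplies by at most \<open>n \<Sum> |c_i|^2\<close>. The
      summand \<open>1\<close> makes \<open>K\<close> positive.\<close>
    define K where "K = D * (of_nat n * (\<Sum>i<n. (norm (c i))\<^sup>2)) + 1"
    have K: "K > 0" using r(3) by (simp add: K_def sum_nonneg add_nonneg_pos)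
    have ps: "pos_def s" unfolding s_def by (rule pos_def_twist[OF r(1)])
    have "pos_def (\<lambda>x. (of_real D * (of_real (of_nat n * (\<Sum>i<n. (norm (c i))\<^sup>2)) * q x - twist n c t q x)
         + twist n c t (\<lambda>x. of_real D * q x - r x) x) + q x)"
      by (intro pos_def_add pos_def_scale pos_def_twist_le pos_def_twist q r)
    also have "twist n c t (\<lambda>x. of_real D * q x - r x) = (\<lambda>x. of_real D * twist n c t q x - s x)"
      by (simp add: s_def twist_def fun_eq_iff sum_subtractf right_diff_distrib sum_distrib_left mult_ac)
    finally have "pos_def (\<lambda>x. of_real K * q x - s x)"
      by (simp add: K_def algebra_simps)
    then have "pos_def (\<lambda>x. of_real (1 / K) * (of_real K * q x - s x))"
      using K by (intro pos_def_scale) auto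
    then have "pos_def (\<lambda>x. q x - of_real (1 / K) * s x)"
      using K by (simp add: right_diff_distrib)
    \<comment> \<open>Scaling by \<open>1 / K\<close> moves \<open>s\<close> into the interval where
      \<open>lower\<close> applies; the estimate is homogeneous in \<open>s\<close>, so the factor
      disappears again.\<close>
    then have "(\<lambda>x. of_real (1 / K) * s x) \<in> dominated q"
      using K by (intro dominatedI pos_def_scale ps) auto
    from lower[OF this] have "a * Re (s 0) / K \<le> Re (ip q (\<lambda>x. of_real (1 / K) * s x))" by simp
    also have "ip q (\<lambda>x. of_real (1 / K) * s x) = of_real (1 / K) * ip q s"
      using mean_cmult[of "\<lambda>x. q x * cnj (s x)" "of_real (1 / K)"]
      by (simp add: ip_def cont s_def mult_ac del: of_real_divide)
    finally have "a * Re (s 0) \<le> Re (ip q s)"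
      using K by (simp add: field_simps)
    moreover have "ip s q = cnj (ip q s)" by (rule ip_cnj) (simp_all only: s_def cont)
    moreover have "(\<Sum>i<n. \<Sum>j<n. c i * cnj (c j) * (v (t i - t j) - of_real a * r (t i - t j))) =
        ip s q - of_real a * s 0"
      unfolding s_def v_sum[symmetric]
      by (simp add: twist_def right_diff_distrib sum_subtractf sum_distrib_left mult_ac)
    ultimately show "0 \<le> Re (\<Sum>i<n. \<Sum>j<n. c i * cnj (c j) * (v (t i - t j) - of_real a * r (t i - t j)))"
      by (simp only:) simp
  qed
  moreover have "pos_def (\<lambda>x. q x - v x)"
  proof (rule pdI)
    show "q (- x) - v (- x) = cnj (q x - v x)" for x
      by (simp add: v_minus pos_def_minus[OF q(2)])
    fix n c and t :: "nat \<Rightarrow> 'g"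
    define s where "s = twist n c t q"
    have ps: "pos_def s" unfolding s_def by (rule pos_def_twist[OF q(2)])
    \<comment> \<open>After a translation the twist falls on \<open>q\<close> instead of
      \<open>r\<close>.\<close>
    have v: "v t = mean (\<lambda>x. r x * cnj (q (x + - t)))" for t
      unfolding v_def using mean_translate[of "\<lambda>x. r (x + t) * cnj (q x)" "- t"] by simp
    have "ip r s = mean (\<lambda>x. \<Sum>i<n. \<Sum>j<n. c i * cnj (c j) * (r x * cnj (q (x + - (t i - t j)))))"
      unfolding ip_def s_def twist_def
      by (subst sum.swap, rule arg_cong[of _ _ mean]) (simp add: fun_eq_iff sum_distrib_left mult_ac algebra_simps)
    also have "\<dots> = (\<Sum>i<n. \<Sum>j<n. c i * cnj (c j) * mean (\<lambda>x. r x * cnj (q (x + - (t i - t j)))))"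
      by (simp only: mean_sum mean_cmult continuous_on_sum cont)
    also have "\<dots> = (\<Sum>i<n. \<Sum>j<n. c i * cnj (c j) * v (t i - t j))"
      unfolding v by (rule refl)
    finally have "(\<Sum>i<n. \<Sum>j<n. c i * cnj (c j) * (q (t i - t j) - v (t i - t j))) = s 0 - ip r s"
      by (simp add: s_def twist_def right_diff_distrib sum_subtractf)
    \<comment> \<open>Here the normalisation of \<open>r\<close> enters: \<open>|r| \<le> 1\<close>,
      while \<open>|s| \<le> s 0\<close>.\<close>
    moreover have "Re (ip r s) \<le> 1 * Re (s 0)"
      by (rule Re_ip_le) (use pos_def_norm_le[OF ps] pos_def_norm_le[OF r(1)] r(4) in \<open>auto simp: s_def intro: cont\<close>)
    ultimately show "0 \<le> Re (\<Sum>i<n. \<Sum>j<n. c i * cnj (c j) * (q (t i - t j) - v (t i - t j)))"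
      by (simp only:) simp
  qed
  ultimately have "pos_def (\<lambda>x. (v x - of_real a * r x) + (q x - v x))" by (rule pos_def_add)
  then show ?thesis by (simp add: algebra_simps)
qed


lemma ip_self_eq_0:
  fixes f :: "'g \<Rightarrow> complex"
  assumes "continuous_on UNIV f" "Re (ip f f) \<le> 0"
  shows "f a = 0"
  using ip_self_pos[OF assms(1), of a] assms(2) by fastforce

text \<open>
  A maximiser of the strictly convex functional \<open>q \<mapsto> ip q q\<close> on the compact convex set of
  normalised functions below \<open>D q\<close> is an extreme point, and extreme points are characters.
\<close>

lemma truncation_character:
  fixes q :: "'g \<Rightarrow> complex"
  assumes q: "continuous_on UNIV q" "pos_def q" "0 < Re (q 0)" and D: "D > 0"
    and absorb: "\<And>r D'. \<lbrakk>pos_def r; pos_def (\<lambda>x. of_real D' * q x - r x); D' \<ge> 0; Re (r 0) = 1\<rbrakk>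
      \<Longrightarrow> pos_def (\<lambda>x. of_real D * q x - r x)"
  shows "\<exists>\<phi>\<in>character_group. pos_def (\<lambda>x. of_real D * q x - \<phi> x)"
proof -
  let ?Dq = "\<lambda>x. of_real D * q x"
  have cDq: "continuous_on UNIV ?Dq" by (intro continuous_intros q)
  define K where "K = dominated ?Dq \<inter> {r. r 0 = 1}"
  have "continuous_on UNIV (\<lambda>r::'g \<Rightarrow> complex. r 0)"
    by (rule continuous_on_product_coordinates)
  then have "closed {r::'g \<Rightarrow> complex. r 0 = 1}"
    by (intro closed_Collect_eq continuous_on_const)
  then have "compact K" unfolding K_def by (intro compact_Int_closed compact_dominated)
  moreover have "continuous_on K (\<lambda>r. Re (ip r r))"
    unfolding K_def using continuous_on_ip_self[OF cDq] by (rule continuous_on_subset) simp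
  \<comment> \<open>By \<open>absorb\<close>, lying below any multiple \<open>D' q\<close> already
    gives lying below \<open>D q\<close>, so perturbations of the maximiser require no control of
    constants.\<close>
  moreover have K_I: "r \<in> K" if "pos_def r" "pos_def (\<lambda>x. of_real D' * q x - r x)" "D' \<ge> 0" "r 0 = 1" for r D'
    using absorb[OF that(1,2,3)] that unfolding K_def by (auto intro: dominatedI)
  define m where "m = 1 / Re (q 0)"
  have m: "m > 0" using q(3) by (simp add: m_def)
  have "(\<lambda>x. of_real m * q x) \<in> K"
    using m q(3) pos_def_0 pos_def_zero(3)[OF q(2)] by (intro K_I[of _ m] pos_def_scale q) (auto simp: m_def)
  ultimately obtain r where r: "r \<in> K" "\<And>p. p \<in> K \<Longrightarrow> Re (ip p p) \<le> Re (ip r r)"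
    using continuous_attains_sup[of K "\<lambda>r. Re (ip r r)"] by blast
  have pr: "pos_def r" "pos_def (\<lambda>x. ?Dq x - r x)" and r0: "r 0 = 1"
    using r(1) by (auto simp: K_def dominated_def)
  have cr: "continuous_on UNIV r"
    by (rule continuous_on_dominated[OF cDq]) (use r(1) in \<open>simp add: K_def\<close>)
  \<comment> \<open>The left-hand side \<open>s\<close> is such that \<open>2 r + s\<close> and
    \<open>2 r - s\<close> are both positive definite; maximality of \<open>r\<close> forces
    \<open>s\<close> to be a multiple of \<open>r\<close>.\<close>
  have extreme: "z * r (x + t) + cnj z * r (x - t) = (z * r t + cnj z * r (- t)) * r x"
    if z: "z * cnj z = 1" for z t x
  proof -
    define s where "s x = z * r (x + t) + cnj z * r (x - t)" for x
    define \<sigma> where "\<sigma> = 2 * Re (z * r t)"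
    have s0: "s 0 = of_real \<sigma>"
      using complex_add_cnj[of "z * r t"] pos_def_minus[OF pr(1), of t] by (simp add: s_def \<sigma>_def)
    have "norm (z * r t) \<le> 1"
      using pos_def_norm_le[OF pr(1), of t] r0 by (simp add: norm_mult norm_eq_1_if_mult_cnj[OF z])
    then have "\<bar>\<sigma>\<bar> \<le> 2" using abs_Re_le_cmod[of "z * r t"] by (simp add: \<sigma>_def abs_mult)
    then have \<sigma>: "3 + \<sigma> > 0" "3 - \<sigma> > 0" by auto
    have plus: "pos_def (\<lambda>x. 2 * r x + s x)"
      using pos_def_two_point[OF pr(1), of z 1 t] z by (simp add: s_def add.assoc)
    have minus: "pos_def (\<lambda>x. 2 * r x - s x)"
      using pos_def_two_point[OF pr(1), of "- z" 1 t] z by (simp add: s_def algebra_simps)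
    \<comment> \<open>\<open>h 0 = 0\<close>, so moving from \<open>r\<close> in the direction
      \<open>h\<close> preserves the value \<open>1\<close> at \<open>0\<close>.\<close>
    define h where "h x = s x - of_real \<sigma> * r x" for x
    have ch: "continuous_on UNIV h"
      unfolding h_def s_def using continuous_on_shift[OF cr, of "- t"]
      by (intro continuous_intros cr continuous_on_shift[OF cr]) simp
    \<comment> \<open>For these \<open>e\<close> the function \<open>r + e h\<close> is
      \<open>|e| (3 r + s)\<close> and \<open>|e| (3 r - s)\<close>, respectively. Using
      \<open>3 r\<close> instead of \<open>2 r\<close> keeps both \<open>3 + \<sigma>\<close> and
      \<open>3 - \<sigma>\<close> positive.\<close>
    have in_K: "(\<lambda>x. r x + of_real e * h x) \<in> K" 
      if e: "e = 1 / (3 + \<sigma>) \<or> e = - 1 / (3 - \<sigma>)" for e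
    \<comment> \<open>\<open>5 |e| D q - |e| (3 r + s)\<close> is \<open>|e|\<close> times the sum
      of \<open>5 (D q - r)\<close> and \<open>2 r - s\<close>; likewise with the sign of
      \<open>s\<close> reversed.\<close>
    proof (rule K_I[of _ "5 * \<bar>e\<bar> * D"])
      have "0 \<le> \<bar>e\<bar>" by simp
      have pm: "pos_def (\<lambda>x. of_real \<bar>e\<bar> * ((2 * r x + s x) + r x))"
        "pos_def (\<lambda>x. of_real \<bar>e\<bar> * ((2 * r x - s x) + r x))"
        by (intro pos_def_add pos_def_scale plus minus pr abs_ge_zero)+
      have pm': "pos_def (\<lambda>x. of_real \<bar>e\<bar> * (of_real 5 * (?Dq x - r x) + (2 * r x - s x)))"
        "pos_def (\<lambda>x. of_real \<bar>e\<bar> * (of_real 5 * (?Dq x - r x) + (2 * r x + s x)))"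
        by (intro pos_def_add pos_def_scale plus minus pr abs_ge_zero; simp)+
      consider "e = 1 / (3 + \<sigma>)" | "e = - 1 / (3 - \<sigma>)" using e by blast
      then have "\<exists>g\<in>{\<lambda>x. s x, \<lambda>x. - s x}. (\<lambda>x. r x + of_real e * h x) = (\<lambda>x. of_real \<bar>e\<bar> * ((2 * r x + g x) + r x))"
      proof cases
        case 1
        then have "e * (3 + \<sigma>) = 1" "\<bar>e\<bar> = e" using \<sigma> by auto
        then have e1: "of_real e * (3 + of_real \<sigma>) = (1::complex)"
          by (metis of_real_1 of_real_add of_real_mult of_real_numeral)
        then have "(\<lambda>x. r x + of_real e * h x) = (\<lambda>x. of_real \<bar>e\<bar> * ((2 * r x + s x) + r x))"
          unfolding \<open>\<bar>e\<bar> = e\<close> h_def using e1 by (intro ext) algebra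
        then show ?thesis by (intro bexI[of _ "\<lambda>x. s x"]) auto
      next
        case 2
        then have "e * (3 - \<sigma>) = - 1" "\<bar>e\<bar> = - e" using \<sigma> by auto
        then have e1: "of_real e * (3 - of_real \<sigma>) = (- 1::complex)"
          by (metis of_real_1 of_real_diff of_real_minus of_real_mult of_real_numeral)
        then have "(\<lambda>x. r x + of_real e * h x) = (\<lambda>x. of_real \<bar>e\<bar> * ((2 * r x + - s x) + r x))"
          unfolding \<open>\<bar>e\<bar> = - e\<close> of_real_minus h_def using e1 by (intro ext) algebra
        then show ?thesis by (intro bexI[of _ "\<lambda>x. - s x"]) auto
      qed
      then obtain g where g: "g = (\<lambda>x. s x) \<or> g = (\<lambda>x. - s x)"
        "(\<lambda>x. r x + of_real e * h x) = (\<lambda>x. of_real \<bar>e\<bar> * ((2 * r x + g x) + r x))" by blast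
      show "pos_def (\<lambda>x. r x + of_real e * h x)"
        unfolding g(2) using g(1) pm by auto
      have "(\<lambda>x. of_real (5 * \<bar>e\<bar> * D) * q x - (r x + of_real e * h x)) =
          (\<lambda>x. of_real \<bar>e\<bar> * (of_real 5 * (?Dq x - r x) + (2 * r x - g x)))"
        using fun_cong[OF g(2)] by (simp add: fun_eq_iff algebra_simps)
      then show "pos_def (\<lambda>x. of_real (5 * \<bar>e\<bar> * D) * q x - (r x + of_real e * h x))"
        using g(1) pm' by auto
      show "r 0 + of_real e * h 0 = 1" by (simp add: h_def s0 r0)
    qed (use D in simp)
    \<comment> \<open>The two values of \<open>e\<close> have opposite signs, so combining the two
      inequalities eliminates the first-order term \<open>ip r h\<close>.\<close>
    have max: "2 * e * Re (ip r h) + e\<^sup>2 * Re (ip h h) \<le> 0" 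
      if "e = 1 / (3 + \<sigma>) \<or> e = - 1 / (3 - \<sigma>)" for e
      using r(2)[OF in_K[OF that]] unfolding Re_ip_add_scaled[OF cr ch] by simp
    have "2 * Re (ip r h) + 1 / (3 + \<sigma>) * Re (ip h h) \<le> 0"
    proof -
      have "1 / (3 + \<sigma>) * (2 * Re (ip r h) + 1 / (3 + \<sigma>) * Re (ip h h)) \<le> 0"
        using max[of "1 / (3 + \<sigma>)"] by (simp add: power2_eq_square algebra_simps)
      then show ?thesis using \<sigma> by (simp only: mult_le_0_iff) (auto simp: divide_le_0_iff)
    qed
    moreover have "- 2 * Re (ip r h) + 1 / (3 - \<sigma>) * Re (ip h h) \<le> 0"
    proof -
      have "1 / (3 - \<sigma>) * (- 2 * Re (ip r h) + 1 / (3 - \<sigma>) * Re (ip h h)) \<le> 0"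
        using max[of "- 1 / (3 - \<sigma>)"] by (simp add: power2_eq_square algebra_simps)
      then show ?thesis using \<sigma> by (simp only: mult_le_0_iff) (auto simp: divide_le_0_iff)
    qed
    ultimately have "(1 / (3 + \<sigma>) + 1 / (3 - \<sigma>)) * Re (ip h h) \<le> 0"
      by (simp add: distrib_right)
    moreover have "1 / (3 + \<sigma>) + 1 / (3 - \<sigma>) > 0" using \<sigma> by (simp add: add_pos_pos)
    ultimately have "Re (ip h h) \<le> 0" by (simp add: mult_le_0_iff)
    then have "h x = 0" by (rule ip_self_eq_0[OF ch])
    then have "s x = s 0 * r x" by (simp add: h_def s0)
    then show ?thesis by (simp add: s_def)
  qed
  have mult: "r (x + t) = r x * r t" for x t
  proof -
    \<comment> \<open>\<open>z = 1\<close> and \<open>z = \<i>\<close> give the sum and the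
      difference of \<open>r (x + t)\<close> and \<open>r (x - t)\<close>.\<close>
    have "r (x + t) + r (x - t) = (r t + r (- t)) * r x" using extreme[of 1 x t] by simp
    moreover have "\<i> * (r (x + t) - r (x - t)) = \<i> * ((r t - r (- t)) * r x)"
      using extreme[of \<i> x t] by (simp add: algebra_simps)
    then have "r (x + t) - r (x - t) = (r t - r (- t)) * r x" by simp
    ultimately have "2 * r (x + t) = 2 * (r x * r t)" by algebra
    then show ?thesis by simp
  qed
  have "norm (r x) = 1" for x
  proof -
    have "r x * cnj (r x) = 1" using mult[of x "- x"] pos_def_minus[OF pr(1), of x] r0 by simp
    then show ?thesis by (rule norm_eq_1_if_mult_cnj)
  qed
  then have "r \<in> character_group" using mult cr by (simp add: character_group_def)
  then show ?thesis using pr(2) by blast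
qed

text \<open>In Fourier terms, a nonzero \<open>k\<close> has a positive coefficient. The truncation
  \<open>q\<close> of \<open>k\<close> satisfies \<open>a r \<lless> q\<close> for every normalised
  \<open>r\<close> below some multiple of \<open>q\<close>, so \<open>1 / a\<close> serves as the
  common multiple.\<close>

theorem pos_def_dominates_character:
  fixes k :: "'g \<Rightarrow> complex"
  assumes k: "continuous_on UNIV k" "pos_def k" "0 < Re (k 0)"
  shows "\<exists>\<phi>\<in>character_group. \<exists>D\<ge>0. pos_def (\<lambda>x. of_real D * k x - \<phi> x)"
proof -
  obtain q c where q: "q \<in> dominated k" and c: "c > 0" "Re (q 0) > 0"
    and lower: "\<And>s. s \<in> dominated q \<Longrightarrow> c * Re (q 0) * Re (s 0) \<le> Re (ip q s)"
    using spectral_truncation[OF k] by blast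
  have cq: "continuous_on UNIV q" by (rule continuous_on_dominated[OF k(1) q])
  have pq: "pos_def q" "pos_def (\<lambda>x. k x - q x)" using q by (auto simp: dominated_def)
  define a where "a = c * Re (q 0)"
  have a: "a > 0" using c by (simp add: a_def)
  have "\<exists>\<phi>\<in>character_group. pos_def (\<lambda>x. of_real (1 / a) * q x - \<phi> x)"
  proof (rule truncation_character[OF cq pq(1) c(2)])
    show "1 / a > 0" using a by simp
    fix r D'
    assume r: "pos_def r" "pos_def (\<lambda>x. of_real D' * q x - r x)" "D' \<ge> 0" "Re (r 0) = 1"
    have "pos_def (\<lambda>x. q x - of_real a * r x)"
      by (rule truncation_dominates[OF cq pq(1) _ r]) (use lower in \<open>simp add: a_def\<close>)
    then have "pos_def (\<lambda>x. of_real (1 / a) * (q x - of_real a * r x))"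
      using a by (intro pos_def_scale) auto
    then show "pos_def (\<lambda>x. of_real (1 / a) * q x - r x)"
      using a by (simp add: right_diff_distrib)
  qed
  then obtain \<phi> where \<phi>: "\<phi> \<in> character_group" "pos_def (\<lambda>x. of_real (1 / a) * q x - \<phi> x)" by blast
  have "pos_def (\<lambda>x. of_real (1 / a) * (k x - q x) + (of_real (1 / a) * q x - \<phi> x))"
    using a by (intro pos_def_add pos_def_scale pq \<phi>) auto
  then have "pos_def (\<lambda>x. of_real (1 / a) * k x - \<phi> x)" by (simp add: right_diff_distrib)
  then show ?thesis using \<phi>(1) a by (intro bexI[of _ \<phi>] exI[of _ "1 / a"]) auto
qed

end

section \<open>Separation of points by characters\<close>

context compact_ab_group
begin

lemma continuous_on_correlation:
  fixes f g :: "'g \<Rightarrow> complex"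
  assumes "continuous_on UNIV f" "continuous_on UNIV g"
  shows "continuous_on UNIV (\<lambda>t. mean (\<lambda>x. f (x + t) * cnj (g x)))"
proof (rule continuous_on_uniformI)
  fix e :: real assume "e > 0"
  have "compact (range g)" by (rule compact_continuous_image[OF assms(2) compact_UNIV])
  then obtain B where B: "B > 0" "\<And>x. norm (g x) \<le> B"
    using bounded_pos[of "range g"] compact_imp_bounded by auto
  define d where "d = e / (2 * B)"
  have "d > 0" using \<open>e > 0\<close> B by (simp add: d_def)
  then obtain U where U: "open U" "0 \<in> U" "\<And>x y. x - y \<in> U \<Longrightarrow> dist (f x) (f y) < d"
    using uniform_continuity[OF assms(1)] by blast
  have "dist (mean (\<lambda>x. f (x + s) * cnj (g x))) (mean (\<lambda>x. f (x + t) * cnj (g x))) < e"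
    if "s - t \<in> U" for s t
  proof -
    have "norm (f (x + s) * cnj (g x) - f (x + t) * cnj (g x)) \<le> d * B" for x
    proof -
      have "norm (f (x + s) * cnj (g x) - f (x + t) * cnj (g x)) = norm (f (x + s) - f (x + t)) * norm (g x)"
        by (simp add: norm_mult flip: left_diff_distrib)
      also have "\<dots> \<le> d * B"
        using U(3)[of "x + s" "x + t"] that B \<open>d > 0\<close> by (intro mult_mono) (auto simp: dist_norm)
      finally show ?thesis .
    qed
    then have "norm (mean (\<lambda>x. f (x + s) * cnj (g x)) - mean (\<lambda>x. f (x + t) * cnj (g x))) \<le> d * B"
      by (intro mean_norm_diff_le continuous_intros continuous_on_shift assms)
    also have "\<dots> < e" using \<open>e > 0\<close> B by (simp add: d_def)
    finally show ?thesis by (simp add: dist_norm)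
  qed
  then show "\<exists>U. open U \<and> 0 \<in> U \<and> (\<forall>s t. s - t \<in> U \<longrightarrow>
      dist (mean (\<lambda>x. f (x + s) * cnj (g x))) (mean (\<lambda>x. f (x + t) * cnj (g x))) < e)"
    using U(1,2) by blast
qed

lemma pos_def_autocorrelation:
  fixes g :: "'g \<Rightarrow> complex"
  assumes "continuous_on UNIV g"
  shows "pos_def (\<lambda>t. mean (\<lambda>x. g (x + t) * cnj (g x)))"
proof (rule pdI)
  note cont = continuous_on_mult continuous_on_cnj continuous_on_const assms
    continuous_on_shift[OF assms] continuous_on_sum
  fix t
  have "cnj (mean (\<lambda>x. g (x + t) * cnj (g x))) = mean (\<lambda>x. cnj (g (x + t) * cnj (g x)))"
    by (rule mean_cnj[symmetric]) (intro cont)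
  also have "\<dots> = mean (\<lambda>x. cnj (g (x + - t + t) * cnj (g (x + - t))))"
    by (rule mean_translate[symmetric])
  finally show "mean (\<lambda>x. g (x + - t) * cnj (g x)) = cnj (mean (\<lambda>x. g (x + t) * cnj (g x)))"
    by (simp add: mult.commute)
next
  note cont = continuous_on_mult continuous_on_cnj continuous_on_const assms
    continuous_on_shift[OF assms] continuous_on_sum
  fix n c and t :: "nat \<Rightarrow> 'g"
  \<comment> \<open>The quadratic form is the mean of \<open>|w|^2\<close> for this combination of
    translates.\<close>
  define w where "w x = (\<Sum>i<n. c i * g (x + t i))" for x
  have shift: "mean (\<lambda>x. g (x + (s - u)) * cnj (g x)) = mean (\<lambda>x. g (x + s) * cnj (g (x + u)))" for s u
    using mean_translate[of "\<lambda>x. g (x + (s - u)) * cnj (g x)" u] by (simp add: add.assoc)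
  have "(\<Sum>i<n. \<Sum>j<n. c i * cnj (c j) * mean (\<lambda>x. g (x + (t i - t j)) * cnj (g x))) =
      mean (\<lambda>x. \<Sum>i<n. \<Sum>j<n. c i * cnj (c j) * (g (x + t i) * cnj (g (x + t j))))"
    unfolding shift by (simp only: mean_sum mean_cmult cont)
  also have "\<dots> = mean (\<lambda>x. w x * cnj (w x))"
    by (rule arg_cong[of _ _ mean])
      (simp add: fun_eq_iff w_def sum_product mult_ac)
  also have "0 \<le> Re \<dots>"
    using ip_self_nonneg[of w] unfolding ip_def w_def by (simp only: cont)
  finally show "0 \<le> Re (\<Sum>i<n. \<Sum>j<n. c i * cnj (c j) * mean (\<lambda>x. g (x + (t i - t j)) * cnj (g x)))" .
qed

theorem character_separates:
  fixes f :: "'g \<Rightarrow> complex"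
  assumes f: "continuous_on UNIV f" and a: "f 0 \<noteq> f a"
  shows "\<exists>\<phi>\<in>character_group. \<phi> a \<noteq> 1"
proof -
  \<comment> \<open>The autocorrelation of this difference has vanishing coefficients at all
    characters with period \<open>a\<close>, so a character found below a multiple of it must detect
    \<open>a\<close>.\<close>
  define g where "g x = f x - f (x + a)" for x
  have g: "continuous_on UNIV g"
    unfolding g_def by (intro continuous_on_diff f continuous_on_shift)
  define k where "k t = mean (\<lambda>x. g (x + t) * cnj (g x))" for t
  have k: "continuous_on UNIV k" "pos_def k"
    unfolding k_def by (rule continuous_on_correlation pos_def_autocorrelation; rule g)+
  have "0 < Re (ip g g)" by (rule ip_self_pos[OF g, of 0]) (use a in \<open>simp add: g_def\<close>)
  then have "0 < Re (k 0)" by (simp add: k_def ip_def)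
  then obtain \<phi> D where \<phi>: "\<phi> \<in> character_group" and D: "pos_def (\<lambda>x. of_real D * k x - \<phi> x)"
    using pos_def_dominates_character[OF k] by blast
  have "\<phi> a \<noteq> 1"
  proof
    assume "\<phi> a = 1"
    then have per: "\<phi> (t + a) = \<phi> t" for t using character_add[OF \<phi>] by simp
    \<comment> \<open>\<open>k t = H t - H (t + a)\<close>, so translation invariance kills the
      coefficient of \<open>k\<close> at a character with period \<open>a\<close>.\<close>
    define H where "H t = mean (\<lambda>x. f (x + t) * cnj (g x))" for t
    have H: "continuous_on UNIV H" unfolding H_def by (rule continuous_on_correlation[OF f g])
    note cont = continuous_on_mult continuous_on_cnj continuous_on_const continuous_on_diff
      continuous_on_shift[OF H] H character_continuous[OF \<phi>] k(1) continuous_on_shift[OF f] g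
    have "k t = mean (\<lambda>x. f (x + t) * cnj (g x) - f (x + (t + a)) * cnj (g x))" for t
      unfolding k_def by (rule arg_cong[of _ _ mean]) (simp add: fun_eq_iff g_def algebra_simps)
    then have kH: "k t = H t - H (t + a)" for t
      unfolding H_def by (simp only: mean_diff cont)
    have "mean (\<lambda>t. k t * cnj (\<phi> t)) = mean (\<lambda>t. H t * cnj (\<phi> t) - H (t + a) * cnj (\<phi> (t + a)))"
      unfolding kH per by (simp add: left_diff_distrib)
    also have "\<dots> = mean (\<lambda>t. H t * cnj (\<phi> t)) - mean (\<lambda>t. H (t + a) * cnj (\<phi> (t + a)))"
      by (rule mean_diff) (simp_all only: per cont)
    also have "\<dots> = 0" using mean_translate[of "\<lambda>t. H t * cnj (\<phi> t)" a] by simp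
    finally have k\<phi>: "mean (\<lambda>t. k t * cnj (\<phi> t)) = 0" .
    \<comment> \<open>The mean of \<open>w\<close> is the coefficient of the positive definite
      function \<open>D k - \<phi>\<close> at \<open>\<phi>\<close>, which would be
      \<open>-1\<close>.\<close>
    define w where "w x = (of_real D * k x - \<phi> x) * cnj (\<phi> x)" for x
    have "pos_def w" unfolding w_def
      by (rule pos_def_mult_hom[OF D]) (simp_all add: character_add[OF \<phi>] character_minus[OF \<phi>])
    moreover have w: "continuous_on UNIV w" unfolding w_def by (intro cont)
    ultimately have "0 \<le> Re (mean w)" by (intro pos_def_mean_nonneg[OF _ has_mean_mean])
    have "mean w = mean (\<lambda>x. of_real D * (k x * cnj (\<phi> x)) - 1)"
      unfolding w_def by (rule arg_cong[of _ _ mean])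
        (simp add: fun_eq_iff left_diff_distrib character_mult_cnj[OF \<phi>])
    also have "\<dots> = -1"
      by (simp only: mean_diff mean_cmult cont k\<phi> mean_const) simp
    finally show False using \<open>0 \<le> Re (mean w)\<close> by simp
  qed
  then show ?thesis using \<phi> by blast
qed

end

section \<open>Trigonometric polynomials\<close>

inductive_set trig_poly :: "('g::topological_ab_group_add \<Rightarrow> complex) set" where
  character: "\<phi> \<in> character_group \<Longrightarrow> (\<lambda>x. c * \<phi> x) \<in> trig_poly"
| add: "p \<in> trig_poly \<Longrightarrow> q \<in> trig_poly \<Longrightarrow> (\<lambda>x. p x + q x) \<in> trig_poly"

lemma character_group_one: "(\<lambda>x. 1) \<in> character_group"
  by (simp add: character_group_def)

lemma character_group_mult:
  "\<phi> \<in> character_group \<Longrightarrow> \<psi> \<in> character_group \<Longrightarrow> (\<lambda>x. \<phi> x * \<psi> x) \<in> character_group"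
  by (auto simp: character_group_def norm_mult mult_ac intro!: continuous_intros)

lemma character_group_cnj: "\<phi> \<in> character_group \<Longrightarrow> (\<lambda>x. cnj (\<phi> x)) \<in> character_group"
  by (auto simp: character_group_def intro!: continuous_intros)

lemma character_group_power: "\<phi> \<in> character_group \<Longrightarrow> (\<lambda>x. \<phi> x ^ n) \<in> character_group"
  by (induction n) (auto intro: character_group_one character_group_mult)

lemma trig_poly_const: "(\<lambda>x. c) \<in> trig_poly"
  using trig_poly.character[OF character_group_one, of c] by simp

lemma continuous_on_trig_poly: "p \<in> trig_poly \<Longrightarrow> continuous_on UNIV p"
  by (induction rule: trig_poly.induct)
    (auto intro!: continuous_on_mult continuous_on_add continuous_on_const intro: character_continuous)

lemma trig_poly_mult:
  assumes "p \<in> trig_poly" "q \<in> trig_poly"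
  shows "(\<lambda>x. p x * q x) \<in> trig_poly"
  using assms(1)
proof induction
  case (character \<phi> c)
  show ?case
    using assms(2)
  proof induction
    case (character \<psi> d)
    then show ?case
      using trig_poly.character[OF character_group_mult[OF \<open>\<phi> \<in> character_group\<close> character], of "c * d"]
      by (simp add: mult_ac)
  next
    case (add p q)
    then show ?case using trig_poly.add by (fastforce simp: distrib_left)
  qed
next
  case (add p q)
  then show ?case using trig_poly.add by (fastforce simp: distrib_right)
qed

lemma trig_poly_power: "p \<in> trig_poly \<Longrightarrow> (\<lambda>x. p x ^ n) \<in> trig_poly"
  by (induction n) (auto intro: trig_poly_const trig_poly_mult)

lemma trig_poly_sum: "(\<And>i. i \<in> I \<Longrightarrow> p i \<in> trig_poly) \<Longrightarrow> (\<lambda>x. \<Sum>i\<in>I. p i x) \<in> trig_poly"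
  by (induction I rule: infinite_finite_induct) (auto intro: trig_poly_const trig_poly.add)

text \<open>Unfolds to the same sum as in \<open>nbhd_fraction\<close>.\<close>

definition multiple :: "nat \<Rightarrow> 'g::ab_group_add \<Rightarrow> 'g" where
  "multiple k x = (\<Sum>i<k. x)"

lemma multiple_0 [simp]: "multiple 0 x = 0" and multiple_Suc: "multiple (Suc k) x = multiple k x + x"
  by (simp_all only: multiple_def lessThan_0 sum.empty sum.lessThan_Suc)

lemma multiple_zero [simp]: "multiple k 0 = 0"
  by (simp add: multiple_def)

lemma multiple_add: "multiple k (x + y) = multiple k x + multiple k y"
  by (simp only: multiple_def sum.distrib)

lemma continuous_on_multiple: "continuous_on UNIV (multiple k :: 'g::topological_ab_group_add \<Rightarrow> 'g)"
  unfolding multiple_def by (intro continuous_on_sum continuous_on_id)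

lemma character_multiple: "\<phi> \<in> character_group \<Longrightarrow> \<phi> (multiple k x) = \<phi> x ^ k"
  by (induction k) (simp_all add: multiple_Suc character_zero character_add mult.commute)

lemma (in compact_ab_group) mean_character:
  fixes \<phi> :: "'g \<Rightarrow> complex"
  assumes "\<phi> \<in> character_group" "\<phi> a \<noteq> 1"
  shows "mean \<phi> = 0"
proof -
  have "\<phi> a * mean \<phi> = mean (\<lambda>x. \<phi> a * \<phi> x)"
    by (rule mean_cmult[symmetric]) (rule character_continuous[OF assms(1)])
  also have "\<dots> = mean (\<lambda>x. \<phi> (x + a))" by (simp add: character_add[OF assms(1)] mult.commute)
  also have "\<dots> = mean \<phi>" by (rule mean_translate)
  finally show ?thesis using assms(2) by simp
qed

text \<open>The image is a connected set of \<open>n\<close>-th roots of unity, hence a single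
  point, and it contains \<open>\<phi> 0 = 1\<close>.\<close>

lemma connected_character_power:
  assumes "connected (UNIV :: 'g::topological_ab_group_add set)"
    and \<phi>: "\<phi> \<in> character_group" and n: "n > 0" and pow: "\<And>x::'g. \<phi> x ^ n = 1"
  shows "\<phi> x = 1"
proof -
  have "connected (range \<phi>)"
    by (rule connected_continuous_image[OF character_continuous[OF \<phi>] assms(1)])
  moreover have "finite (range \<phi>)"
    by (rule finite_subset[OF _ finite_roots_unity[of n]]) (use n pow in auto)
  ultimately obtain z where "range \<phi> = {z}"
    using connected_finite_iff_sing[of "range \<phi>"] by auto
  then have "\<phi> x = \<phi> 0" by (metis rangeI singletonD)
  then show ?thesis using character_zero[OF \<phi>] by simp
qed

section \<open>Decorrelation by large multiples on a connected group\<close>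

locale connected_compact_ab_group = compact_ab_group G
  for G :: "'a::topological_ab_group_add itself" +
  assumes connected_UNIV: "connected (UNIV :: 'a set)"
    and separating: "\<And>a::'a. a \<noteq> 0 \<Longrightarrow> \<exists>\<phi>\<in>character_group. \<phi> a \<noteq> 1"
begin

text \<open>For a character \<open>\<psi>\<close> the product \<open>\<psi> \<phi>^k\<close> is
  trivial for at most one \<open>k\<close>, since two such exponents would make a power of
  \<open>\<phi>\<close> trivial. Nontrivial characters have mean \<open>0\<close>.\<close>

lemma mean_trig_poly_character_power:
  assumes "p \<in> trig_poly" "\<phi> \<in> character_group" "\<phi> a \<noteq> (1::complex)"
  shows "\<exists>K. \<forall>k\<ge>K. mean (\<lambda>x::'a. p x * \<phi> x ^ k) = 0"
  using assms(1)
proof induction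
  case (character \<psi> c)
  have \<psi>k: "(\<lambda>x. \<psi> x * \<phi> x ^ k) \<in> character_group" for k
    by (intro character_group_mult character character_group_power assms)
  have unique: "k = m" if "k \<le> m" "\<And>x. \<psi> x * \<phi> x ^ k = 1" "\<And>x. \<psi> x * \<phi> x ^ m = 1" for k m
  proof (rule ccontr)
    assume "k \<noteq> m"
    have "\<phi> x ^ (m - k) = 1" for x
    proof -
      have "(\<psi> x * \<phi> x ^ k) * \<phi> x ^ (m - k) = \<psi> x * \<phi> x ^ m"
        using that(1) by (simp add: mult.assoc flip: power_add)
      then show ?thesis using that(2,3)[of x] by simp
    qed
    then have "\<phi> a = 1"
      using connected_character_power[OF connected_UNIV assms(2), of "m - k"] that(1) \<open>k \<noteq> m\<close> by auto
    then show False using assms(3) by simp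
  qed
  have "\<exists>K. \<forall>k\<ge>K. \<exists>x. \<psi> x * \<phi> x ^ k \<noteq> 1"
  proof (cases "\<exists>k. \<forall>x. \<psi> x * \<phi> x ^ k = 1")
    case True
    then obtain m where m: "\<And>x. \<psi> x * \<phi> x ^ m = 1" by blast
    have "\<exists>x. \<psi> x * \<phi> x ^ k \<noteq> 1" if "k \<ge> Suc m" for k
    proof (rule ccontr)
      assume "\<nexists>x. \<psi> x * \<phi> x ^ k \<noteq> 1"
      then have "m = k" using unique[of m k] m that by auto
      then show False using that by simp
    qed
    then show ?thesis by blast
  qed blast
  then obtain K where K: "\<And>k. k \<ge> K \<Longrightarrow> \<exists>x. \<psi> x * \<phi> x ^ k \<noteq> 1" by blast
  have "mean (\<lambda>x. c * \<psi> x * \<phi> x ^ k) = 0" if k: "k \<ge> K" for k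
  proof -
    obtain x where "\<psi> x * \<phi> x ^ k \<noteq> 1" using K[OF k] by blast
    then have "mean (\<lambda>x. \<psi> x * \<phi> x ^ k) = 0" by (rule mean_character[OF \<psi>k])
    then show ?thesis
      using mean_cmult[OF character_continuous[OF \<psi>k[of k]], of c] by (simp add: mult.assoc)
  qed
  then show ?case by blast
next
  case (add p q)
  then obtain K L where "\<And>k. k \<ge> K \<Longrightarrow> mean (\<lambda>x. p x * \<phi> x ^ k) = 0"
    "\<And>k. k \<ge> L \<Longrightarrow> mean (\<lambda>x. q x * \<phi> x ^ k) = 0" by blast
  moreover have "mean (\<lambda>x. (p x + q x) * \<phi> x ^ k) =
      mean (\<lambda>x. p x * \<phi> x ^ k) + mean (\<lambda>x. q x * \<phi> x ^ k)" for k
    unfolding distrib_right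
    by (intro mean_add continuous_intros continuous_on_trig_poly add character_continuous assms)
  ultimately have "mean (\<lambda>x. (p x + q x) * \<phi> x ^ k) = 0" if "k \<ge> max K L" for k
    using that by simp
  then show ?case by blast
qed

text \<open>For a character \<open>\<phi>\<close> in place of \<open>q\<close> the shift by
  \<open>y\<close> is only a constant factor, so that \<open>K\<close> can be chosen independently
  of \<open>y\<close>.\<close>

lemma mean_trig_poly_multiple:
  fixes p q :: "'a \<Rightarrow> complex"
  assumes "p \<in> trig_poly" "q \<in> trig_poly"
  shows "\<exists>K. \<forall>k\<ge>K. \<forall>y. mean (\<lambda>x. p x * q (multiple k x - y)) = mean p * mean q"
  using assms(2)
proof induction
  case (character \<phi> c)
  note cont = continuous_on_trig_poly[OF assms(1)] character_continuous[OF character]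
  have eq: "mean (\<lambda>x. p x * (c * \<phi> (multiple k x - y))) = c * cnj (\<phi> y) * mean (\<lambda>x. p x * \<phi> x ^ k)" for k y
  proof -
    have "mean (\<lambda>x. p x * (c * \<phi> (multiple k x - y))) = mean (\<lambda>x. c * cnj (\<phi> y) * (p x * \<phi> x ^ k))"
      by (rule arg_cong[of _ _ mean])
        (simp add: fun_eq_iff character_diff[OF character] character_multiple[OF character] mult_ac)
    then show ?thesis by (simp only: mean_cmult continuous_on_mult continuous_on_power cont)
  qed
  have c\<phi>: "mean (\<lambda>x. c * \<phi> x) = c * mean \<phi>" by (rule mean_cmult[OF cont(2)])
  show ?case
  proof (cases "\<forall>x. \<phi> x = 1")
    case True
    then have "\<phi> = (\<lambda>x. 1)" by auto
    then show ?thesis unfolding eq c\<phi> by simp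
  next
    case False
    then obtain a where "\<phi> a \<noteq> 1" by blast
    then show ?thesis unfolding eq c\<phi>
      using mean_trig_poly_character_power[OF assms(1) character, of a] mean_character[OF character, of a] by auto
  qed
next
  case (add q r)
  then obtain K L where "\<And>k y. k \<ge> K \<Longrightarrow> mean (\<lambda>x. p x * q (multiple k x - y)) = mean p * mean q"
    "\<And>k y. k \<ge> L \<Longrightarrow> mean (\<lambda>x. p x * r (multiple k x - y)) = mean p * mean r" by blast
  moreover have c: "continuous_on UNIV (\<lambda>x. w (multiple k x - y))" if "w \<in> trig_poly" for w k y
    by (rule continuous_on_compose2[OF continuous_on_trig_poly[OF that]])
      (auto intro!: continuous_intros continuous_on_multiple)
  have "mean (\<lambda>x. p x * (q (multiple k x - y) + r (multiple k x - y))) =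
      mean (\<lambda>x. p x * q (multiple k x - y)) + mean (\<lambda>x. p x * r (multiple k x - y))" for k y
    unfolding distrib_left
    by (intro mean_add continuous_on_mult c continuous_on_trig_poly add assms)
  moreover have "mean (\<lambda>x. q x + r x) = mean q + mean r"
    by (intro mean_add continuous_on_trig_poly add)
  ultimately have "mean (\<lambda>x. p x * (q (multiple k x - y) + r (multiple k x - y))) = mean p * mean (\<lambda>x. q x + r x)"
    if "k \<ge> max K L" for k y
    using that by (simp add: distrib_left)
  then show ?case by blast
qed

section \<open>Trigonometric polynomials concentrated near zero\<close>

lemma peaking_trig_poly:
  assumes W: "open W" "(0::'a) \<in> W"
  shows "\<exists>q\<in>trig_poly. \<exists>\<eta>. (\<forall>x. Im (q x) = 0 \<and> 0 \<le> Re (q x) \<and> Re (q x) \<le> 1) \<and>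
    q 0 = 1 \<and> 0 \<le> \<eta> \<and> \<eta> < 1 \<and> (\<forall>x. x \<notin> W \<longrightarrow> Re (q x) \<le> \<eta>)"
proof -
  have "compact (UNIV \<inter> - W)" using compact_UNIV W by (intro compact_Int_closed) auto
  then have comp: "compact (- W)" by simp
  define R where "R \<phi> = {x::'a. Re (\<phi> x) < 1}" for \<phi>
  have "- W \<subseteq> (\<Union>\<phi>\<in>character_group. R \<phi>)"
  proof
    fix x assume "x \<in> - W"
    then have "x \<noteq> 0" using W by auto
    then obtain \<phi> where \<phi>: "\<phi> \<in> character_group" "\<phi> x \<noteq> 1" using separating by blast
    have "Re (\<phi> x) \<noteq> 1"
    proof
      assume "Re (\<phi> x) = 1"
      then show False using character_norm[OF \<phi>(1), of x] \<phi>(2)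
        by (auto simp: cmod_def complex_eq_iff)
    qed
    then have "Re (\<phi> x) < 1"
      using complex_Re_le_cmod[of "\<phi> x"] character_norm[OF \<phi>(1), of x] by simp
    then show "x \<in> (\<Union>\<phi>\<in>character_group. R \<phi>)" using \<phi>(1) by (auto simp: R_def)
  qed
  moreover have "open (R \<phi>)" if "\<phi> \<in> character_group" for \<phi>
    unfolding R_def by (intro open_Collect_less continuous_intros character_continuous that)
  ultimately obtain F where F: "F \<subseteq> character_group" "finite F" "- W \<subseteq> (\<Union>\<phi>\<in>F. R \<phi>)"
    using compactE_image[OF comp, of character_group R] by metis
  \<comment> \<open>The trivial character ensures that the average below is over a nonempty
    set.\<close>
  define H where "H = insert (\<lambda>x. 1) F"
  have H: "H \<subseteq> character_group" "finite H" "H \<noteq> {}" "- W \<subseteq> (\<Union>\<phi>\<in>H. R \<phi>)"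
    using F character_group_one by (auto simp: H_def)
  then have cH: "card H > 0" by (simp add: card_gt_0_iff)
  \<comment> \<open>The average of \<open>(1 + Re \<phi>) / 2\<close> over \<open>H\<close>, written
    as a trigonometric polynomial. Outside \<open>W\<close> some summand drops below its
    maximum.\<close>
  define q where "q x = (\<Sum>\<phi>\<in>H. of_real (1 / (4 * card H)) * (2 + \<phi> x + cnj (\<phi> x)))" for x
  have q_poly: "q \<in> trig_poly"
    unfolding q_def
  proof (intro trig_poly_sum trig_poly_mult trig_poly_const trig_poly.add)
    fix \<phi> assume "\<phi> \<in> H"
    then have "\<phi> \<in> character_group" using H by auto
    from trig_poly.character[OF this, of 1] trig_poly.character[OF character_group_cnj[OF this], of 1]
    show "(\<lambda>x. \<phi> x) \<in> trig_poly" "(\<lambda>x. cnj (\<phi> x)) \<in> trig_poly" by simp_all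
  qed
  have q_eq: "q x = of_real (\<Sum>\<phi>\<in>H. (1 + Re (\<phi> x)) / (2 * card H))" for x
  proof -
    have "q x = (\<Sum>\<phi>\<in>H. of_real ((1 + Re (\<phi> x)) / (2 * card H)))"
      unfolding q_def by (rule sum.cong[OF refl]) (use cH in \<open>simp add: complex_eq_iff field_simps\<close>)
    then show ?thesis by simp
  qed
  have Re_b: "-1 \<le> Re (\<phi> x)" "Re (\<phi> x) \<le> 1" if "\<phi> \<in> H" for \<phi> x
    using abs_Re_le_cmod[of "\<phi> x"] character_norm[of \<phi> x] that H(1) by (auto simp: abs_le_iff)
  have q_nonneg: "0 \<le> Re (q x)" for x
  proof -
    have "0 \<le> 1 + Re (\<phi> x)" if "\<phi> \<in> H" for \<phi> using Re_b(1)[OF that, of x] by simp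
    then show ?thesis
      unfolding q_eq Re_complex_of_real by (intro sum_nonneg divide_nonneg_nonneg) auto
  qed
  have q_le: "Re (q x) \<le> 1" for x
  proof -
    have "Re (q x) \<le> (\<Sum>\<phi>\<in>H. 1 / card H)"
      unfolding q_eq Re_complex_of_real
      using Re_b cH by (intro sum_mono) (auto simp: field_simps)
    then show ?thesis using cH by simp
  qed
  have q_less: "Re (q x) < 1" if "x \<in> - W" for x
  proof -
    obtain \<psi> where \<psi>: "\<psi> \<in> H" "Re (\<psi> x) < 1" using H(4) \<open>x \<in> - W\<close> by (auto simp: R_def)
    have "Re (q x) < (\<Sum>\<phi>\<in>H. 1 / card H)"
      unfolding q_eq Re_complex_of_real
    proof (rule sum_strict_mono_ex1[OF H(2)])
      show "\<forall>\<phi>\<in>H. (1 + Re (\<phi> x)) / (2 * card H) \<le> 1 / card H"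
        using Re_b cH by (auto simp: field_simps)
      show "\<exists>\<phi>\<in>H. (1 + Re (\<phi> x)) / (2 * card H) < 1 / card H"
        using \<psi> cH by (intro bexI[of _ \<psi>]) (auto simp: field_simps)
    qed
    then show ?thesis using cH by simp
  qed
  have q0: "q 0 = 1"
  proof -
    have H0: "\<phi> 0 = 1" if "\<phi> \<in> H" for \<phi> using that H(1) character_zero by blast
    have "q 0 = (\<Sum>\<phi>\<in>H. of_real (1 / card H))"
      unfolding q_def
    proof (rule sum.cong[OF refl])
      fix \<phi> assume "\<phi> \<in> H"
      then show "of_real (1 / (4 * card H)) * (2 + \<phi> 0 + cnj (\<phi> 0)) = of_real (1 / card H)"
        using cH by (simp add: H0[of \<phi>])
    qed
    then show ?thesis using cH by simp
  qed
  have "\<exists>\<eta>. 0 \<le> \<eta> \<and> \<eta> < 1 \<and> (\<forall>x. x \<notin> W \<longrightarrow> Re (q x) \<le> \<eta>)"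
  proof (cases "- W = {}")
    case True
    then show ?thesis by (intro exI[of _ 0]) auto
  next
    case False
    have "continuous_on (- W) (\<lambda>x. Re (q x))"
      using continuous_on_subset[OF continuous_on_trig_poly[OF q_poly]] by (intro continuous_intros) auto
    from continuous_attains_sup[OF comp False this]
    obtain z where "z \<in> - W" "\<And>x. x \<in> - W \<Longrightarrow> Re (q x) \<le> Re (q z)" by blast
    then show ?thesis using q_less q_nonneg by (intro exI[of _ "Re (q z)"]) auto
  qed
  then show ?thesis using q_poly q_nonneg q_le q0 q_eq by (intro bexI[of _ q]) auto
qed

text \<open>A high power of a peaking polynomial: outside \<open>W\<close> it is at most
  \<open>\<eta>^n\<close>, whereas its mean is at least a positive constant times
  \<open>\<theta>^n\<close> for some larger \<open>\<theta>\<close>.\<close>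

lemma concentrated_trig_poly:
  assumes W: "open W" "(0::'a) \<in> W"
  shows "\<exists>p\<in>trig_poly. \<exists>\<eta>. (\<forall>x. Im (p x) = 0 \<and> 0 \<le> Re (p x)) \<and>
    0 \<le> \<eta> \<and> 2 * \<eta> < Re (mean p) \<and> (\<forall>x. x \<notin> W \<longrightarrow> Re (p x) \<le> \<eta>)"
proof -
  obtain q \<eta> where q: "q \<in> trig_poly" "\<And>x. Im (q x) = 0 \<and> 0 \<le> Re (q x) \<and> Re (q x) \<le> 1" "q 0 = 1"
    and \<eta>: "0 \<le> \<eta>" "\<eta> < 1" "\<And>x. x \<notin> W \<Longrightarrow> Re (q x) \<le> \<eta>"
    using peaking_trig_poly[OF W] by blast
  have q_real: "q x = of_real (Re (q x))" for x using q(2) by (simp add: complex_eq_iff)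
  have cq: "continuous_on UNIV q" by (rule continuous_on_trig_poly[OF q(1)])
  define \<theta> where "\<theta> = (1 + \<eta>) / 2"
  have \<theta>: "\<eta> < \<theta>" "\<theta> < 1" "0 < \<theta>" using \<eta> by (auto simp: \<theta>_def)
  \<comment> \<open>Nonzero only where \<open>q > \<theta>\<close>, and at most \<open>1\<close>;
    hence \<open>\<theta>^n g \<le> q^n\<close>.\<close>
  define g where "g x = complex_of_real (max 0 (Re (q x) - \<theta>))" for x
  have cg: "continuous_on UNIV g" unfolding g_def by (intro continuous_intros cq)
  have "0 < Re (mean g)"
    by (rule mean_pos[OF cg, of 0]) (use q(3) \<theta> in \<open>auto simp: g_def\<close>)
  moreover have "(\<lambda>n. 2 * (\<eta> / \<theta>) ^ n) \<longlonglongrightarrow> 2 * 0"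
    using \<eta> \<theta> by (intro tendsto_mult tendsto_const LIMSEQ_power_zero) (simp add: field_simps)
  ultimately have "\<forall>\<^sub>F n in sequentially. 2 * (\<eta> / \<theta>) ^ n < Re (mean g)"
    using order_tendstoD(2) by fastforce
  then obtain n where n: "2 * (\<eta> / \<theta>) ^ n < Re (mean g)"
    by (auto simp: eventually_sequentially)
  define p where "p x = q x ^ n" for x
  have p: "p \<in> trig_poly" unfolding p_def by (rule trig_poly_power[OF q(1)])
  have p_real: "p x = of_real (Re (q x) ^ n)" for x
    unfolding p_def by (subst q_real) simp
  have "Re (\<theta> ^ n * g x) \<le> Re (p x)" for x
  proof (cases "Re (q x) \<le> \<theta>")
    case True
    then show ?thesis using q(2) by (simp add: p_real g_def)
  next
    case False
    have "\<theta> ^ n * (Re (q x) - \<theta>) \<le> \<theta> ^ n * 1"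
      using \<theta> q(2)[of x] by (intro mult_left_mono) auto
    also have "\<dots> \<le> Re (q x) ^ n" using False \<theta> by (simp add: power_mono)
    finally show ?thesis using False by (simp add: p_real g_def)
  qed
  then have "Re (mean (\<lambda>x. of_real (\<theta> ^ n) * g x)) \<le> Re (mean p)"
    by (intro mean_mono continuous_intros cg continuous_on_trig_poly p) simp
  then have "\<theta> ^ n * Re (mean g) \<le> Re (mean p)" by (simp add: mean_cmult[OF cg] del: of_real_power)
  moreover have "2 * \<eta> ^ n < \<theta> ^ n * Re (mean g)"
    using n \<theta> by (simp add: power_divide field_simps)
  moreover have "Re (p x) \<le> \<eta> ^ n" if "x \<notin> W" for x
    using q(2)[of x] \<eta>(3)[OF that] by (simp add: p_real power_mono)
  ultimately show ?thesis
    using p q(2) \<eta>(1) by (intro bexI[of _ p] exI[of _ "\<eta> ^ n"]) (auto simp: p_real)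
qed

text \<open>If this fails for \<open>k\<close> and \<open>y\<close>, then at each \<open>x\<close>
  one of \<open>p x\<close> and \<open>p (k x - y)\<close> is at most \<open>\<eta>\<close>, so
  their product is at most \<open>\<eta>\<close> times their sum. Taking means gives
  \<open>m^2 \<le> 2 \<eta> m\<close> for the mean \<open>m\<close> of \<open>p\<close>, contrary to
  \<open>2 \<eta> < m\<close>.\<close>

theorem multiples_of_nbhd_dense:
  assumes W: "open W" "(0::'a) \<in> W"
  shows "\<exists>K. \<forall>k\<ge>K. \<forall>y. \<exists>x\<in>W. multiple k x - y \<in> W"
proof -
  obtain p \<eta> where p: "p \<in> trig_poly" and p_real: "\<And>x. Im (p x) = 0 \<and> 0 \<le> Re (p x)"
    and \<eta>: "0 \<le> \<eta>" "2 * \<eta> < Re (mean p)" "\<And>x. x \<notin> W \<Longrightarrow> Re (p x) \<le> \<eta>"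
    using concentrated_trig_poly[OF W] by blast
  obtain K where K: "\<And>k y. k \<ge> K \<Longrightarrow> mean (\<lambda>x. p x * p (multiple k x - y)) = mean p * mean p"
    using mean_trig_poly_multiple[OF p p] by blast
  \<comment> \<open>Decorrelation with the constant \<open>1\<close>: for large \<open>k\<close>
    composing \<open>p\<close> with \<open>x \<mapsto> k x - y\<close> preserves its mean.\<close>
  obtain L where L: "\<And>k y. k \<ge> L \<Longrightarrow> mean (\<lambda>x. 1 * p (multiple k x - y)) = mean (\<lambda>x::'a. 1) * mean p"
    using mean_trig_poly_multiple[OF trig_poly_const p, of 1] by blast
  have cp: "continuous_on UNIV p" by (rule continuous_on_trig_poly[OF p])
  have cpk: "continuous_on UNIV (\<lambda>x. p (multiple k x - y))" for k y
    by (rule continuous_on_compose2[OF cp]) (auto intro!: continuous_intros continuous_on_multiple)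
  have "has_mean (\<lambda>x. Im (p x)) (Im (mean p))"
    by (rule has_mean_linear[OF has_mean_mean[OF cp] bounded_linear_Im])
  moreover have "(\<lambda>x. Im (p x)) = (\<lambda>x. 0)" using p_real by auto
  ultimately have Im: "Im (mean p) = 0" using has_mean_unique[OF _ has_mean_const] by metis
  have "\<exists>x\<in>W. multiple k x - y \<in> W" if k: "k \<ge> max K L" for k y
  proof (rule ccontr)
    assume contra: "\<not> (\<exists>x\<in>W. multiple k x - y \<in> W)"
    have "Re (p x * p (multiple k x - y)) \<le> Re (of_real \<eta> * (p x + p (multiple k x - y)))" for x
    proof -
      have "Re (p x) \<le> \<eta> \<or> Re (p (multiple k x - y)) \<le> \<eta>" using contra \<eta>(3) by blast
      then have "Re (p x) * Re (p (multiple k x - y)) \<le> \<eta> * Re (p x) + \<eta> * Re (p (multiple k x - y))"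
      proof
        assume "Re (p x) \<le> \<eta>"
        then have "Re (p x) * Re (p (multiple k x - y)) \<le> \<eta> * Re (p (multiple k x - y))"
          using p_real by (intro mult_right_mono) auto
        then show ?thesis using p_real[of x] \<eta>(1) by (simp add: add_increasing)
      next
        assume "Re (p (multiple k x - y)) \<le> \<eta>"
        then have "Re (p x) * Re (p (multiple k x - y)) \<le> Re (p x) * \<eta>"
          using p_real by (intro mult_left_mono) auto
        then show ?thesis using p_real[of "multiple k x - y"] \<eta>(1) by (simp add: add_increasing2 mult.commute)
      qed
      then show ?thesis using p_real by (simp add: distrib_left)
    qed
    then have "Re (mean (\<lambda>x. p x * p (multiple k x - y))) \<le>
        Re (mean (\<lambda>x. of_real \<eta> * (p x + p (multiple k x - y))))"
      by (intro mean_mono continuous_intros cp cpk)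
    also have "mean (\<lambda>x. of_real \<eta> * (p x + p (multiple k x - y))) = of_real \<eta> * (mean p + mean (\<lambda>x. p (multiple k x - y)))"
      by (simp only: mean_cmult mean_add continuous_on_add cp cpk)
    finally have "Re (mean p) * Re (mean p) \<le> 2 * \<eta> * Re (mean p)"
      using K[of k y] L[of k y] k Im by simp
    moreover have "2 * \<eta> * Re (mean p) < Re (mean p) * Re (mean p)"
      using \<eta> by (intro mult_strict_right_mono) auto
    ultimately show False by simp
  qed
  then show ?thesis by blast
qed

end

section \<open>The group of null sequences\<close>

lemma seq_of_F0_of: "f \<longlonglongrightarrow> 0 \<Longrightarrow> seq_of (F0_of f) = f"
  by (rule F0_of_inverse) (simp add: null_sequences_def)

lemma seq_of_F0_of_finite: "finite {n. f n \<noteq> 0} \<Longrightarrow> seq_of (F0_of f) = f"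
proof (rule seq_of_F0_of)
  assume "finite {n. f n \<noteq> 0}"
  then have "\<forall>\<^sub>F n in sequentially. f n = 0"
    by (simp add: cofinite_eq_sequentially[symmetric] eventually_cofinite)
  then show "f \<longlonglongrightarrow> 0" by (simp add: tendsto_eventually)
qed

lemma F0_eqI: "(\<And>n. seq_of x n = seq_of y n) \<Longrightarrow> x = y"
  by (metis ext seq_of_inject)

lemma seq_of_multiple: "seq_of (multiple k x) n = multiple k (seq_of x n)"
  by (induction k) (simp_all add: multiple_Suc seq_of_zero seq_of_plus)

definition single :: "nat \<Rightarrow> 'a \<Rightarrow> 'a::topological_ab_group_add F0" where
  "single n v = F0_of (\<lambda>i. if i = n then v else 0)"

lemma seq_of_single: "seq_of (single n v) i = (if i = n then v else 0)"
  unfolding single_def by (subst seq_of_F0_of_finite) auto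

lemma single_diff: "single n (v - w) = single n v - single n w"
  by (rule F0_eqI) (simp add: seq_of_single seq_of_minus)

lemma single_0: "single n 0 = 0"
  by (rule F0_eqI) (simp add: seq_of_single seq_of_zero)

lemma continuous_on_seq_of: "continuous_on UNIV (\<lambda>x. seq_of x n :: 'a::topological_ab_group_add)"
  unfolding continuous_on_topological
proof (intro ballI allI impI)
  fix x :: "'a F0" and B :: "'a set"
  assume B: "open B" "seq_of x n \<in> B"
  let ?V = "(\<lambda>v. v + seq_of x n) -` B"
  have "open ?V" "0 \<in> ?V" using B by (auto intro!: open_vimage continuous_intros)
  then have "\<forall>\<^sub>F y in nhds x. seq_of y n \<in> B"
    unfolding eventually_nhds_F0 by (intro exI[of _ ?V]) (auto simp: seq_of_minus dest: spec[of _ n])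
  then show "\<exists>A. open A \<and> x \<in> A \<and> (\<forall>y\<in>UNIV. y \<in> A \<longrightarrow> seq_of y n \<in> B)"
    unfolding eventually_nhds by blast
qed

lemma continuous_on_single: "continuous_on UNIV (single n :: 'a \<Rightarrow> 'a::topological_ab_group_add F0)"
  unfolding continuous_on_topological
proof (intro ballI allI impI)
  fix v :: 'a and B :: "'a F0 set"
  assume "open B" "single n v \<in> B"
  then have "\<forall>\<^sub>F y in nhds (single n v). y \<in> B" by (rule eventually_nhds_in_open)
  then obtain V where V: "open V" "0 \<in> V" "\<And>y. \<forall>i. seq_of (y - single n v) i \<in> V \<Longrightarrow> y \<in> B"
    unfolding eventually_nhds_F0 by blast
  have "open ((\<lambda>w. w - v) -` V)" by (intro open_vimage V continuous_intros)
  moreover have "v \<in> (\<lambda>w. w - v) -` V" using V by simp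
  moreover have "single n w \<in> B" if "w - v \<in> V" for w
    by (rule V(3)) (use that V(2) in \<open>simp add: seq_of_single flip: single_diff\<close>)
  ultimately show "\<exists>A. open A \<and> v \<in> A \<and> (\<forall>w\<in>UNIV. w \<in> A \<longrightarrow> single n w \<in> B)"
    by (intro exI[of _ "(\<lambda>w. w - v) -` V"]) auto
qed

lemma character_group_seq_of:
  assumes "\<phi> \<in> character_group"
  shows "(\<lambda>x. \<phi> (seq_of x n)) \<in> character_group"
  using assms continuous_on_compose2[OF character_continuous[OF assms] continuous_on_seq_of[of n]]
  by (simp add: character_group_def seq_of_plus)

text \<open>The subgroup generated by \<open>V\<close> is open, since it contains the translate of
  \<open>V\<close> to each of its points, and so is its complement, a union of cosets.\<close>

lemma connected_group_closure:
  fixes V :: "'a::topological_ab_group_add set"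
  assumes "connected (UNIV :: 'a set)" "open V" "0 \<in> V"
  shows "group_closure V = UNIV"
proof -
  have trans: "open ((\<lambda>y. y - a) -` V)" for a
    by (intro open_vimage assms continuous_intros)
  have mem: "v \<in> group_closure V" if "v \<in> V" for v
    using that by (auto intro: group_closure.base)
  have "open (group_closure V)"
  proof (subst open_subopen, rule ballI)
    fix a assume a: "a \<in> group_closure V"
    have "(\<lambda>y. y - a) -` V \<subseteq> group_closure V"
      using group_closure_add[OF mem a] by fastforce
    then show "\<exists>T. open T \<and> a \<in> T \<and> T \<subseteq> group_closure V"
      using trans[of a] assms(3) by (intro exI[of _ "(\<lambda>y. y - a) -` V"]) auto
  qed
  moreover have "open (- group_closure V)"
  proof (subst open_subopen, rule ballI)
    fix b assume b: "b \<in> - group_closure V"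
    have "(\<lambda>y. y - b) -` V \<subseteq> - group_closure V"
    proof
      fix y assume y: "y \<in> (\<lambda>y. y - b) -` V"
      show "y \<in> - group_closure V"
      proof
        assume "y \<in> group_closure V"
        from group_closure.diff[OF this mem[of "y - b"]] show False using y b by simp
      qed
    qed
    then show "\<exists>T. open T \<and> b \<in> T \<and> T \<subseteq> - group_closure V"
      using trans[of b] assms(3) by (intro exI[of _ "(\<lambda>y. y - b) -` V"]) auto
  qed
  moreover have "0 \<in> group_closure V" by simp
  ultimately show ?thesis
    using connectedD[OF assms(1), of "group_closure V" "- group_closure V"] by blast
qed

section \<open>Failure of the Schwartz condition\<close>

lemma unit_powers_near_one:
  fixes z :: complex
  assumes "norm z = 1" "\<And>k. 1 / 2 \<le> Re (z ^ k)"
  shows "z = 1"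
proof (rule ccontr)
  assume z: "z \<noteq> 1"
  \<comment> \<open>For \<open>z \<noteq> 1\<close> the geometric sums stay bounded by
    \<open>2 / norm (z - 1)\<close>, while their real parts grow linearly in
    \<open>N\<close>.\<close>
  have "real N / 2 \<le> 2 / norm (z - 1)" for N
  proof -
    have "real N / 2 = (\<Sum>k<N. 1 / 2)" by simp
    also have "\<dots> \<le> (\<Sum>k<N. Re (z ^ k))" by (intro sum_mono assms)
    also have "\<dots> = Re (\<Sum>k<N. z ^ k)" by simp
    also have "\<dots> \<le> norm (\<Sum>k<N. z ^ k)" by (rule complex_Re_le_cmod)
    also have "\<dots> = norm (z ^ N - 1) / norm (z - 1)" using z by (simp add: geometric_sum norm_divide)
    also have "\<dots> \<le> 2 / norm (z - 1)"
      using norm_triangle_ineq4[of "z ^ N" 1] assms(1) by (intro divide_right_mono) (auto simp: norm_power)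
    finally show ?thesis .
  qed
  then show False using reals_Archimedean2[of "2 * (2 / norm (z - 1))"] by (smt (verit) field_sum_of_halves)
qed

lemma not_schwartz_F0:
  fixes x :: "'a::topological_ab_group_add"
  assumes conn: "connected (UNIV :: 'a set)" and \<phi>: "\<phi> \<in> character_group" "\<phi> x \<noteq> 1"
  shows "\<not> schwartz_group TYPE('a F0)"
proof
  assume S: "schwartz_group TYPE('a F0)"
  \<comment> \<open>The margin between \<open>3/4\<close> and \<open>1/2\<close> absorbs the
    contribution of the finite sets \<open>F n\<close>.\<close>
  define V where "V = {v. 3 / 4 < Re (\<phi> v)}"
  have V: "open V" "0 \<in> V"
    unfolding V_def using character_zero[OF \<phi>(1)]
    by (auto intro!: open_Collect_less continuous_intros character_continuous[OF \<phi>(1)])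
  define U where "U = {y. \<forall>n. seq_of y n \<in> V}"
  have "\<forall>\<^sub>F y in nhds 0. y \<in> U"
    unfolding eventually_nhds_F0 U_def using V by auto
  then have "0 \<in> interior U" unfolding eventually_nhds interior_def by blast
  then obtain F where F: "\<And>n. n \<ge> 1 \<Longrightarrow> finite (F n)"
    "0 \<in> interior (\<Inter>n\<in>{1..}. {x + f | x f. x \<in> nbhd_fraction n U \<and> f \<in> F n})"
    using S unfolding schwartz_group_def by blast
  then have "\<forall>\<^sub>F y in nhds 0. y \<in> (\<Inter>n\<in>{1..}. {x + f | x f. x \<in> nbhd_fraction n U \<and> f \<in> F n})"
    unfolding eventually_nhds by (meson in_mono interior_subset open_interior)
  then obtain W where W: "open W" "0 \<in> W"
    "\<And>y. \<forall>n. seq_of y n \<in> W \<Longrightarrow> y \<in> (\<Inter>n\<in>{1..}. {x + f | x f. x \<in> nbhd_fraction n U \<and> f \<in> F n})"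
    unfolding eventually_nhds_F0 by auto
  have one: "\<phi> v = 1" if v: "v \<in> W" for v
  proof (rule unit_powers_near_one)
    show "norm (\<phi> v) = 1" by (rule character_norm[OF \<phi>(1)])
    fix k
    \<comment> \<open>\<open>Suc k\<close> gives \<open>n \<ge> 1\<close> also for
      \<open>k = 0\<close>, and puts \<open>k\<close> into \<open>{1..n}\<close> otherwise.\<close>
    define n where "n = Suc k"
    have "\<forall>\<^sub>F i in sequentially. norm (\<phi> (seq_of f i) - 1) < 1 / (4 * n)" if "f \<in> F n" for f
    proof -
      have "(\<lambda>i. \<phi> (seq_of f i)) \<longlonglongrightarrow> \<phi> 0"
        using seq_of[of f] character_continuous[OF \<phi>(1)]
        by (intro continuous_on_tendsto_compose[of UNIV \<phi>]) (auto simp: null_sequences_def)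
      from tendstoD[OF this, of "1 / (4 * n)"] show ?thesis
        by (simp add: dist_norm n_def character_zero[OF \<phi>(1)])
    qed
    then have "\<forall>\<^sub>F i in sequentially. \<forall>f\<in>F n. norm (\<phi> (seq_of f i) - 1) < 1 / (4 * n)"
      by (intro eventually_ball_finite F) (auto simp: n_def)
    \<comment> \<open>Finitely many null sequences are simultaneously small at some coordinate
      \<open>i\<close>. The tolerance \<open>1 / (4 n)\<close> leaves an error of at most
      \<open>1/4\<close> in the \<open>k\<close>-th power.\<close>
    then obtain i where i: "\<And>f. f \<in> F n \<Longrightarrow> norm (\<phi> (seq_of f i) - 1) < 1 / (4 * n)"
      by (auto simp: eventually_sequentially)
    have "single i v \<in> (\<Inter>n\<in>{1..}. {x + f | x f. x \<in> nbhd_fraction n U \<and> f \<in> F n})"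
      by (rule W(3)) (use v W(2) in \<open>simp add: seq_of_single\<close>)
    then have "single i v \<in> {x + f | x f. x \<in> nbhd_fraction n U \<and> f \<in> F n}"
      by (rule INT_D) (simp add: n_def)
    then obtain y f where y: "y \<in> nbhd_fraction n U" and f: "f \<in> F n" and yf: "single i v = y + f" by blast
    have v_eq: "v = seq_of y i + seq_of f i"
      using arg_cong[OF yf, of "\<lambda>s. seq_of s i"] by (simp add: seq_of_single seq_of_plus)
    show "1 / 2 \<le> Re (\<phi> v ^ k)"
    proof (cases "k = 0")
      case False
      then have "multiple k y \<in> U" using y by (simp add: nbhd_fraction_def multiple_def n_def)
      then have "3 / 4 < Re (\<phi> (seq_of y i) ^ k)"
        by (simp add: U_def V_def seq_of_multiple character_multiple[OF \<phi>(1)])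
      moreover have "norm (\<phi> v ^ k - \<phi> (seq_of y i) ^ k) \<le> 1 / 4"
      proof -
        have "norm (\<phi> v ^ k - \<phi> (seq_of y i) ^ k) \<le> k * norm (\<phi> v - \<phi> (seq_of y i))"
          by (intro norm_power_diff) (simp_all add: character_norm[OF \<phi>(1)])
        also have "norm (\<phi> v - \<phi> (seq_of y i)) = norm (\<phi> (seq_of y i)) * norm (\<phi> (seq_of f i) - 1)"
          unfolding v_eq character_add[OF \<phi>(1)] norm_mult[symmetric] by (simp add: right_diff_distrib)
        also have "k * \<dots> \<le> k * (1 / (4 * n))"
          using i[OF f] by (intro mult_left_mono) (simp_all add: character_norm[OF \<phi>(1)])
        also have "\<dots> \<le> 1 / 4" by (simp add: n_def field_simps)
        finally show ?thesis .
      qed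
      ultimately show ?thesis
        using abs_Re_le_cmod[of "\<phi> v ^ k - \<phi> (seq_of y i) ^ k"] by simp
    qed simp
  qed
  have "x \<in> group_closure W" using connected_group_closure[OF conn W(1,2)] by simp
  then have "\<phi> x = 1"
    by induction (auto simp: one character_zero[OF \<phi>(1)] character_diff[OF \<phi>(1)])
  then show False using \<phi>(2) by simp
qed

text \<open>
  If the values \<open>z\<^sub>n\<close> of a character on the elements \<open>single n v\<close> stayed away from \<open>1\<close>
  infinitely often, the average \<open>\<Prod>n\<in>B. (1 + z\<^sub>n) / 2\<close> of its values on all partial sums would
  tend to \<open>0\<close>, although all these values have real part at least \<open>1/2\<close>.
\<close>

lemma F0_character_single_tendsto:
  fixes x :: "'a::topological_ab_group_add"
  assumes conn: "connected (UNIV :: 'a set)" and \<phi>: "\<phi> \<in> character_group"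
  shows "(\<lambda>n. \<phi> (single n x)) \<longlonglongrightarrow> 1"
proof -
  have "open {y. 1 / 2 < Re (\<phi> y)}"
    by (intro open_Collect_less continuous_intros character_continuous[OF \<phi>])
  then have "\<forall>\<^sub>F y in nhds 0. y \<in> {y. 1 / 2 < Re (\<phi> y)}"
    by (rule eventually_nhds_in_open) (simp add: character_zero[OF \<phi>])
  then obtain V where V: "open V" "0 \<in> V" "\<And>y. \<forall>n. seq_of y n \<in> V \<Longrightarrow> 1 / 2 < Re (\<phi> y)"
    unfolding eventually_nhds_F0 by auto
  have lim: "(\<lambda>n. \<phi> (single n v)) \<longlonglongrightarrow> 1" if v: "v \<in> V" for v
  proof (rule ccontr)
    define z where "z n = \<phi> (single n v)" for n
    assume "\<not> (\<lambda>n. \<phi> (single n v)) \<longlonglongrightarrow> 1"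
    then obtain e where e: "e > 0" "\<exists>\<^sub>F n in sequentially. e \<le> norm (z n - 1)"
      unfolding tendsto_iff z_def frequently_def dist_norm by (auto simp: not_less not_le)
    define A where "A = {n. e \<le> norm (z n - 1)}"
    have A: "infinite A"
      using e(2) unfolding A_def cofinite_eq_sequentially[symmetric] by (simp add: frequently_cofinite)
    \<comment> \<open>Partial sums of the elements \<open>single n v\<close>; their coordinates are
      \<open>0\<close> or \<open>v\<close>, hence in \<open>V\<close>.\<close>
    define s where "s B = F0_of (\<lambda>n. if n \<in> B then v else 0)" for B
    have s: "seq_of (s B) n = (if n \<in> B then v else 0)" if "finite B" for B n
      unfolding s_def using that by (subst seq_of_F0_of_finite) (auto intro: finite_subset[of _ B])
    have s_insert: "\<phi> (s (insert b C)) = \<phi> (s C) * z b" if "finite C" "b \<notin> C" for b C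
    proof -
      have "s (insert b C) = s C + single b v"
        by (rule F0_eqI) (use that in \<open>auto simp: s seq_of_single seq_of_plus\<close>)
      then show ?thesis by (simp add: character_add[OF \<phi>] z_def)
    qed
    \<comment> \<open>Expanding the product yields the values of \<open>\<phi>\<close> on
      \<open>s (C \<union> B')\<close> for all \<open>B' \<subseteq> B\<close>, which are
      \<open>2 ^ card B\<close> numbers of real part above \<open>1/2\<close>. The set
      \<open>C\<close> is there for the induction.\<close>
    have partial: "2 ^ card B / 2 \<le> Re (\<phi> (s C) * (\<Prod>n\<in>B. 1 + z n))"
      if "finite B" "finite C" "B \<inter> C = {}" for B C
      using that
    proof (induction B arbitrary: C rule: finite_induct)
      case empty
      then show ?case using V(3)[of "s C"] V(2) v by (simp add: s less_imp_le)
    next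
      case (insert b B)
      have "2 ^ card B / 2 \<le> Re (\<phi> (s C) * (\<Prod>n\<in>B. 1 + z n))"
        "2 ^ card B / 2 \<le> Re (\<phi> (s (insert b C)) * (\<Prod>n\<in>B. 1 + z n))"
        using insert by (intro insert.IH; auto)+
      moreover have "\<phi> (s C) * (\<Prod>n\<in>insert b B. 1 + z n) =
          \<phi> (s C) * (\<Prod>n\<in>B. 1 + z n) + \<phi> (s (insert b C)) * (\<Prod>n\<in>B. 1 + z n)"
        using insert s_insert[of C b] by (simp add: algebra_simps)
      ultimately show ?case using insert.hyps by (simp del: prod.insert)
    qed
    \<comment> \<open>By the parallelogram law \<open>|1 + z n|^2 = 4 - |z n - 1|^2\<close>, so for
      \<open>n\<close> in \<open>A\<close> each factor is at most \<open>2 c\<close>, where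
      \<open>c < 1\<close>.\<close>
    define c where "c = sqrt (4 - e\<^sup>2) / 2"
    have z_norm: "norm (z n) = 1" for n by (simp add: z_def character_norm[OF \<phi>])
    have par: "(norm (1 + z n))\<^sup>2 = 4 - (norm (z n - 1))\<^sup>2" for n
    proof -
      have "(norm (1 + z n))\<^sup>2 + (norm (z n - 1))\<^sup>2 = 2 + 2 * (norm (z n))\<^sup>2"
        by (simp only: cmod_power2) (simp add: power2_eq_square algebra_simps)
      then show ?thesis using z_norm[of n] by simp
    qed
    have z_le: "norm (1 + z n) \<le> 2 * c" if "n \<in> A" for n
    proof -
      have "e\<^sup>2 \<le> (norm (z n - 1))\<^sup>2" using that e(1) by (intro power_mono) (auto simp: A_def)
      then have "(norm (1 + z n))\<^sup>2 \<le> 4 - e\<^sup>2" using par[of n] by simp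
      then show ?thesis by (simp add: c_def real_le_rsqrt)
    qed
    obtain n0 where "n0 \<in> A" using A by (metis finite.emptyI ex_in_conv)
    then have "0 \<le> c" using z_le[of n0] norm_ge_zero[of "1 + z n0"] by linarith
    have "sqrt (4 - e\<^sup>2) < sqrt 4" using e(1) by (simp only: real_sqrt_less_iff) simp
    then have "c < 1" by (simp add: c_def)
    have "1 / 2 \<le> c ^ N" for N
    proof -
      obtain B where B: "B \<subseteq> A" "finite B" "card B = N"
        using infinite_arbitrarily_large[OF A, of N] by blast
      have "2 ^ N / 2 \<le> Re (\<phi> (s {}) * (\<Prod>n\<in>B. 1 + z n))" using partial[of B "{}"] B by simp
      also have "\<dots> \<le> norm (\<phi> (s {}) * (\<Prod>n\<in>B. 1 + z n))" by (rule complex_Re_le_cmod)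
      also have "\<dots> = (\<Prod>n\<in>B. norm (1 + z n))"
        by (simp add: norm_mult character_norm[OF \<phi>] prod_norm)
      also have "\<dots> \<le> (\<Prod>n\<in>B. 2 * c)" using B z_le by (intro prod_mono) auto
      also have "\<dots> = 2 ^ N * c ^ N" using B by (simp add: power_mult_distrib)
      finally show ?thesis by simp
    qed
    moreover have "(\<lambda>N. c ^ N) \<longlonglongrightarrow> 0" using \<open>0 \<le> c\<close> \<open>c < 1\<close> by (intro LIMSEQ_power_zero) simp
    ultimately have "1 / 2 \<le> (0::real)" by (intro LIMSEQ_le_const) auto
    then show False by simp
  qed
  \<comment> \<open>Convergence to \<open>1\<close> passes to differences, and \<open>V\<close>
    generates the group.\<close>
  have "x \<in> group_closure V" using connected_group_closure[OF conn V(1,2)] by simp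
  then show ?thesis
  proof induction
    case (base s)
    then show ?case using lim V(2) by auto
  next
    case (diff s t)
    have "(\<lambda>n. \<phi> (single n s) * cnj (\<phi> (single n t))) \<longlonglongrightarrow> 1 * cnj 1"
      by (intro tendsto_mult tendsto_cnj diff.IH)
    then show ?case by (simp add: single_diff character_diff[OF \<phi>])
  qed
qed

text \<open>Convergence in an initial topology is tested on the defining maps; here by induction on
  the generation of open sets.\<close>

lemma limitin_bohr_topology:
  fixes l :: "'a::topological_ab_group_add"
  assumes "\<And>\<phi>. \<phi> \<in> character_group \<Longrightarrow> ((\<lambda>x. \<phi> (f x)) \<longlongrightarrow> \<phi> l) F"
  shows "limitin bohr_topology f l F"
  unfolding limitin_def
proof (intro conjI allI impI)
  have "group_topology (bohr_topology :: 'a topology)" by (rule bohr_topology_group_topology)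
  then show "l \<in> topspace bohr_topology" by (simp add: group_topology_def)
  fix U :: "'a set" assume U: "openin bohr_topology U \<and> l \<in> U"
  then have "generate_topology_on {\<phi> -` U |\<phi> U. \<phi> \<in> character_group \<and> open U} U"
    by (simp add: bohr_topology_eq openin_topology_generated_by_iff)
  then show "\<forall>\<^sub>F x in F. f x \<in> U"
    using U[THEN conjunct2]
  proof induction
    case (Int a b)
    then show ?case by (auto intro: eventually_conj)
  next
    case (UN K)
    then obtain k where k: "k \<in> K" "l \<in> k" by blast
    then have "\<forall>\<^sub>F x in F. f x \<in> k" using UN by blast
    then show ?case using k(1) by (auto elim: eventually_mono)
  next
    case (Basis s)
    then obtain \<phi> W where "s = \<phi> -` W" "\<phi> \<in> character_group" "open W" by blast
    then show ?case using topological_tendstoD[OF assms, of \<phi> W] Basis by auto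
  qed auto
qed

section \<open>Group norms\<close>

text \<open>A translation-invariant metric \<open>p (x - y)\<close>, presented by the distance from
  \<open>0\<close>. The last two assumptions together say that it induces the topology.\<close>

locale compact_normed_group = compact_ab_group G
  for G :: "'a::topological_ab_group_add itself" +
  fixes p :: "'a \<Rightarrow> real"
  assumes p_0 [simp]: "p 0 = 0"
    and p_eq_0: "p x = 0 \<Longrightarrow> x = 0"
    and p_minus [simp]: "p (- x) = p x"
    and p_triangle: "p (x + y) \<le> p x + p y"
    and open_p_ball: "open {x. p x < e}"
    and nbhd_p_ball: "open U \<Longrightarrow> 0 \<in> U \<Longrightarrow> \<exists>e>0. \<forall>x. p x < e \<longrightarrow> x \<in> U"
begin

lemma p_commute: "p (x - y) = p (y - x)"
  using p_minus[of "x - y"] by simp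

lemma p_nonneg: "0 \<le> p x"
  using p_triangle[of x "- x"] by simp

lemma p_pos: "x \<noteq> 0 \<Longrightarrow> 0 < p x"
  using p_nonneg[of x] p_eq_0[of x] by linarith

lemma p_triangle_diff: "p (x - z) \<le> p (x - y) + p (y - z)"
  using p_triangle[of "x - y" "y - z"] by simp

lemma p_abs_diff: "\<bar>p x - p y\<bar> \<le> p (x - y)"
  using p_triangle[of "x - y" y] p_triangle[of "y - x" x] p_commute[of x y] by simp

lemma continuous_on_p: "continuous_on UNIV p"
proof (rule continuous_on_uniformI)
  fix e :: real assume "e > 0"
  have "dist (p x) (p y) < e" if "p (x - y) < e" for x y
    using p_abs_diff[of x y] that by (simp add: dist_real_def)
  then show "\<exists>U. open U \<and> 0 \<in> U \<and> (\<forall>x y. x - y \<in> U \<longrightarrow> dist (p x) (p y) < e)"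
    using \<open>e > 0\<close> by (intro exI[of _ "{x. p x < e}"]) (simp add: open_p_ball)
qed

lemma open_iff_p: "open S \<longleftrightarrow> (\<forall>x\<in>S. \<exists>e>0. \<forall>y. p (y - x) < e \<longrightarrow> y \<in> S)"
proof
  assume S: "open S"
  show "\<forall>x\<in>S. \<exists>e>0. \<forall>y. p (y - x) < e \<longrightarrow> y \<in> S"
  proof
    fix x assume "x \<in> S"
    have "open ((\<lambda>v. v + x) -` S)" by (intro open_vimage S continuous_intros)
    then obtain e where "e > 0" "\<And>v. p v < e \<Longrightarrow> v + x \<in> S"
      using nbhd_p_ball[of "(\<lambda>v. v + x) -` S"] \<open>x \<in> S\<close> by auto
    then have "\<forall>y. p (y - x) < e \<longrightarrow> y \<in> S" by (metis diff_add_cancel)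
    with \<open>e > 0\<close> show "\<exists>e>0. \<forall>y. p (y - x) < e \<longrightarrow> y \<in> S" by blast
  qed
next
  assume S: "\<forall>x\<in>S. \<exists>e>0. \<forall>y. p (y - x) < e \<longrightarrow> y \<in> S"
  show "open S"
  proof (subst open_subopen, rule ballI)
    fix x assume "x \<in> S"
    then obtain e where e: "e > 0" "\<And>y. p (y - x) < e \<Longrightarrow> y \<in> S" using S by blast
    have "open ((\<lambda>y. y - x) -` {v. p v < e})" by (intro open_vimage open_p_ball continuous_intros)
    then show "\<exists>T. open T \<and> x \<in> T \<and> T \<subseteq> S"
      using e by (intro exI[of _ "(\<lambda>y. y - x) -` {v. p v < e}"]) auto
  qed
qed

text \<open>The base type carries only a topological class, so metric notions such as completeness
  are taken from the locale of abstract metric spaces.\<close>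

sublocale X: Metric_space "UNIV :: 'a set" "\<lambda>x y. p (x - y)"
proof
  show "p (x - y) = p (y - x)" for x y by (rule p_commute)
  show "p (x - y) = 0 \<longleftrightarrow> x = y" for x y using p_eq_0[of "x - y"] by auto
  show "p (x - z) \<le> p (x - y) + p (y - z)" for x y z by (rule p_triangle_diff)
qed (rule p_nonneg)

lemma X_mtopology: "X.mtopology = euclidean"
proof (rule topology_eq[THEN iffD2], intro allI)
  fix S
  show "openin X.mtopology S \<longleftrightarrow> openin euclidean S"
    unfolding X.openin_mtopology open_openin[symmetric] open_iff_p
    by (simp add: X.mball_def subset_iff p_commute Ball_def)
qed

lemma X_mcomplete: "X.mcomplete"
  by (rule X.compact_space_imp_mcomplete) (simp add: X_mtopology compact_space_def compact_UNIV)

lemma tendsto_iff_p: "(f \<longlongrightarrow> l) F \<longleftrightarrow> (\<forall>e>0. \<forall>\<^sub>F x in F. p (f x - l) < e)"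
  using X.limitin_metric[of f l F] by (simp add: X_mtopology)

lemma null_p: "\<forall>\<^sub>F n in sequentially. p (seq_of x n) < e" if "e > 0"
  using seq_of[of x] that by (simp add: null_sequences_def tendsto_iff_p)

text \<open>Guarantees that the supremum in \<open>sup_norm\<close> is taken over a bounded
  set.\<close>

lemma p_bounded: "\<exists>B. \<forall>x. p x \<le> B"
  using continuous_attains_sup[OF compact_UNIV _ continuous_on_p] by auto

section \<open>The complete supremum metric on null sequences\<close>

definition sup_norm :: "'a F0 \<Rightarrow> real" where
  "sup_norm x = (SUP n. p (seq_of x n))"

lemma p_le_sup_norm: "p (seq_of x n) \<le> sup_norm x"
proof -
  obtain B where "\<And>x. p x \<le> B" using p_bounded by blast
  then show ?thesis unfolding sup_norm_def by (intro cSUP_upper bdd_aboveI[of _ B]) auto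
qed

lemma sup_norm_le: "(\<And>n. p (seq_of x n) \<le> e) \<Longrightarrow> sup_norm x \<le> e"
  unfolding sup_norm_def by (intro cSUP_least) auto

sublocale F: Metric_space "UNIV :: 'a F0 set" "\<lambda>x y. sup_norm (x - y)"
proof
  show "0 \<le> sup_norm (x - y)" for x y using p_le_sup_norm[of "x - y" 0] p_nonneg order_trans by blast
  show "sup_norm (x - y) = sup_norm (y - x)" for x y unfolding sup_norm_def by (simp add: seq_of_minus p_commute)
  show "sup_norm (x - y) = 0 \<longleftrightarrow> x = y" for x y
  proof
    assume sup_norm: "sup_norm (x - y) = 0"
    have "p (seq_of x n - seq_of y n) = 0" for n
      using p_le_sup_norm[of "x - y" n] p_nonneg[of "seq_of x n - seq_of y n"] sup_norm by (simp add: seq_of_minus)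
    then show "x = y" using p_eq_0 by (intro F0_eqI) fastforce
  qed (simp add: sup_norm_def seq_of_zero)
  show "sup_norm (x - z) \<le> sup_norm (x - y) + sup_norm (y - z)" for x y z
  proof (rule sup_norm_le)
    fix n
    show "p (seq_of (x - z) n) \<le> sup_norm (x - y) + sup_norm (y - z)"
      using p_triangle_diff[of "seq_of x n" "seq_of z n" "seq_of y n"] p_le_sup_norm[of "x - y" n] p_le_sup_norm[of "y - z" n]
      by (simp add: seq_of_minus)
  qed
qed

lemma F_mtopology: "F.mtopology = euclidean"
proof (rule topology_eq[THEN iffD2], intro allI)
  fix S :: "'a F0 set"
  show "openin F.mtopology S \<longleftrightarrow> openin euclidean S"
  proof
    assume "openin F.mtopology S"
    then have S: "\<And>x. x \<in> S \<Longrightarrow> \<exists>e>0. \<forall>y. sup_norm (x - y) < e \<longrightarrow> y \<in> S"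
      unfolding F.openin_mtopology by (simp add: F.mball_def subset_iff)
    have "\<exists>V. open V \<and> 0 \<in> V \<and> {y. \<forall>n. seq_of (y - x) n \<in> V} \<subseteq> S" if x: "x \<in> S" for x
    proof -
      obtain e where e: "e > 0" "\<And>y. sup_norm (x - y) < e \<Longrightarrow> y \<in> S" using S[OF x] by blast
      \<comment> \<open>Strict bounds in the coordinates give only a weak bound for the supremum,
        hence \<open>e / 2\<close>.\<close>
      have "y \<in> S" if "\<forall>n. seq_of (y - x) n \<in> {v. p v < e / 2}" for y
      proof (rule e(2))
        have "sup_norm (x - y) \<le> e / 2"
          by (rule sup_norm_le) (use that in \<open>simp add: seq_of_minus p_commute less_imp_le\<close>)
        then show "sup_norm (x - y) < e" using e(1) by simp
      qed
      then show ?thesis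
        using e(1) open_p_ball[of "e / 2"] by (intro exI[of _ "{v. p v < e / 2}"]) auto
    qed
    then show "openin euclidean S" by (simp add: open_F0_def)
  next
    assume "openin euclidean S"
    then have "open S" by simp
    have "\<exists>e>0. \<forall>y. sup_norm (x - y) < e \<longrightarrow> y \<in> S" if x: "x \<in> S" for x
    proof -
      obtain V where V: "open V" "0 \<in> V" "{y. \<forall>n. seq_of (y - x) n \<in> V} \<subseteq> S"
        using \<open>open S\<close> x unfolding open_F0_def by blast
      obtain e where e: "e > 0" "\<And>v. p v < e \<Longrightarrow> v \<in> V" using nbhd_p_ball[OF V(1,2)] by blast
      have "y \<in> S" if y: "sup_norm (x - y) < e" for y
      proof -
        have "seq_of (y - x) n \<in> V" for n
          using p_le_sup_norm[of "x - y" n] y by (intro e(2)) (simp add: seq_of_minus p_commute)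
        then show ?thesis using V(3) by blast
      qed
      then show ?thesis using e(1) by blast
    qed
    then show "openin F.mtopology S"
      unfolding F.openin_mtopology by (simp add: F.mball_def subset_iff)
  qed
qed

lemma F_closure: "x \<in> closure A \<longleftrightarrow> (\<forall>e>0. \<exists>y\<in>A. sup_norm (x - y) < e)"
proof -
  have "closure A = F.mtopology closure_of A" by (simp add: F_mtopology)
  then show ?thesis by (simp add: F.metric_closure_of)
qed

lemma F_tendsto: "(f \<longlongrightarrow> l) F \<longleftrightarrow> (\<forall>e>0. \<forall>\<^sub>F x in F. sup_norm (f x - l) < e)"
  using F.limitin_metric[of f l F] by (simp add: F_mtopology)

text \<open>Coordinatewise limits exist by compactness of the base group. The Cauchy condition makes
  the convergence uniform, which also forces the limit sequence to be null.\<close>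

lemma F_mcomplete: "F.mcomplete"
  unfolding F.mcomplete_def
proof (intro allI impI)
  fix \<sigma> assume \<sigma>: "F.MCauchy \<sigma>"
  have cauchy: "\<exists>N. \<forall>i\<ge>N. \<forall>j\<ge>N. sup_norm (\<sigma> i - \<sigma> j) < e" if "e > 0" for e
    using \<sigma>[unfolded F.MCauchy_def, THEN conjunct2, rule_format, OF that] by metis
  have "\<exists>l. (\<lambda>i. seq_of (\<sigma> i) n) \<longlonglongrightarrow> l" for n
  proof -
    have "X.MCauchy (\<lambda>i. seq_of (\<sigma> i) n)"
      unfolding X.MCauchy_def
    proof (intro conjI allI impI)
      fix e :: real assume "e > 0"
      then obtain N where N: "\<forall>i\<ge>N. \<forall>j\<ge>N. sup_norm (\<sigma> i - \<sigma> j) < e" using cauchy by blast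
      have "p (seq_of (\<sigma> i) n - seq_of (\<sigma> j) n) < e" if "i \<ge> N" "j \<ge> N" for i j
        using N that p_le_sup_norm[of "\<sigma> i - \<sigma> j" n] by (force simp: seq_of_minus)
      then show "\<exists>N. \<forall>i j. N \<le> i \<longrightarrow> N \<le> j \<longrightarrow> p (seq_of (\<sigma> i) n - seq_of (\<sigma> j) n) < e" by blast
    qed simp
    then show ?thesis using X_mcomplete unfolding X.mcomplete_def X_mtopology by auto
  qed
  then obtain x where x: "\<And>n. (\<lambda>i. seq_of (\<sigma> i) n) \<longlonglongrightarrow> x n" by metis
  have near: "\<exists>N. \<forall>i\<ge>N. \<forall>n. p (seq_of (\<sigma> i) n - x n) \<le> e" if e: "e > 0" for e
  proof -
    obtain N where N: "\<forall>i\<ge>N. \<forall>j\<ge>N. sup_norm (\<sigma> i - \<sigma> j) < e" using cauchy[OF e] by blast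
    have "p (seq_of (\<sigma> i) n - x n) \<le> e" if i: "i \<ge> N" for i n
    proof (rule field_le_epsilon)
      fix d :: real assume "d > 0"
      then have "\<forall>\<^sub>F j in sequentially. p (seq_of (\<sigma> j) n - x n) < d"
        using x[of n] by (simp add: tendsto_iff_p)
      then obtain j where j: "j \<ge> N" "p (seq_of (\<sigma> j) n - x n) < d"
        unfolding eventually_sequentially by (metis linorder_linear)
      have "p (seq_of (\<sigma> i) n - seq_of (\<sigma> j) n) < e"
        using N i j(1) p_le_sup_norm[of "\<sigma> i - \<sigma> j" n] by (force simp: seq_of_minus)
      then show "p (seq_of (\<sigma> i) n - x n) \<le> e + d"
        using p_triangle_diff[of "seq_of (\<sigma> i) n" "x n" "seq_of (\<sigma> j) n"] j(2) by simp
    qed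
    then show ?thesis by blast
  qed
  have "x \<longlonglongrightarrow> 0"
    unfolding tendsto_iff_p
  proof (intro allI impI)
    fix e :: real assume "e > 0"
    then obtain N where N: "\<forall>i\<ge>N. \<forall>n. p (seq_of (\<sigma> i) n - x n) \<le> e / 2"
      using near[of "e / 2"] by auto
    have "\<forall>\<^sub>F n in sequentially. p (seq_of (\<sigma> N) n) < e / 2"
      by (rule null_p) (use \<open>e > 0\<close> in simp)
    then show "\<forall>\<^sub>F n in sequentially. p (x n - 0) < e"
    proof eventually_elim
      case (elim n)
      then show ?case
        using N p_triangle_diff[of "x n" 0 "seq_of (\<sigma> N) n"] p_commute[of "x n" "seq_of (\<sigma> N) n"]
        by (smt (verit) diff_zero field_sum_of_halves order_refl)
    qed
  qed
  then have seq_x: "seq_of (F0_of x) = x" by (rule seq_of_F0_of)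
  have "\<sigma> \<longlonglongrightarrow> F0_of x"
    unfolding F_tendsto
  proof (intro allI impI)
    fix e :: real assume "e > 0"
    then obtain N where N: "\<forall>i\<ge>N. \<forall>n. p (seq_of (\<sigma> i) n - x n) \<le> e / 2"
      using near[of "e / 2"] by auto
    have "sup_norm (\<sigma> i - F0_of x) < e" if "i \<ge> N" for i
    proof -
      have "sup_norm (\<sigma> i - F0_of x) \<le> e / 2"
        by (rule sup_norm_le) (use N that in \<open>simp add: seq_of_minus seq_x\<close>)
      then show ?thesis using \<open>e > 0\<close> by simp
    qed
    then show "\<forall>\<^sub>F i in sequentially. sup_norm (\<sigma> i - F0_of x) < e"
      unfolding eventually_sequentially by blast
  qed
  then show "\<exists>x. limitin F.mtopology \<sigma> x sequentially" by (auto simp: F_mtopology)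
qed

section \<open>Separability and connectedness\<close>

lemma countable_dense: "\<exists>D. countable D \<and> (\<forall>x. \<forall>e>0. \<exists>d\<in>D. p (x - d) < e)"
proof -
  have "\<exists>n>0::nat. \<exists>a. \<forall>x. \<exists>i<n. x + a i \<in> {x. p x < 1 / real (Suc m)}" for m
    by (rule finite_translates_cover[OF open_p_ball]) simp
  then obtain n a where na: "\<And>m x. \<exists>i<(n m :: nat). p (x + a m i) < 1 / real (Suc m)"
    unfolding mem_Collect_eq by metis
  \<comment> \<open>For each \<open>m\<close> the points \<open>- a m i\<close> with
    \<open>i < n m\<close> form a finite net of mesh \<open>1 / Suc m\<close>.\<close>
  let ?D = "\<Union>m. (\<lambda>i. - a m i) ` {..<n m}"
  have "\<exists>d\<in>?D. p (x - d) < e" if e: "e > 0" for x e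
  proof -
    obtain m where m: "1 / real (Suc m) < e" using nat_approx_posE[OF e] by blast
    obtain i where "i < n m" "p (x + a m i) < 1 / real (Suc m)" using na by blast
    then show ?thesis using m by (intro bexI[of _ "- a m i"]) auto
  qed
  then show ?thesis by (intro exI[of _ ?D]) auto
qed

lemma F_separable: "\<exists>C. countable C \<and> closure C = (UNIV :: 'a F0 set)"
proof -
  obtain D where D: "countable D" "\<And>x e. e > 0 \<Longrightarrow> \<exists>d\<in>D. p (x - d) < e"
    using countable_dense by blast
  \<comment> \<open>Finitely supported sequences coded by lists, so that countability is that of the
    lists over \<open>D\<close>.\<close>
  define s where "s xs = F0_of (\<lambda>n. if n < length xs then xs ! n else (0::'a))" for xs
  have s: "seq_of (s xs) n = (if n < length xs then xs ! n else 0)" for xs n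
    unfolding s_def by (subst seq_of_F0_of_finite) (auto intro: finite_subset[of _ "{..<length xs}"])
  have "x \<in> closure (s ` lists D)" for x
    unfolding F_closure
  proof (intro allI impI)
    fix e :: real assume "e > 0"
    then have "\<forall>\<^sub>F n in sequentially. p (seq_of x n) < e / 2" by (intro null_p) simp
    then obtain N where N: "\<And>n. n \<ge> N \<Longrightarrow> p (seq_of x n) < e / 2"
      unfolding eventually_sequentially by blast
    have "\<forall>n. \<exists>d. d \<in> D \<and> p (seq_of x n - d) < e / 2"
      using D(2)[of "e / 2"] \<open>e > 0\<close> by auto
    then obtain d where d: "\<And>n. d n \<in> D" "\<And>n. p (seq_of x n - d n) < e / 2" by metis
    let ?xs = "map d [0..<N]"
    have "sup_norm (x - s ?xs) \<le> e / 2"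
    proof (rule sup_norm_le)
      fix n
      show "p (seq_of (x - s ?xs) n) \<le> e / 2"
        using N[of n] d(2)[of n] by (cases "n < N") (auto simp: seq_of_minus s)
    qed
    then have "sup_norm (x - s ?xs) < e" using \<open>e > 0\<close> by simp
    moreover have "?xs \<in> lists D" using d(1) by auto
    ultimately show "\<exists>y\<in>s ` lists D. sup_norm (x - y) < e" by blast
  qed
  moreover have "countable (s ` lists D)" using D(1) by (intro countable_image countable_lists)
  ultimately show ?thesis by blast
qed

lemma polish_F0: "polish TYPE('a F0)"
  unfolding polish_def
proof
  show "separable_space (euclidean :: 'a F0 topology)"
    unfolding separable_space_def using F_separable by simp
  show "completely_metrizable_space (euclidean :: 'a F0 topology)"
    using F.completely_metrizable_space_mtopology[OF F_mcomplete] by (simp add: F_mtopology)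
qed

text \<open>Truncations are joined to \<open>0\<close> by changing one coordinate at a time within a
  continuous image of the connected base group. They are dense, and components are closed.\<close>

lemma connected_F0:
  assumes "connected (UNIV :: 'a set)"
  shows "connected (UNIV :: 'a F0 set)"
proof -
  define tr where "tr N x = F0_of (\<lambda>n. if n < N then seq_of x n else 0)" for N and x :: "'a F0"
  have tr: "seq_of (tr N x) n = (if n < N then seq_of x n else 0)" for N n and x :: "'a F0"
    unfolding tr_def by (subst seq_of_F0_of_finite) (auto intro: finite_subset[of _ "{..<N}"])
  have "connected_component UNIV 0 (tr N x)" for N and x :: "'a F0"
  proof (induction N)
    case 0
    have "tr 0 x = 0" by (rule F0_eqI) (simp add: tr seq_of_zero)
    then show ?case by (simp add: connected_component_refl)
  next
    case (Suc N)
    have "tr (Suc N) x = tr N x + single N (seq_of x N)"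
      by (rule F0_eqI) (auto simp: tr seq_of_plus seq_of_single less_Suc_eq)
    moreover have "tr N x = tr N x + single N 0" by (simp add: single_0)
    moreover have "connected (range (\<lambda>v. tr N x + single N v))"
      by (rule connected_continuous_image[OF _ assms]) (intro continuous_intros continuous_on_single)
    ultimately have "connected_component UNIV (tr N x) (tr (Suc N) x)"
      unfolding connected_component_def by (intro exI[of _ "range (\<lambda>v. tr N x + single N v)"]) blast
    then show ?case using Suc.IH connected_component_trans by blast
  qed
  moreover have "x \<in> closure (range (\<lambda>N. tr N x))" for x :: "'a F0"
    unfolding F_closure
  proof (intro allI impI)
    fix e :: real assume "e > 0"
    then have "\<forall>\<^sub>F n in sequentially. p (seq_of x n) < e / 2" by (intro null_p) simp
    then obtain N where N: "\<And>n. n \<ge> N \<Longrightarrow> p (seq_of x n) < e / 2"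
      unfolding eventually_sequentially by blast
    have "sup_norm (x - tr N x) \<le> e / 2"
    proof (rule sup_norm_le)
      fix n
      show "p (seq_of (x - tr N x) n) \<le> e / 2"
        using N[of n] \<open>e > 0\<close> by (cases "n < N") (auto simp: seq_of_minus tr)
    qed
    then show "\<exists>y\<in>range (\<lambda>N. tr N x). sup_norm (x - y) < e" using \<open>e > 0\<close> by (intro bexI[of _ "tr N x"]) auto
  qed
  ultimately have "x \<in> closure (connected_component_set UNIV 0)" for x :: "'a F0"
    using closure_mono[of "range (\<lambda>N. tr N x)" "connected_component_set UNIV 0"] by blast
  moreover have "closed (connected_component_set UNIV (0::'a F0))"
    by (rule closed_connected_component) simp
  ultimately have "connected_component_set UNIV 0 = (UNIV :: 'a F0 set)" by auto
  then show ?thesis using connected_connected_component[of UNIV "0::'a F0"] by simp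
qed

text \<open>The norm \<open>p\<close> itself is a continuous function with different values at
  \<open>0\<close> and \<open>a\<close>.\<close>

lemma characters_separate_zero: "a \<noteq> 0 \<Longrightarrow> \<exists>\<phi>\<in>character_group. \<phi> a \<noteq> 1" for a :: 'a
proof (rule character_separates[of "\<lambda>x. complex_of_real (p x)"])
  show "continuous_on UNIV (\<lambda>x. complex_of_real (p x))" by (intro continuous_intros continuous_on_p)
  show "a \<noteq> 0 \<Longrightarrow> complex_of_real (p 0) \<noteq> complex_of_real (p a)" using p_pos[of a] by simp
qed

lemma MAP_F0: "MAP_group TYPE('a F0)"
  unfolding MAP_group_def
proof (intro allI impI)
  fix x y :: "'a F0" assume "x \<noteq> y"
  then obtain n where "seq_of x n - seq_of y n \<noteq> 0" using F0_eqI[of x y] by auto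
  then obtain \<phi> where \<phi>: "\<phi> \<in> character_group" "\<phi> (seq_of x n - seq_of y n) \<noteq> 1"
    using characters_separate_zero by blast
  then have "\<phi> (seq_of x n) \<noteq> \<phi> (seq_of y n)"
    using character_mult_cnj[OF \<phi>(1)] by (auto simp: character_diff[OF \<phi>(1)])
  then show "\<exists>\<phi>\<in>character_group. \<phi> x \<noteq> \<phi> y"
    by (intro bexI[of _ "\<lambda>z. \<phi> (seq_of z n)"] character_group_seq_of[OF \<phi>(1)])
qed

text \<open>Baire category: an element lying in all sets \<open>T c m\<close>, for \<open>c\<close>
  in a countable dense set, has multiples arbitrarily close to every such \<open>c\<close>.\<close>

lemma monothetic_F0:
  assumes "connected (UNIV :: 'a set)"
  shows "monothetic TYPE('a F0)"
proof -
  interpret connected_compact_ab_group G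
    by unfold_locales (fact assms, rule characters_separate_zero)
  obtain C where C: "countable C" "closure C = (UNIV :: 'a F0 set)" using F_separable by blast
  define T where "T c m = (\<Union>k. multiple k -` {y. sup_norm (c - y) < 1 / real (Suc m)})" for c :: "'a F0" and m
  have ball: "open {y. sup_norm (c - y) < e}" for c :: "'a F0" and e
    using F.openin_mball[of c e] by (simp add: F_mtopology F.mball_def)
  have open_T: "open (T c m)" for c m
    unfolding T_def by (intro open_UN ballI open_vimage ball continuous_on_multiple)
  have dense_T: "x \<in> closure (T c m)" for c m x
    unfolding F_closure
  proof (intro allI impI)
    fix e :: real assume "e > 0"
    \<comment> \<open>The halves turn weak bounds by \<open>d\<close> into strict ones.\<close>
    define d where "d = min (e / 2) (1 / real (Suc m) / 2)"
    have d: "d > 0" using \<open>e > 0\<close> by (simp add: d_def)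
    \<comment> \<open>One \<open>K\<close> serves all coordinates, because the density of multiples
      is uniform in the target \<open>y\<close>.\<close>
    obtain K where K: "\<And>y. \<exists>u. p u < d \<and> p (multiple K u - y) < d"
      using multiples_of_nbhd_dense[OF open_p_ball[of d]] d by auto
    have "\<forall>\<^sub>F n in sequentially. p (seq_of x n) < d \<and> p (seq_of c n) < d"
      by (intro eventually_conj null_p d)
    then obtain N where N: "\<And>n. n \<ge> N \<Longrightarrow> p (seq_of x n) < d \<and> p (seq_of c n) < d"
      unfolding eventually_sequentially by blast
    have "\<forall>n. \<exists>u. p u < d \<and> p (multiple K u - (seq_of c n - multiple K (seq_of x n))) < d"
      using K by blast
    then obtain u where u: "\<And>n. p (u n) < d"
      "\<And>n. p (multiple K (u n) - (seq_of c n - multiple K (seq_of x n))) < d" by metis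
    \<comment> \<open>Adding \<open>u n\<close> brings the multiple by \<open>K\<close> close to
      coordinate \<open>n\<close> of \<open>c\<close>. From \<open>N\<close> on the value
      \<open>0\<close> suffices, as both \<open>x\<close> and \<open>c\<close> are already within
      \<open>d\<close> of \<open>0\<close>.\<close>
    define y where "y = F0_of (\<lambda>n. if n < N then seq_of x n + u n else 0)"
    have y: "seq_of y n = (if n < N then seq_of x n + u n else 0)" for n
      unfolding y_def by (subst seq_of_F0_of_finite) (auto intro: finite_subset[of _ "{..<N}"])
    have "sup_norm (x - y) \<le> d"
    proof (rule sup_norm_le)
      fix n
      show "p (seq_of (x - y) n) \<le> d"
        using N[of n] u(1)[of n] by (cases "n < N") (auto simp: seq_of_minus y less_imp_le)
    qed
    then have "sup_norm (x - y) < e" using \<open>e > 0\<close> by (simp add: d_def)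
    moreover have "sup_norm (c - multiple K y) \<le> d"
    proof (rule sup_norm_le)
      fix n
      show "p (seq_of (c - multiple K y) n) \<le> d"
      proof (cases "n < N")
        case True
        have "p (seq_of (c - multiple K y) n) = p (seq_of c n - (multiple K (seq_of x n) + multiple K (u n)))"
          using True by (simp add: seq_of_minus seq_of_multiple y multiple_add)
        also have "\<dots> = p (multiple K (u n) - (seq_of c n - multiple K (seq_of x n)))"
          by (subst p_commute) (simp add: algebra_simps)
        finally show ?thesis using u(2)[of n] by simp
      next
        case False
        then show ?thesis using N[of n] by (simp add: seq_of_minus seq_of_multiple y)
      qed
    qed
    then have "sup_norm (c - multiple K y) < 1 / real (Suc m)"
    proof (rule le_less_trans)
      have "d \<le> 1 / real (Suc m) / 2" by (simp add: d_def)
      also have "\<dots> < 1 / real (Suc m)" by (simp add: field_simps)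
      finally show "d < 1 / real (Suc m)" .
    qed
    ultimately show "\<exists>y\<in>T c m. sup_norm (x - y) < e" by (auto simp: T_def)
  qed
  have "F.mtopology closure_of (\<Inter>((\<lambda>(c, m). T c m) ` (C \<times> UNIV))) = UNIV"
    by (rule F.metric_Baire_category[OF F_mcomplete]) (use C(1) open_T dense_T in \<open>auto simp: F_mtopology\<close>)
  then have "(\<Inter>((\<lambda>(c, m). T c m) ` (C \<times> UNIV))) \<noteq> {}" by force
  then obtain x where x: "\<And>c m. c \<in> C \<Longrightarrow> x \<in> T c m" by auto
  have mult: "multiple k x \<in> group_closure {x}" for k
    by (induction k) (auto simp: multiple_Suc intro: group_closure_add group_closure.base)
  have "y \<in> closure (group_closure {x})" for y
    unfolding F_closure
  proof (intro allI impI)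
    fix e :: real assume "e > 0"
    then obtain m where m: "1 / real (Suc m) < e / 2" using nat_approx_posE[of "e / 2"] by auto
    have "y \<in> closure C" using C(2) by simp
    then obtain c where c: "c \<in> C" "sup_norm (y - c) < e / 2"
      unfolding F_closure using \<open>e > 0\<close> by (meson half_gt_zero)
    obtain k where k: "sup_norm (c - multiple k x) < 1 / real (Suc m)" using x[OF c(1), of m] by (auto simp: T_def)
    have "sup_norm (y - multiple k x) < e"
      using F.triangle[of y c "multiple k x"] c(2) k m by simp
    then show "\<exists>z\<in>group_closure {x}. sup_norm (y - z) < e" using mult by blast
  qed
  then show ?thesis unfolding monothetic_def by blast
qed

section \<open>Convergence and compactness in the Bohr topology\<close>

lemma single_not_convergent:
  fixes x :: 'a
  assumes "x \<noteq> 0" "strict_mono r"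
  shows "\<not> (\<lambda>n. single (r n) x) \<longlonglongrightarrow> l"
proof
  assume "(\<lambda>n. single (r n) x) \<longlonglongrightarrow> l"
  then have "\<forall>\<^sub>F n in sequentially. sup_norm (single (r n) x - l) < p x / 2"
    unfolding F_tendsto using p_pos[OF assms(1)] half_gt_zero by blast
  then obtain N where N: "\<And>n. n \<ge> N \<Longrightarrow> sup_norm (single (r n) x - l) < p x / 2"
    unfolding eventually_sequentially by blast
  \<comment> \<open>Two terms with different indices differ by \<open>x\<close> at coordinate
    \<open>r N\<close>, so their distance is at least \<open>p x\<close>.\<close>
  have "r N \<noteq> r (Suc N)" using assms(2) by (simp add: strict_mono_eq)
  then have "p x = p (seq_of (single (r N) x - single (r (Suc N)) x) (r N))"
    by (simp add: seq_of_minus seq_of_single)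
  also have "\<dots> \<le> sup_norm (single (r N) x - single (r (Suc N)) x)" by (rule p_le_sup_norm)
  also have "\<dots> \<le> sup_norm (single (r N) x - l) + sup_norm (single (r (Suc N)) x - l)"
    using F.triangle[of "single (r N) x" l "single (r (Suc N)) x"] F.commute[of l "single (r (Suc N)) x"] by simp
  also have "\<dots> < p x" using N[of N] N[of "Suc N"] by simp
  finally show False by simp
qed

lemma single_limitin_bohr:
  assumes "connected (UNIV :: 'a set)"
  shows "limitin bohr_topology (\<lambda>n. single n (x::'a)) 0 sequentially"
  by (rule limitin_bohr_topology) (simp add: character_zero F0_character_single_tendsto assms)

lemma not_schur_F0:
  assumes "connected (UNIV :: 'a set)" "(x::'a) \<noteq> 0"
  shows "\<not> schur_property TYPE('a F0)"
  using single_limitin_bohr[OF assms(1), of x] single_not_convergent[OF assms(2) strict_mono_id]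
  unfolding schur_property_def convergent_def id_def by blast

text \<open>The elements \<open>single n x\<close> together with \<open>0\<close> form a
  Bohr-compact set, whereas no subsequence of them converges in the metrizable group
  \<open>F0\<close>.\<close>

lemma not_respects_compactness_F0:
  assumes "connected (UNIV :: 'a set)" "(x::'a) \<noteq> 0"
  shows "\<not> respects_compactness TYPE('a F0)"
proof
  assume R: "respects_compactness TYPE('a F0)"
  let ?K = "insert 0 (range (\<lambda>n. single n x))"
  have "compactin bohr_topology ?K"
  proof (rule compactin_sequence_with_limit[OF single_limitin_bohr[OF assms(1), of x]])
    have "group_topology (bohr_topology :: 'a F0 topology)" by (rule bohr_topology_group_topology)
    then show "range (\<lambda>n. single n x) \<subseteq> topspace bohr_topology" by (simp add: group_topology_def)
  qed simp
  then have "compactin F.mtopology ?K" using R by (simp add: respects_compactness_def F_mtopology)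
  then obtain l r where "strict_mono r" "limitin F.mtopology ((\<lambda>n. single n x) \<circ> r) l sequentially"
    unfolding F.compactin_sequentially by (metis range_subsetD subset_insertI subset_UNIV)
  then show False
    using single_not_convergent[OF assms(2), of r l] by (simp add: F_mtopology o_def)
qed

text \<open>Only the inclusion of the intersection in the subgroup calls for an argument: each
  \<open>y\<close> outside is excluded by a single sequence of coordinate characters.\<close>

lemma g_closed_null_sequences: "g_closed (null_sequences :: (nat \<Rightarrow> 'a F0) set)"
proof -
  let ?H = "null_sequences :: (nat \<Rightarrow> 'a F0) set"
  have "y \<in> ?H" if y: "\<And>u. range u \<subseteq> character_group \<Longrightarrow> ?H \<subseteq> s_subgroup u \<Longrightarrow> y \<in> s_subgroup u" for y
  proof (rule ccontr)
    assume "y \<notin> ?H"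
    then obtain e where e: "e > 0" "\<exists>\<^sub>F k in sequentially. e \<le> sup_norm (y k)"
      unfolding null_sequences_def F_tendsto frequently_def by (auto simp: not_less not_le)
    then have "infinite {k. e \<le> sup_norm (y k)}"
      unfolding cofinite_eq_sequentially[symmetric] by (simp add: frequently_cofinite)
    from infinite_enumerate[OF this]
    obtain r :: "nat \<Rightarrow> nat" where r: "strict_mono r" "\<And>n. e \<le> sup_norm (y (r n))" by auto
    have "\<exists>i. e / 2 < p (seq_of (y (r n)) i)" for n
    proof (rule ccontr)
      assume "\<nexists>i. e / 2 < p (seq_of (y (r n)) i)"
      then have "sup_norm (y (r n)) \<le> e / 2" by (intro sup_norm_le) (simp add: not_less)
      then show False using r(2)[of n] e(1) by simp
    qed
    then obtain i where i: "\<And>n. e / 2 < p (seq_of (y (r n)) (i n))" by metis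
    \<comment> \<open>By compactness the selected coordinates converge along a subsequence. Their
      norms exceed \<open>e / 2\<close>, so the limit is not \<open>0\<close>.\<close>
    have "compactin X.mtopology UNIV" using compact_UNIV by (simp add: X_mtopology)
    then obtain l q where q: "strict_mono q"
      "limitin X.mtopology ((\<lambda>n. seq_of (y (r n)) (i n)) \<circ> q) l sequentially"
      unfolding X.compactin_sequentially by (metis subset_UNIV)
    then have lim: "(\<lambda>n. seq_of (y (r (q n))) (i (q n))) \<longlonglongrightarrow> l"
      by (simp add: X_mtopology o_def)
    have "(\<lambda>n. p (seq_of (y (r (q n))) (i (q n)))) \<longlonglongrightarrow> p l"
      by (rule continuous_on_tendsto_compose[OF continuous_on_p lim]) auto
    then have "e / 2 \<le> p l"
      by (rule LIMSEQ_le_const) (use i in \<open>auto intro: less_imp_le\<close>)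
    then have "l \<noteq> 0" using e(1) by auto
    then obtain \<phi> where \<phi>: "\<phi> \<in> character_group" "\<phi> l \<noteq> 1" using characters_separate_zero by blast
    \<comment> \<open>Both the term and its coordinate vary with \<open>n\<close>. On null sequences
      the values still tend to \<open>1\<close>, since convergence to \<open>0\<close> in
      \<open>F0\<close> is uniform over the coordinates.\<close>
    define u where "u n z = \<phi> (seq_of (z (r (q n))) (i (q n)))" for n and z :: "nat \<Rightarrow> 'a F0"
    have "u n \<in> character_group" for n
    proof -
      let ?\<psi> = "\<lambda>x. \<phi> (seq_of x (i (q n)))"
      have \<psi>: "?\<psi> \<in> character_group" by (rule character_group_seq_of[OF \<phi>(1)])
      have "continuous_on UNIV (\<lambda>z::nat \<Rightarrow> 'a F0. ?\<psi> (z (r (q n))))"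
        by (rule continuous_on_compose2[OF character_continuous[OF \<psi>] continuous_on_product_coordinates]) simp
      then show ?thesis
        using \<psi> by (simp add: character_group_def u_def[abs_def])
    qed
    moreover have "?H \<subseteq> s_subgroup u"
    proof
      fix z assume "z \<in> ?H"
      then have z: "z \<longlonglongrightarrow> 0" by (simp add: null_sequences_def)
      have zr: "(\<lambda>n. z (r (q n))) \<longlonglongrightarrow> 0"
        using LIMSEQ_subseq_LIMSEQ[OF z strict_mono_compose[OF r(1) q(1)]] by (simp add: o_def)
      have "(\<lambda>n. seq_of (z (r (q n))) (i (q n))) \<longlonglongrightarrow> 0"
        unfolding tendsto_iff_p
      proof (intro allI impI)
        fix e :: real assume "e > 0"
        then have "\<forall>\<^sub>F n in sequentially. sup_norm (z (r (q n))) < e" using zr by (simp add: F_tendsto)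
        then show "\<forall>\<^sub>F n in sequentially. p (seq_of (z (r (q n))) (i (q n)) - 0) < e"
          by eventually_elim (use p_le_sup_norm in \<open>auto intro: le_less_trans\<close>)
      qed
      then have "(\<lambda>n. \<phi> (seq_of (z (r (q n))) (i (q n)))) \<longlonglongrightarrow> \<phi> 0"
        by (rule continuous_on_tendsto_compose[OF character_continuous[OF \<phi>(1)]]) auto
      then show "z \<in> s_subgroup u" by (simp add: s_subgroup_def u_def character_zero[OF \<phi>(1)])
    qed
    ultimately have "y \<in> s_subgroup u" by (intro y) auto
    then have "(\<lambda>n. \<phi> (seq_of (y (r (q n))) (i (q n)))) \<longlonglongrightarrow> 1"
      by (simp add: s_subgroup_def u_def)
    moreover have "(\<lambda>n. \<phi> (seq_of (y (r (q n))) (i (q n)))) \<longlonglongrightarrow> \<phi> l"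
      by (rule continuous_on_tendsto_compose[OF character_continuous[OF \<phi>(1)] lim]) auto
    ultimately show False using LIMSEQ_unique \<phi>(2) by blast
  qed
  then show ?thesis unfolding g_closed_def by blast
qed

end

section \<open>An invariant metric on a compact metrizable group\<close>

lemma compact_metrizable_group_norm:
  assumes "compact (UNIV :: 'a::topological_ab_group_add set)"
    and "metrizable_space (euclidean :: 'a topology)"
  shows "\<exists>p :: 'a \<Rightarrow> real. compact_normed_group p"
proof -
  interpret compact_ab_group "TYPE('a)" by standard (rule assms)
  obtain M d where M: "Metric_space M d" "(euclidean :: 'a topology) = Metric_space.mtopology M d"
    using assms(2) unfolding metrizable_space_def by blast
  have "M = UNIV" using Metric_space.topspace_mtopology[OF M(1)] by (simp flip: M(2))
  then interpret M: Metric_space "UNIV :: 'a set" d using M(1) by simp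
  have mtop: "M.mtopology = euclidean" using M(2) \<open>M = UNIV\<close> by simp
  have ball: "open (M.mball x e)" for x e using M.openin_mball[of x e] by (simp add: mtop)
  \<comment> \<open>Joint continuity, from which the tube lemma gives smallness of
    \<open>d (s + t) t\<close> uniformly in \<open>t\<close>.\<close>
  have d_open: "open {q. d (fst q + snd q) (snd q) < e}" for e
  proof -
    have c: "continuous_map euclidean (mtopology_of (metric (UNIV, d))) h"
      if "continuous_on UNIV h" for h :: "'a \<times> 'a \<Rightarrow> 'a"
      using that by (simp add: mtop)
    have "continuous_map euclidean euclidean (\<lambda>q::'a\<times>'a. mdist (metric (UNIV, d)) (fst q + snd q) (snd q))"
      by (intro continuous_map_mdist c continuous_intros)
    then have "continuous_on UNIV (\<lambda>q::'a\<times>'a. d (fst q + snd q) (snd q))" by simp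
    then show ?thesis by (intro open_Collect_less continuous_on_const)
  qed
  have "\<exists>U. open U \<and> 0 \<in> U \<and> (\<forall>s\<in>U. \<forall>t. d (s + t) t < e)" if "e > 0" for e
    using nbhd_zero_uniform[OF d_open[of e]] that by simp
  note small = this
  \<comment> \<open>This bound makes the supremum that defines \<open>p\<close> meaningful.\<close>
  have "\<exists>B. \<forall>x t. d (x + t) t \<le> B"
  proof -
    obtain U where U: "open U" "0 \<in> U" "\<And>s t. s \<in> U \<Longrightarrow> d (s + t) t < 1" using small[of 1] by auto
    obtain n a where n: "(n::nat) > 0" "\<And>x. \<exists>i<n. x + a i \<in> U"
      using finite_translates_cover[OF U(1,2)] by metis
    have bound: "d x 0 \<le> 1 + (\<Sum>i<n. d (- a i) 0)" for x
    proof -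
      obtain i where i: "i < n" "x + a i \<in> U" using n by blast
      have "d x 0 \<le> d x (- a i) + d (- a i) 0" by (rule M.triangle) auto
      moreover have "d x (- a i) < 1" using U(3)[OF i(2), of "- a i"] by simp
      moreover have "d (- a i) 0 \<le> (\<Sum>i<n. d (- a i) 0)"
        by (rule member_le_sum) (use i in auto)
      ultimately show ?thesis by simp
    qed
    have "d (x + t) t \<le> 2 * (1 + (\<Sum>i<n. d (- a i) 0))" for x t
      using M.triangle[of "x + t" 0 t] M.commute[of 0 t] bound[of "x + t"] bound[of t] by simp
    then show ?thesis by blast
  qed
  then obtain B where B: "\<And>x t. d (x + t) t \<le> B" by blast
  \<comment> \<open>Taking the supremum of the distance over all translates makes it invariant, and
    uniformity in \<open>t\<close> keeps the topology.\<close>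
  define p where "p x = (SUP t. d (x + t) t)" for x
  have le_p: "d (x + t) t \<le> p x" for x t
    unfolding p_def by (intro cSUP_upper bdd_aboveI[of _ B]) (auto simp: B)
  have p_le: "p x \<le> e" if "\<And>t. d (x + t) t \<le> e" for x e
    unfolding p_def by (intro cSUP_least) (auto simp: that)
  have p_0: "p 0 = 0" using p_le[of 0 0] le_p[of 0 0] by simp
  have p_minus_le: "p (- x) \<le> p x" for x
  proof (rule p_le)
    fix t show "d (- x + t) t \<le> p x"
      using le_p[of x "- x + t"] M.commute[of t "- x + t"] by simp
  qed
  have p_tri: "p (x + y) \<le> p x + p y" for x y
  proof (rule p_le)
    fix t
    show "d (x + y + t) t \<le> p x + p y"
      using M.triangle[of "x + y + t" "y + t" t] le_p[of x "y + t"] le_p[of y t] by (simp add: add.assoc)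
  qed
  have p_nbhd: "\<exists>U. open U \<and> 0 \<in> U \<and> (\<forall>s\<in>U. p s < e)" if e: "e > 0" for e
  proof -
    obtain U where U: "open U" "0 \<in> U" "\<And>s t. s \<in> U \<Longrightarrow> d (s + t) t < e / 2"
      using small[of "e / 2"] e by auto
    have "p s < e" if "s \<in> U" for s
      using p_le[of s "e / 2"] U(3)[OF that] e by (fastforce intro: less_imp_le)
    then show ?thesis using U(1,2) by blast
  qed
  have "compact_normed_group p"
  proof
    show "p 0 = 0" by (rule p_0)
    show "x = 0" if "p x = 0" for x
    proof -
      have "d x 0 \<le> 0" using le_p[of x 0] that by simp
      then show ?thesis using M.nonneg[of x 0] M.zero[of x 0] by simp
    qed
    show "p (- x) = p x" for x using p_minus_le[of x] p_minus_le[of "- x"] by simp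
    show "p (x + y) \<le> p x + p y" for x y by (rule p_tri)
    show "open {x. p x < e}" for e
    proof (subst open_subopen, rule ballI)
      fix x assume "x \<in> {x. p x < e}"
      then obtain U where U: "open U" "0 \<in> U" "\<And>s. s \<in> U \<Longrightarrow> p s < e - p x"
        using p_nbhd[of "e - p x"] by auto
      have "open ((\<lambda>y. y - x) -` U)" by (intro open_vimage U continuous_intros)
      moreover have "p y < e" if "y - x \<in> U" for y
        using p_tri[of "y - x" x] U(3)[OF that] by simp
      ultimately show "\<exists>T. open T \<and> x \<in> T \<and> T \<subseteq> {x. p x < e}"
        using U(2) by (intro exI[of _ "(\<lambda>y. y - x) -` U"]) auto
    qed
    show "\<exists>e>0. \<forall>x. p x < e \<longrightarrow> x \<in> U" if U: "open U" "0 \<in> U" for U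
    proof -
      have "openin M.mtopology U" using U by (simp add: mtop)
      then obtain e where e: "e > 0" "M.mball 0 e \<subseteq> U"
        using U(2) unfolding M.openin_mtopology by blast
      have "x \<in> U" if "p x < e" for x
        using le_p[of x 0] that M.commute[of x 0] e(2) by (auto simp: M.mball_def)
      then show ?thesis using e(1) by blast
    qed
  qed
  then show ?thesis by blast
qed

text \<open>The negative statements are guarded by the existence of a nonzero element: for the
  trivial group \<open>F0\<close> is a single point, which is a Schwartz group, has the Schur
  property and respects compactness.\<close>

theorem theorem1p11:
  assumes "compact (UNIV :: 'x::topological_ab_group_add set)"
    and "connected (UNIV :: 'x set)"
    and "metrizable_space (euclidean :: 'x topology)"
  shows
    "(monothetic TYPE('x F0) \<and> connected (UNIV :: 'x F0 set) \<and> polish TYPE('x F0) \<and>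
        ((\<exists>x::'x. x \<noteq> 0) \<longrightarrow> \<not> schwartz_group TYPE('x F0))) \<and>
     (MAP_group TYPE('x F0) \<and>
        ((\<exists>x::'x. x \<noteq> 0) \<longrightarrow>
          \<not> schur_property TYPE('x F0) \<and> \<not> respects_compactness TYPE('x F0))) \<and>
     g_closed (null_sequences :: (nat \<Rightarrow> 'x F0) set)"
proof -
  obtain p :: "'x \<Rightarrow> real" where "compact_normed_group p"
    using compact_metrizable_group_norm[OF assms(1,3)] by blast
  then interpret compact_normed_group "TYPE('x)" p .
  have "\<not> schwartz_group TYPE('x F0)" if "(x::'x) \<noteq> 0" for x
    using characters_separate_zero[OF that] not_schwartz_F0[OF assms(2)] by blast
  then show ?thesis
    using monothetic_F0[OF assms(2)] connected_F0[OF assms(2)] polish_F0 MAP_F0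
      not_schur_F0[OF assms(2)] not_respects_compactness_F0[OF assms(2)] g_closed_null_sequences
    by blast
qed

end
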